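(* Let $\mathcal R$ be a strong CCTRS and $s\in\mathcal T(\mathcal G)$ a ground labeled term. (1) If $\zeta(s)$ is terminating with respect to $\to_{\Xi(\mathcal R),\mu}$ and there is a context-sensitive reduction $\zeta(s)\to^*_{\Xi(\mathcal R),\mu}t$ with cost $N$ for some $t$, then there is a complexity-conscious reduction $s\rightharpoonup^* t'$ for some $t'$ with cost at least $N$. (2) If there is an infinite $(\Xi(\mathcal R),\mu)$-reduction starting from $\zeta(s)$, then $s\rightharpoonup^\infty$.
   Context: A CCTRS over $\mathcal F$ is a set $\mathcal R$ of conditional rules each of the form $f(\ell_1,\dots,\ell_n)\to r\Leftarrow a_1\approx b_1,\dots,a_k\approx b_k$ (defined symbols are roots of left-hand sides, others constructors; constructor terms contain only constructors and variables) where $\ell_1,\dots,\ell_n,b_1,\dots,b_k$ are constructor terms, the terms $f(\ell_1,\dots,\ell_n),b_1,\dots,b_k$ pairwise share no variables, $\mathrm{Var}(r)\subseteq\mathrm{Var}(\ell_1,\dots,\ell_n,b_1,\dots,b_k)$, and $\mathrm{Var}(a_i)\subseteq\mathrm{Var}(\ell_1,\dots,\ell_n,b_1,\dots,b_{i-1})$. $\mathcal R{\restriction}f$ is the set of rules with left-hand root $f$. A strong CCTRS is a CCTRS with each $\mathcal R{\restriction}f$ finite and each $f(\ell_1,\dots,\ell_n)$ and $b_j$ linear. Let $m_f=|\mathcal R{\restriction}f|$ (0 for constructors), with fixed enumeration $\rho^f_1,\dots,\rho^f_{m_f}$. Labeled reduction: $\mathcal G$ consists of the constructors and symbols $f_R$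 ($R\subseteq\mathcal R{\restriction}f$, same arity as $f$); $\mathrm{label}$ replaces each defined $f$ by $f_{\mathcal R\restriction f}$; $\mathrm{erase}$ removes labels; labeled normal forms are terms over constructors, symbols $f_\emptyset$ and variables. $s\rightharpoonup t$ is defined inductively: either (i, "$\bot$-step") there are $p$ and a rule $\rho\colon\ell\to r\Leftarrow c$ with $s|_p=f_R(s_1,\dots,s_n)$, $\rho\in R$, $t=s[f_{R\setminus\{\rho\}}(s_1,\dots,s_n)]_p$, and linear labeled normal forms $u_1,\dots,u_n$ on fresh variables and $\sigma$ with $s|_p=f_R(u_1,\dots,u_n)\sigma$ and $f(\mathrm{erase}(u_1),\dots,\mathrm{erase}(u_n))$ not unifiable with $\ell$; or (ii) there are $p$, $\rho\colon f(\ell_1,\dots,\ell_n)\to r\Leftarrow a_1\approx b_1,\dots,a_k\approx b_k$, $\sigma$, $0\le j\le k$ with $s|_p=f_R(\ell_1\sigma,\dots,\ell_n\sigma)$, $\rho\in R$, $\mathrm{label}(a_i)\sigma\rightharpoonup^*b_i\sigma$ for $1\le i\le j$, and either (successful) $j=k$, $t=s[\mathrm{label}(r)\sigma]_p$, or (failed) $j<k$, $\mathrm{label}(a_{j+1})\sigma\rightharpoonup^*u\tau$ for a linear labeled normal form $u$ with $\mathrm{erase}(u)$ not unifiable with $b_{j+1}$, and $t=s[f_{R\setminus\{\rho\}}(\ell_1\sigma,\dots,\ell_n\sigma)]_p$. A complexity-conscious reduction is a labeled reduction together with chosen witnessing condition reductions; its cost is the sum of its step costs, where a $\bot$-step costs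 $0$, a successful step costs $1$ plus the costs of the $k$ condition reductions, and a failed step costs the sum of the costs of the $j$ condition reductions and of $\mathrm{label}(a_{j+1})\sigma\rightharpoonup^*u\tau$. $s\rightharpoonup_\rhd t$ if there are $p$, $\rho$ as in (ii), $\sigma$, $0\le j<k$ with $s|_p=f_R(\ell_1\sigma,\dots,\ell_n\sigma)$, $\rho\in R$, $\mathrm{label}(a_i)\sigma\rightharpoonup^*b_i\sigma$ for $i\le j$, and $t=\mathrm{label}(a_{j+1})\sigma$; $s\rightharpoonup^\infty$ means an infinite sequence of $\rightharpoonup\cup\rightharpoonup_\rhd$ steps from $s$. The transformed system: signature $\mathcal H$ with constants $\bot,\top$ ($\mu=\emptyset$); every $f\in\mathcal F$ of arity $n$ as a symbol of arity $n+m_f$ with $\mu(f)=\{1,\dots,n\}$; and for every defined $f$ of arity $n$, every $\rho^f_i$ with $k>0$ conditions and $1\le j\le k$ a symbol $f_i^j$ of arity $n+m_f+j-1$ with $\mu(f_i^j)=\{n+i+j-1\}$. A position is active in $t$ if it is $\epsilon$ or $iq$ with $i\in\mu(\mathrm{root}(t))$ and $q$ active in $t|_i$; $\to_{\Xi(\mathcal R),\mu}$ rewrites only at active positions. $\xi_\star$ ($\star\in\{\bot,\top\}$): identity on variables, homomorphic on constructors, $f(t_1..t_n)\mapsto f(\xi_\star(t_1),\dots,\xi_\star(t_n),\star,\dots,\star)$ ($m_f$ copies) for defined $f$; $\bot$-patterns are linear terms $\xi_\bot(t)$. For a linear constructor term $t$: $\mathrm{AP}(x)=\emptyset$, and $\mathrm{AP}(f(t_1,\dots,t_n))$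 consists of $g(x_1,\dots,x_m)$ for every constructor $g\neq f$ of arity $m$, $g(x_1,\dots,x_m,\bot,\dots,\bot)$ for every defined $g$ of arity $m$, and $f(x_1,\dots,x_{i-1},u,x_{i+1},\dots,x_n)$ for $u\in\mathrm{AP}(t_i)$ (fresh distinct $x$'s). Notation: $\langle t_1,\dots,t_n\rangle[u_1,\dots,u_j]_i$ is $t_1,\dots,t_{i-1},u_1,\dots,u_j,t_{i+1},\dots,t_n$. For the $i$-th rule $\rho_i\colon f(\vec\ell)\to r\Leftarrow a_1\approx b_1,\dots,a_k\approx b_k$ of $\mathcal R{\restriction}f$ and fresh distinct $x_1,\dots,x_{m_f},y_1,\dots,y_n$, $\Xi(\mathcal R)$ contains: $(1)$ if $k=0$: $f(\vec\ell,\langle\vec x\rangle[\top]_i)\to\xi_\top(r)$; if $k>0$: $(2)$ $f(\vec\ell,\langle\vec x\rangle[\top]_i)\to f_i^1(\vec\ell,\langle\vec x\rangle[\xi_\top(a_1)]_i)$, $(3)$ $f_i^k(\vec\ell,\langle\vec x\rangle[b_1,\dots,b_k]_i)\to\xi_\top(r)$, $(4)$ for $1\le j<k$: $f_i^j(\vec\ell,\langle\vec x\rangle[b_1,\dots,b_j]_i)\to f_i^{j+1}(\vec\ell,\langle\vec x\rangle[b_1,\dots,b_j,\xi_\top(a_{j+1})]_i)$, $(5)$ for $1\le j\le k$ and $v\in\mathrm{AP}(b_j)$ (fresh variables): $f_i^j(\vec\ell,\langle\vec x\rangle[b_1,\dots,b_{j-1},v]_i)\to f(\vec\ell,\langle\vec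 x\rangle[\bot]_i)$; and for any $k$: $(6)$ for $1\le j\le n$ and $v\in\mathrm{AP}(\ell_j)$ (fresh variables): $f(\langle\vec y\rangle[v]_j,\langle\vec x\rangle[\top]_i)\to f(\langle\vec y\rangle[v]_j,\langle\vec x\rangle[\bot]_i)$. The cost of a $(\Xi(\mathcal R),\mu)$-reduction is the number of steps using rules of type (1) or (3). The map $\zeta\colon\mathcal T(\mathcal G,\mathcal V)\to\mathcal T(\mathcal H,\mathcal V)$: identity on variables, homomorphic on constructors, $\zeta(f_R(t_1,\dots,t_n))=f(\zeta(t_1),\dots,\zeta(t_n),c_1,\dots,c_{m_f})$ with $c_i=\top$ iff $\rho^f_i\in R$, else $\bot$. *)

theory Defs
  imports Main
begin

datatype ('f, 'v) "term" = Var 'v | Fun 'f "('f, 'v) term list"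

fun vars :: "('f, 'v) term \<Rightarrow> 'v set" where
  "vars (Var x) = {x}"
| "vars (Fun f ts) = \<Union> (set (map vars ts))"

fun subst :: "('f, 'v) term \<Rightarrow> ('v \<Rightarrow> ('f, 'w) term) \<Rightarrow> ('f, 'w) term" where
  "subst (Var x) \<sigma> = \<sigma> x"
| "subst (Fun f ts) \<sigma> = Fun f (map (\<lambda>t. subst t \<sigma>) ts)"

fun smap :: "('f \<Rightarrow> 'g) \<Rightarrow> ('f, 'v) term \<Rightarrow> ('g, 'v) term" where
  "smap g (Var x) = Var x"
| "smap g (Fun f ts) = Fun (g f) (map (smap g) ts)"

fun all_syms :: "('f \<Rightarrow> nat \<Rightarrow> bool) \<Rightarrow> ('f, 'v) term \<Rightarrow> bool" where
  "all_syms P (Var x) = True"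
| "all_syms P (Fun f ts) = (P f (length ts) \<and> (\<forall>t \<in> set ts. all_syms P t))"

fun linear_term :: "('f, 'v) term \<Rightarrow> bool" where
  "linear_term (Var x) = True"
| "linear_term (Fun f ts) = ((\<forall>t \<in> set ts. linear_term t) \<and>
     (\<forall>i < length ts. \<forall>j < length ts. i \<noteq> j \<longrightarrow> vars (ts ! i) \<inter> vars (ts ! j) = {}))"

definition unifiable :: "('f, 'v) term \<Rightarrow> ('f, 'v) term \<Rightarrow> bool" where
  "unifiable s t \<longleftrightarrow> (\<exists>\<sigma> :: 'v \<Rightarrow> ('f, 'v) term. subst s \<sigma> = subst t \<sigma>)"

fun is_pos :: "('f, 'v) term \<Rightarrow> nat list \<Rightarrow> bool" where
  "is_pos t [] = True"
| "is_pos (Var x) (i # p) = False"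
| "is_pos (Fun f ts) (i # p) = (i < length ts \<and> is_pos (ts ! i) p)"

fun subt_at :: "('f, 'v) term \<Rightarrow> nat list \<Rightarrow> ('f, 'v) term" where
  "subt_at t [] = t"
| "subt_at (Var x) (i # p) = Var x"
| "subt_at (Fun f ts) (i # p) = subt_at (ts ! i) p"

fun replace_at :: "('f, 'v) term \<Rightarrow> nat list \<Rightarrow> ('f, 'v) term \<Rightarrow> ('f, 'v) term" where
  "replace_at t [] u = u"
| "replace_at (Var x) (i # p) u = Var x"
| "replace_at (Fun f ts) (i # p) u = Fun f (ts[i := replace_at (ts ! i) p u])"

text \<open>A conditional rule  l \<rightarrow> r \<Leftarrow> a1 \<approx> b1, ..., ak \<approx> bk  is (l, r, [(a1,b1),...,(ak,bk)]).
  The CCTRS over signature 'f (with arities ar) is given by the enumerations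
  rules f = [\<rho>^f_1, ..., \<rho>^f_{m_f}] of R restricted to f; R is the union of all of them.\<close>
type_synonym ('f, 'v) crule = "('f, 'v) term \<times> ('f, 'v) term \<times> (('f, 'v) term \<times> ('f, 'v) term) list"

definition wf_term :: "('f \<Rightarrow> nat) \<Rightarrow> ('f, 'v) term \<Rightarrow> bool" where
  "wf_term ar t = all_syms (\<lambda>g n. n = ar g) t"

definition is_cterm :: "('f \<Rightarrow> nat) \<Rightarrow> ('f \<Rightarrow> ('f, 'v) crule list) \<Rightarrow> ('f, 'v) term \<Rightarrow> bool" where
  "is_cterm ar rules t = all_syms (\<lambda>g n. n = ar g \<and> rules g = []) t"

definition strong_cctrs :: "('f \<Rightarrow> nat) \<Rightarrow> ('f \<Rightarrow> ('f, 'v) crule list) \<Rightarrow> bool" where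
  "strong_cctrs ar rules \<longleftrightarrow>
    (\<forall>f. distinct (rules f)) \<and>
    (\<forall>f. \<forall>\<rho> \<in> set (rules f). \<exists>ls r cs. \<rho> = (Fun f ls, r, cs) \<and> length ls = ar f \<and>
       (\<forall>l \<in> set ls. is_cterm ar rules l) \<and>
       (\<forall>c \<in> set cs. is_cterm ar rules (snd c) \<and> wf_term ar (fst c)) \<and> wf_term ar r \<and>
       linear_term (Fun f ls) \<and> (\<forall>c \<in> set cs. linear_term (snd c)) \<and>
       (\<forall>i < length cs. vars (snd (cs ! i)) \<inter> vars (Fun f ls) = {}) \<and>
       (\<forall>i < length cs. \<forall>j < length cs. i \<noteq> j \<longrightarrow> vars (snd (cs ! i)) \<inter> vars (snd (cs ! j)) = {}) \<and>
       vars r \<subseteq> vars (Fun f ls) \<union> (\<Union>c \<in> set cs. vars (snd c)) \<and>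
       (\<forall>i < length cs. vars (fst (cs ! i)) \<subseteq> vars (Fun f ls) \<union> (\<Union>j < i. vars (snd (cs ! j)))))"

text \<open>A labeled symbol f_R is the pair (f, R); constructors c are represented as (c, {}).\<close>
type_synonym ('f, 'v) lterm = "('f \<times> ('f, 'v) crule set, 'v) term"

definition label :: "('f \<Rightarrow> ('f, 'v) crule list) \<Rightarrow> ('f, 'v) term \<Rightarrow> ('f, 'v) lterm" where
  "label rules t = smap (\<lambda>f. (f, set (rules f))) t"

definition erase :: "('f, 'v) lterm \<Rightarrow> ('f, 'v) term" where
  "erase t = smap fst t"

text \<open>labeled normal forms: only constructors and symbols f_\<emptyset> (and variables)\<close>
definition lnf :: "('f, 'v) lterm \<Rightarrow> bool" where
  "lnf t = all_syms (\<lambda>g n. snd g = {}) t"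

definition wf_lterm :: "('f \<Rightarrow> nat) \<Rightarrow> ('f \<Rightarrow> ('f, 'v) crule list) \<Rightarrow> ('f, 'v) lterm \<Rightarrow> bool" where
  "wf_lterm ar rules t = all_syms (\<lambda>g n. n = ar (fst g) \<and> snd g \<subseteq> set (rules (fst g))) t"

text \<open>lstep rules s t c: s \<rightharpoonup> t by a step of cost c (with chosen witnessing condition reductions);
  lsteps rules s t c: a complexity-conscious reduction s \<rightharpoonup>* t of cost c.\<close>
inductive lstep :: "('f \<Rightarrow> ('f, 'v) crule list) \<Rightarrow> ('f, 'v) lterm \<Rightarrow> ('f, 'v) lterm \<Rightarrow> nat \<Rightarrow> bool"
  and lsteps :: "('f \<Rightarrow> ('f, 'v) crule list) \<Rightarrow> ('f, 'v) lterm \<Rightarrow> ('f, 'v) lterm \<Rightarrow> nat \<Rightarrow> bool"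
  for rules where
  bot_step: "\<lbrakk> is_pos s p; subt_at s p = Fun (f, R) ss; \<rho> \<in> R;
      linear_term (Fun (f, R) us); \<forall>u \<in> set us. lnf u;
      vars (Fun (f, R) us) \<inter> vars (fst \<rho>) = {};
      subt_at s p = subst (Fun (f, R) us) \<sigma>;
      \<not> unifiable (Fun f (map erase us)) (fst \<rho>) \<rbrakk>
    \<Longrightarrow> lstep rules s (replace_at s p (Fun (f, R - {\<rho>}) ss)) 0"
| succ_step: "\<lbrakk> is_pos s p; \<rho> \<in> R; \<rho> = (Fun f ls, r, cs);
      subt_at s p = Fun (f, R) (map (\<lambda>l. subst (label rules l) \<sigma>) ls);
      length ks = length cs;
      \<forall>i < length cs. lsteps rules (subst (label rules (fst (cs ! i))) \<sigma>)
                                   (subst (label rules (snd (cs ! i))) \<sigma>) (ks ! i) \<rbrakk>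
    \<Longrightarrow> lstep rules s (replace_at s p (subst (label rules r) \<sigma>)) (Suc (sum_list ks))"
| fail_step: "\<lbrakk> is_pos s p; \<rho> \<in> R; \<rho> = (Fun f ls, r, cs);
      subt_at s p = Fun (f, R) (map (\<lambda>l. subst (label rules l) \<sigma>) ls);
      j < length cs; length ks = j;
      \<forall>i < j. lsteps rules (subst (label rules (fst (cs ! i))) \<sigma>)
                          (subst (label rules (snd (cs ! i))) \<sigma>) (ks ! i);
      lsteps rules (subst (label rules (fst (cs ! j))) \<sigma>) (subst u \<tau>) c;
      linear_term u; lnf u; vars u \<inter> vars (snd (cs ! j)) = {};
      \<not> unifiable (erase u) (snd (cs ! j)) \<rbrakk>
    \<Longrightarrow> lstep rules s (replace_at s p (Fun (f, R - {\<rho>}) (map (\<lambda>l. subst (label rules l) \<sigma>) ls)))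
          (sum_list ks + c)"
| lsteps_refl: "lsteps rules s s 0"
| lsteps_step: "\<lbrakk> lstep rules s u c1; lsteps rules u t c2 \<rbrakk> \<Longrightarrow> lsteps rules s t (c1 + c2)"

definition lstep_cond :: "('f \<Rightarrow> ('f, 'v) crule list) \<Rightarrow> ('f, 'v) lterm \<Rightarrow> ('f, 'v) lterm \<Rightarrow> bool" where
  "lstep_cond rules s t \<longleftrightarrow> (\<exists>p \<rho> R f ls r cs \<sigma> j. is_pos s p \<and> \<rho> \<in> R \<and> \<rho> = (Fun f ls, r, cs) \<and>
      subt_at s p = Fun (f, R) (map (\<lambda>l. subst (label rules l) \<sigma>) ls) \<and> j < length cs \<and>
      (\<forall>i < j. \<exists>c. lsteps rules (subst (label rules (fst (cs ! i))) \<sigma>)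
                                (subst (label rules (snd (cs ! i))) \<sigma>) c) \<and>
      t = subst (label rules (fst (cs ! j))) \<sigma>)"

definition linf :: "('f \<Rightarrow> ('f, 'v) crule list) \<Rightarrow> ('f, 'v) lterm \<Rightarrow> bool" where
  "linf rules s \<longleftrightarrow> (\<exists>g. g 0 = s \<and>
     (\<forall>i. (\<exists>c. lstep rules (g i) (g (Suc i)) c) \<or> lstep_cond rules (g i) (g (Suc i))))"

text \<open>Symbols of H. Cond f i j (0-based i < m_f, 0-based j < k) stands for the paper's f_{i+1}^{j+1}.\<close>
datatype 'f hsym = HBot | HTop | Orig 'f | Cond 'f nat nat

fun mu :: "('f \<Rightarrow> nat) \<Rightarrow> 'f hsym \<Rightarrow> nat set" where
  "mu ar HBot = {}"
| "mu ar HTop = {}"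
| "mu ar (Orig f) = {..< ar f}"
| "mu ar (Cond f i j) = {ar f + i + j}"

fun active :: "('f \<Rightarrow> nat) \<Rightarrow> ('f hsym, 'v) term \<Rightarrow> nat list \<Rightarrow> bool" where
  "active ar t [] = True"
| "active ar (Var x) (i # p) = False"
| "active ar (Fun g ts) (i # p) = (i \<in> mu ar g \<and> i < length ts \<and> active ar (ts ! i) p)"

fun xi :: "('f \<Rightarrow> ('f, 'v) crule list) \<Rightarrow> 'f hsym \<Rightarrow> ('f, 'v) term \<Rightarrow> ('f hsym, 'v) term" where
  "xi rules st (Var x) = Var x"
| "xi rules st (Fun f ts) = Fun (Orig f) (map (xi rules st) ts @ replicate (length (rules f)) (Fun st []))"

definition ins_at :: "'a list \<Rightarrow> nat \<Rightarrow> 'a list \<Rightarrow> 'a list" where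
  "ins_at xs i us = take i xs @ us @ drop (Suc i) xs"

text \<open>anti-patterns AP(t); variables are arbitrary here, linearity/freshness is imposed on the
  whole left-hand side of the rules of \<Xi>(R) below\<close>
inductive ap :: "('f \<Rightarrow> nat) \<Rightarrow> ('f \<Rightarrow> ('f, 'v) crule list) \<Rightarrow> ('f, 'v) term \<Rightarrow> ('f hsym, 'v) term \<Rightarrow> bool"
  for ar rules where
  ap_con: "\<lbrakk> rules g = []; g \<noteq> f; length xs = ar g \<rbrakk>
    \<Longrightarrow> ap ar rules (Fun f ts) (Fun (Orig g) (map Var xs))"
| ap_def: "\<lbrakk> rules g \<noteq> []; length xs = ar g \<rbrakk>
    \<Longrightarrow> ap ar rules (Fun f ts) (Fun (Orig g) (map Var xs @ replicate (length (rules g)) (Fun HBot [])))"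
| ap_arg: "\<lbrakk> i < length ts; length xs = length ts; ap ar rules (ts ! i) u \<rbrakk>
    \<Longrightarrow> ap ar rules (Fun f ts) (Fun (Orig f) ((map Var xs)[i := u]))"

text \<open>xi_rule ar rules l r c: l \<rightarrow> r is a rule of \<Xi>(R); c = 1 for rules of type (1) and (3),
  c = 0 otherwise. All choices of fresh distinct variables are included (the lhs is required to
  be linear, which expresses freshness/distinctness).\<close>
inductive xi_rule :: "('f \<Rightarrow> nat) \<Rightarrow> ('f \<Rightarrow> ('f, 'v) crule list) \<Rightarrow> ('f hsym, 'v) term \<Rightarrow> ('f hsym, 'v) term \<Rightarrow> nat \<Rightarrow> bool"
  for ar rules where
  type1: "\<lbrakk> i < length (rules f); rules f ! i = (Fun f ls, r, cs); cs = [];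
      length xs = length (rules f);
      lhs = Fun (Orig f) (map (xi rules HTop) ls @ ins_at (map Var xs) i [Fun HTop []]);
      linear_term lhs \<rbrakk>
    \<Longrightarrow> xi_rule ar rules lhs (xi rules HTop r) 1"
| type2: "\<lbrakk> i < length (rules f); rules f ! i = (Fun f ls, r, cs); cs \<noteq> [];
      length xs = length (rules f);
      lhs = Fun (Orig f) (map (xi rules HTop) ls @ ins_at (map Var xs) i [Fun HTop []]);
      linear_term lhs \<rbrakk>
    \<Longrightarrow> xi_rule ar rules lhs
          (Fun (Cond f i 0) (map (xi rules HTop) ls @ ins_at (map Var xs) i [xi rules HTop (fst (cs ! 0))])) 0"
| type3: "\<lbrakk> i < length (rules f); rules f ! i = (Fun f ls, r, cs); cs \<noteq> [];
      length xs = length (rules f);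
      lhs = Fun (Cond f i (length cs - 1))
              (map (xi rules HTop) ls @ ins_at (map Var xs) i (map (\<lambda>c. xi rules HTop (snd c)) cs));
      linear_term lhs \<rbrakk>
    \<Longrightarrow> xi_rule ar rules lhs (xi rules HTop r) 1"
| type4: "\<lbrakk> i < length (rules f); rules f ! i = (Fun f ls, r, cs); Suc j < length cs;
      length xs = length (rules f);
      lhs = Fun (Cond f i j)
              (map (xi rules HTop) ls @ ins_at (map Var xs) i (map (\<lambda>c. xi rules HTop (snd c)) (take (Suc j) cs)));
      linear_term lhs \<rbrakk>
    \<Longrightarrow> xi_rule ar rules lhs
          (Fun (Cond f i (Suc j))
             (map (xi rules HTop) ls @ ins_at (map Var xs) i
                (map (\<lambda>c. xi rules HTop (snd c)) (take (Suc j) cs) @ [xi rules HTop (fst (cs ! Suc j))]))) 0"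
| type5: "\<lbrakk> i < length (rules f); rules f ! i = (Fun f ls, r, cs); j < length cs;
      ap ar rules (snd (cs ! j)) v;
      length xs = length (rules f);
      lhs = Fun (Cond f i j)
              (map (xi rules HTop) ls @ ins_at (map Var xs) i (map (\<lambda>c. xi rules HTop (snd c)) (take j cs) @ [v]));
      linear_term lhs \<rbrakk>
    \<Longrightarrow> xi_rule ar rules lhs
          (Fun (Orig f) (map (xi rules HTop) ls @ ins_at (map Var xs) i [Fun HBot []])) 0"
| type6: "\<lbrakk> i < length (rules f); rules f ! i = (Fun f ls, r, cs); j < length ls;
      ap ar rules (ls ! j) v; length ys = length ls;
      length xs = length (rules f);
      lhs = Fun (Orig f) ((map Var ys)[j := v] @ ins_at (map Var xs) i [Fun HTop []]);
      linear_term lhs \<rbrakk>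
    \<Longrightarrow> xi_rule ar rules lhs
          (Fun (Orig f) ((map Var ys)[j := v] @ ins_at (map Var xs) i [Fun HBot []])) 0"

definition hstep :: "('f \<Rightarrow> nat) \<Rightarrow> ('f \<Rightarrow> ('f, 'v) crule list) \<Rightarrow> ('f hsym, 'v) term \<Rightarrow> ('f hsym, 'v) term \<Rightarrow> nat \<Rightarrow> bool" where
  "hstep ar rules s t c \<longleftrightarrow> (\<exists>l r p \<sigma>. xi_rule ar rules l r c \<and> is_pos s p \<and> active ar s p \<and>
      subt_at s p = subst l \<sigma> \<and> t = replace_at s p (subst r \<sigma>))"

inductive hsteps :: "('f \<Rightarrow> nat) \<Rightarrow> ('f \<Rightarrow> ('f, 'v) crule list) \<Rightarrow> ('f hsym, 'v) term \<Rightarrow> ('f hsym, 'v) term \<Rightarrow> nat \<Rightarrow> bool"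
  for ar rules where
  hsteps_refl: "hsteps ar rules s s 0"
| hsteps_step: "\<lbrakk> hstep ar rules s u c1; hsteps ar rules u t c2 \<rbrakk> \<Longrightarrow> hsteps ar rules s t (c1 + c2)"

definition hinf :: "('f \<Rightarrow> nat) \<Rightarrow> ('f \<Rightarrow> ('f, 'v) crule list) \<Rightarrow> ('f hsym, 'v) term \<Rightarrow> bool" where
  "hinf ar rules s \<longleftrightarrow> (\<exists>g. g 0 = s \<and> (\<forall>i. \<exists>c. hstep ar rules (g i) (g (Suc i)) c))"

definition hterminating :: "('f \<Rightarrow> nat) \<Rightarrow> ('f \<Rightarrow> ('f, 'v) crule list) \<Rightarrow> ('f hsym, 'v) term \<Rightarrow> bool" where
  "hterminating ar rules s \<longleftrightarrow> \<not> hinf ar rules s"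

fun zeta :: "('f \<Rightarrow> ('f, 'v) crule list) \<Rightarrow> ('f, 'v) lterm \<Rightarrow> ('f hsym, 'v) term" where
  "zeta rules (Var x) = Var x"
| "zeta rules (Fun (f, R) ts) = Fun (Orig f)
     (map (zeta rules) ts @ map (\<lambda>\<rho>. if \<rho> \<in> R then Fun HTop [] else Fun HBot []) (rules f))"

end

(* A context-sensitive reduction may suspend the evaluation of conditions in several subterms and then
   copy, move or erase these subterms. The labeled reduction postpones a suspended evaluation
   until it is decided, so that every copy may be continued differently; the cost already spent on it
   is recorded as pending. When a copy is about to be erased, its pending cost is realised first: termination lets
   the suspended evaluation be completed, since a context-sensitive normal form is the
   image of a labeled normal form, on which every condition either matches or hits an anti-pattern.
   For infinite reductions no costs matter. Every step is matched by labeled steps or only advances a suspended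
   evaluation, and that evaluation is simulated from the instantiated condition, which lies below the
   term in the order used for linf. Well-founded induction along this order shows that a term
   without infinite labeled reduction has no infinite context-sensitive one. *)
theory Submission
  imports Defs
begin

section \<open>Terms, substitutions and labeled reductions\<close>

text \<open>The obstacle is that one substitution \<open>\<sigma>'\<close> must serve the
  rolled-back left-hand side and all its conditions. A value already used in a condition cannot be
  advanced without invalidating the recorded condition reductions, so its pending cost has to be
  charged to the copy inside the condition; this is why \<open>sim_cond\<close> removes
  \<open>avars cs (Suc j)\<close> from its last sum. The other values can still be advanced: inside
  the left-hand side before a successful step, or at the end of the condition reduction whose
  pattern binds them. Copying only multiplies pending costs, so inequalities between sums over
  variable sets suffice. A second obstacle is that matched values become frozen in inactive
  arguments of \<open>Cond\<close>, where termination of the surrounding term no longer gives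
  information about them. Hence \<open>sim_cond\<close> stores \<open>pays\<close> for each of them;
  it is established at the moment of matching, while they are still active.\<close>

lemma subst_cong: "(\<And>x. x \<in> vars t \<Longrightarrow> \<sigma> x = \<tau> x) \<Longrightarrow> subst t \<sigma> = subst t \<tau>"
  by (induction t) auto

lemma subst_eqD: "subst t \<sigma> = subst t \<tau> \<Longrightarrow> x \<in> vars t \<Longrightarrow> \<sigma> x = \<tau> x"
  by (induction t) auto

lemma finite_vars: "finite (vars t)"
  by (induction t) auto

lemma label_simps [simp]:
  "label rules (Var x) = Var x"
  "label rules (Fun f ts) = Fun (f, set (rules f)) (map (label rules) ts)"
  by (simp_all add: label_def[abs_def])

lemma erase_simps [simp]:
  "erase (Var x) = Var x"
  "erase (Fun g ts) = Fun (fst g) (map erase ts)"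
  by (simp_all add: erase_def[abs_def])

lemma lnf_simps [simp]:
  "lnf (Var x)"
  "lnf (Fun g ts) \<longleftrightarrow> snd g = {} \<and> (\<forall>t\<in>set ts. lnf t)"
  by (simp_all add: lnf_def)

lemma wf_lterm_simps [simp]:
  "wf_lterm ar rules (Var x)"
  "wf_lterm ar rules (Fun g ts) \<longleftrightarrow> length ts = ar (fst g) \<and> snd g \<subseteq> set (rules (fst g)) \<and>
     (\<forall>t\<in>set ts. wf_lterm ar rules t)"
  by (auto simp add: wf_lterm_def)

lemma wf_term_simps [simp]:
  "wf_term ar (Var x)"
  "wf_term ar (Fun g ts) \<longleftrightarrow> length ts = ar g \<and> (\<forall>t\<in>set ts. wf_term ar t)"
  by (auto simp add: wf_term_def)

lemma is_cterm_simps [simp]: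
  "is_cterm ar rules (Var x)"
  "is_cterm ar rules (Fun g ts) \<longleftrightarrow> length ts = ar g \<and> rules g = [] \<and> (\<forall>t\<in>set ts. is_cterm ar rules t)"
  by (auto simp add: is_cterm_def)

lemma is_cterm_imp_wf_term: "is_cterm ar rules t \<Longrightarrow> wf_term ar t"
  by (induction t) auto

lemma vars_label [simp]: "vars (label rules t) = vars t"
  by (induction t) auto

lemma vars_xi [simp]: "vars (xi rules (st :: 'f hsym) t) = vars t" if "st \<in> {HTop, HBot}"
  by (induction t) auto

section \<open>Subadditivity of sums over sets of variables\<close>

lemma sum_Un_le:
  fixes p :: "'a \<Rightarrow> nat"
  assumes "finite A" "finite B"
  shows "sum p (A \<union> B) \<le> sum p A + sum p B"
  using sum.union_inter[OF assms, of p] by simp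

lemma sum_UN_le:
  fixes p :: "'a \<Rightarrow> nat"
  assumes "finite I" "\<And>i. i \<in> I \<Longrightarrow> finite (A i)"
  shows "sum p (\<Union>i\<in>I. A i) \<le> (\<Sum>i\<in>I. sum p (A i))"
  using assms
proof (induction I rule: finite_induct)
  case (insert i I)
  have "sum p (A i \<union> (\<Union>i\<in>I. A i)) \<le> sum p (A i) + sum p (\<Union>i\<in>I. A i)"
    using insert by (intro sum_Un_le) auto
  then show ?case using insert by auto
qed simp

text \<open>The form with \<open>sorted_wrt\<close> unfolds along \<open>#\<close> and
  \<open>@\<close>, which fits argument lists assembled by \<open>ins_at\<close>; the symmetric
  version with indices is recovered in \<open>pdisj_nth\<close>.\<close>

definition pdisj :: "('f, 'v) term list \<Rightarrow> bool" where
  "pdisj ts = sorted_wrt (\<lambda>s t. vars s \<inter> vars t = {}) ts"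

lemma pdisj_simps [simp]:
  "pdisj []"
  "pdisj (t # ts) \<longleftrightarrow> (\<forall>u\<in>set ts. vars t \<inter> vars u = {}) \<and> pdisj ts"
  "pdisj (ts @ us) \<longleftrightarrow> pdisj ts \<and> pdisj us \<and> (\<forall>t\<in>set ts. \<forall>u\<in>set us. vars t \<inter> vars u = {})"
  by (auto simp: pdisj_def sorted_wrt_append)

lemma pdisj_ground: "(\<And>t. t \<in> set ts \<Longrightarrow> vars t = {}) \<Longrightarrow> pdisj ts"
  by (induction ts) auto

lemma pdisj_nth:
  "pdisj ts \<longleftrightarrow> (\<forall>i<length ts. \<forall>j<length ts. i \<noteq> j \<longrightarrow> vars (ts ! i) \<inter> vars (ts ! j) = {})"
proof
  assume *: "pdisj ts"
  have "vars (ts ! i) \<inter> vars (ts ! j) = {}" if "i < length ts" "j < length ts" "i \<noteq> j" for i j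
  proof (cases "i < j")
    case True
    then show ?thesis using * that by (auto simp: pdisj_def sorted_wrt_iff_nth_less)
  next
    case False
    then have "vars (ts ! j) \<inter> vars (ts ! i) = {}"
      using * that by (auto simp: pdisj_def sorted_wrt_iff_nth_less)
    then show ?thesis by blast
  qed
  then show "\<forall>i<length ts. \<forall>j<length ts. i \<noteq> j \<longrightarrow> vars (ts ! i) \<inter> vars (ts ! j) = {}" by blast
qed (simp add: pdisj_def sorted_wrt_iff_nth_less)

lemma linear_Fun: "linear_term (Fun g ts) \<longleftrightarrow> (\<forall>t\<in>set ts. linear_term t) \<and> pdisj ts"
  by (simp add: pdisj_nth)

declare linear_term.simps(2) [simp del]

lemma pdisj_map_Var [simp]: "pdisj (map Var xs) \<longleftrightarrow> distinct xs"
  by (auto simp: pdisj_nth distinct_conv_nth)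

lemma pdisj_map_Var_update:
  "distinct ys \<Longrightarrow> vars v \<inter> set ys = {} \<Longrightarrow> pdisj ((map Var ys)[j := v])"
  by (cases "j < length ys")
    (auto simp: pdisj_nth distinct_conv_nth nth_list_update list_update_beyond disjoint_iff)

lemma set_ins_at: "set (ins_at xs i us) \<subseteq> set xs \<union> set us"
  by (auto simp: ins_at_def dest: in_set_takeD in_set_dropD)

lemma pdisj_ins_at:
  assumes "distinct xs" "\<forall>u\<in>set us. vars u \<inter> set xs = {}" "pdisj us"
  shows "pdisj (ins_at (map Var xs) i us)"
proof -
  have "set (take i xs) \<inter> set (drop (Suc i) xs) = {}"
    using assms(1) by (auto simp: set_take_disj_set_drop_if_distinct)
  then show ?thesis using assms
    by (auto simp: ins_at_def take_map drop_map dest: in_set_takeD in_set_dropD)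
qed

text \<open>This is the common shape of left-hand sides in the transformed system: argument
  patterns, then flag variables with a block inserted at place \<open>i\<close>. It discharges the
  linearity premise of \<open>xi_rule\<close> whenever a redex has to be exhibited.\<close>

lemma linear_lhs:
  assumes "\<forall>t\<in>set As. linear_term t" "\<forall>u\<in>set us. linear_term u"
    and "pdisj As" "pdisj us" "\<forall>t\<in>set As. \<forall>u\<in>set us. vars t \<inter> vars u = {}"
    and "distinct xs" "\<forall>t\<in>set As \<union> set us. vars t \<inter> set xs = {}"
  shows "linear_term (Fun g (As @ ins_at (map Var xs) i us))"
  using assms set_ins_at[of "map Var xs" i us]
  by (fastforce simp: linear_Fun intro!: pdisj_ins_at)

lemma ins_at_single: "i < length zs \<Longrightarrow> ins_at zs i [a] = zs[i := a]"
  by (simp add: ins_at_def upd_conv_take_nth_drop)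

lemma map_ins_at: "map f (ins_at xs i us) = ins_at (map f xs) i (map f us)"
  by (simp add: ins_at_def take_map drop_map)

text \<open>Equal lengths fix where the inserted block begins and ends. The second conclusion allows
  the instances of the flag variables to be exchanged for the actual \<open>flags\<close>, whatever
  is inserted at \<open>i\<close>.\<close>

lemma ins_at_inj:
  assumes "length F = length X" "length us = length vs"
    and "ins_at F i us = ins_at X i vs"
  shows "us = vs" "ins_at F i zs = ins_at X i zs"
  using assms by (auto simp: ins_at_def)

text \<open>A variable lies in at most one of the terms, so the choice in \<open>h\<close> is
  forced. The lemma glues substitutions as well as cost functions.\<close>

lemma merge_functions:
  assumes "pdisj ts"
  obtains h where "\<And>k x. k < length ts \<Longrightarrow> x \<in> vars (ts ! k) \<Longrightarrow> h x = f k x"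
proof -
  define h where "h x = f (SOME k. k < length ts \<and> x \<in> vars (ts ! k)) x" for x
  have "h x = f k x" if k: "k < length ts" "x \<in> vars (ts ! k)" for k x
  proof -
    have "(SOME k. k < length ts \<and> x \<in> vars (ts ! k)) = k"
      using k assms by (intro some_equality) (auto simp: pdisj_nth)
    then show ?thesis by (simp add: h_def)
  qed
  then show thesis using that by blast
qed

text \<open>No variable is constrained by two arguments, so matching may be done argument by
  argument.\<close>

lemma merge_match:
  assumes "pdisj ps" "length Ts = length ps"
    and "\<And>k. k < length ps \<Longrightarrow> \<exists>\<tau>. Ts ! k = subst (ps ! k) \<tau>"
  shows "\<exists>\<tau>. Ts = map (\<lambda>p. subst p \<tau>) ps"
proof -
  obtain f where f: "\<And>k. k < length ps \<Longrightarrow> Ts ! k = subst (ps ! k) (f k)"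
    using assms(3) by metis
  obtain h where h: "\<And>k x. k < length ps \<Longrightarrow> x \<in> vars (ps ! k) \<Longrightarrow> h x = f k x"
    using merge_functions[OF assms(1)] by blast
  have "Ts = map (\<lambda>p. subst p h) ps"
    using assms(2) f by (auto simp: list_eq_iff_nth_eq intro!: subst_cong h[symmetric])
  then show ?thesis by blast
qed

lemma fresh_list:
  assumes "infinite (UNIV :: 'v set)" "finite (V :: 'v set)"
  obtains xs where "length xs = n" "distinct xs" "set xs \<inter> V = {}"
proof -
  have "infinite (- V)" using assms by (simp add: Compl_eq_Diff_UNIV)
  then obtain B where B: "finite B" "card B = n" "B \<subseteq> - V"
    using infinite_arbitrarily_large by blast
  obtain xs where "set xs = B" "distinct xs" using finite_distinct_list[OF B(1)] by blast
  then show thesis using that[of xs] B distinct_card[of xs] by auto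
qed

section \<open>Closure of labeled reductions under contexts and substitutions\<close>

lemma lstep_Fun:
  assumes "lstep rules s t c" "k < length ss" "ss ! k = s"
  shows "lstep rules (Fun g ss) (Fun g (ss[k := t])) c"
  using assms(1)
proof (cases rule: lstep.cases)
  case (bot_step p f R us \<rho> vs \<sigma>)
  show ?thesis
    using lstep_lsteps.bot_step[of "Fun g ss" "k # p", OF _ _ bot_step(5-7)] bot_step assms(2,3) by auto
next
  case (succ_step p \<rho> R f ls r cs \<sigma> ks)
  show ?thesis
    using lstep_lsteps.succ_step[of "Fun g ss" "k # p" \<rho> R f ls r cs rules \<sigma> ks] succ_step assms(2,3) by auto
next
  case (fail_step p \<rho> R f ls r cs \<sigma> j ks u \<tau> c)
  show ?thesis
    using lstep_lsteps.fail_step[of "Fun g ss" "k # p" \<rho> R f ls r cs rules \<sigma> j ks u \<tau> c]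
      fail_step assms(2,3) by auto
qed

lemma lsteps_trans: "lsteps rules s t c \<Longrightarrow> lsteps rules t u d \<Longrightarrow> lsteps rules s u (c + d)"
proof (induction rule: lstep_lsteps.inducts(2)[where ?P1.0 = "\<lambda>_ _ _. True"])
  case (lsteps_step s u c1 t c2)
  then show ?case using lstep_lsteps.lsteps_step[of rules s u c1 _ "c2 + d"] by (simp add: add.assoc)
qed auto

lemma lstep_imp_lsteps: "lstep rules s t c \<Longrightarrow> lsteps rules s t c"
  using lsteps_step[OF _ lsteps_refl, of rules s t c] by simp

abbreviation red :: "('f \<Rightarrow> ('f, 'v) crule list) \<Rightarrow> ('f, 'v) lterm \<Rightarrow> ('f, 'v) lterm \<Rightarrow> bool" where
  "red rules s t \<equiv> \<exists>c. lstep rules s t c"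

lemma lsteps_imp_rtranclp: "lsteps rules s t c \<Longrightarrow> (red rules)\<^sup>*\<^sup>* s t"
proof (induction rule: lstep_lsteps.inducts(2)[where ?P1.0 = "\<lambda>_ _ _. True"])
  case (lsteps_step s u c1 t c2)
  then show ?case by (blast intro: converse_rtranclp_into_rtranclp)
qed auto

lemma lsteps_Fun:
  assumes "lsteps rules s t c" "k < length ss" "ss ! k = s"
  shows "lsteps rules (Fun g ss) (Fun g (ss[k := t])) c"
  using assms
proof (induction arbitrary: ss rule: lstep_lsteps.inducts(2)[where ?P1.0 = "\<lambda>_ _ _. True"])
  case (lsteps_refl s ss)
  then show ?case using lstep_lsteps.lsteps_refl[of rules] by auto
next
  case (lsteps_step s u c1 t c2)
  show ?case
    using lstep_lsteps.lsteps_step[OF lstep_Fun[OF lsteps_step(1) lsteps_step.prems]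
      lsteps_step(4)[of "ss[k := u]"]] lsteps_step.prems by simp
qed auto

lemma lsteps_args:
  assumes "length ss' = length ss" "\<And>k. k < length ss \<Longrightarrow> lsteps rules (ss ! k) (ss' ! k) (c k)"
  shows "lsteps rules (Fun g ss) (Fun g ss') (\<Sum>k<length ss. c k)"
proof -
  \<comment> \<open>The arguments are reduced from left to right; after \<open>m\<close> rounds the
    first \<open>m\<close> are finished and the others untouched.\<close>
  have "lsteps rules (Fun g ss) (Fun g (take m ss' @ drop m ss)) (\<Sum>k<m. c k)" if "m \<le> length ss" for m
    using that
  proof (induction m)
    case (Suc m)
    let ?us = "take m ss' @ drop m ss"
    have "lsteps rules (Fun g ?us) (Fun g (?us[m := ss' ! m])) (c m)"
      using Suc.prems assms by (intro lsteps_Fun[of _ "ss ! m"]) (auto simp: nth_append)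
    moreover have "?us[m := ss' ! m] = take (Suc m) ss' @ drop (Suc m) ss"
      using Suc.prems assms(1)
      by (simp add: list_update_append Cons_nth_drop_Suc[symmetric] take_Suc_conv_app_nth)
    ultimately show ?case using Suc lsteps_trans by fastforce
  qed (use lsteps_refl[of rules "Fun g ss"] in simp)
  from this[of "length ss"] assms(1) show ?thesis by simp
qed

text \<open>Every occurrence of a variable is reduced separately, while the sum counts each variable
  once; a non-linear \<open>t\<close> therefore gives only an inequality.\<close>

lemma lsteps_subst:
  assumes "\<And>x. x \<in> vars t \<Longrightarrow> lsteps rules (\<sigma> x) (\<tau> x) (c x)"
  shows "\<exists>d. lsteps rules (subst t \<sigma>) (subst t \<tau>) d \<and> (\<Sum>x\<in>vars t. c x) \<le> d"
  using assms
proof (induction t)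
  case (Var x)
  then show ?case by auto
next
  case (Fun g ts)
  have "\<forall>k. \<exists>d. k < length ts \<longrightarrow> lsteps rules (subst (ts ! k) \<sigma>) (subst (ts ! k) \<tau>) d
      \<and> (\<Sum>x\<in>vars (ts ! k). c x) \<le> d"
    using Fun by (auto simp: Bex_def) (meson nth_mem)
  from choice[OF this] obtain d where d: "\<And>k. k < length ts \<Longrightarrow> lsteps rules (subst (ts ! k) \<sigma>) (subst (ts ! k) \<tau>) (d k)
      \<and> (\<Sum>x\<in>vars (ts ! k). c x) \<le> d k" by blast
  have "lsteps rules (subst (Fun g ts) \<sigma>) (subst (Fun g ts) \<tau>) (\<Sum>k<length ts. d k)"
    using lsteps_args[of "map (\<lambda>t. subst t \<tau>) ts" "map (\<lambda>t. subst t \<sigma>) ts" rules d g] d by simp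
  moreover have "(\<Sum>x\<in>vars (Fun g ts). c x) \<le> (\<Sum>k<length ts. d k)"
  proof -
    have "vars (Fun g ts) = (\<Union>k\<in>{..<length ts}. vars (ts ! k))" by (auto simp: set_conv_nth)
    then have "(\<Sum>x\<in>vars (Fun g ts). c x) \<le> (\<Sum>k<length ts. \<Sum>x\<in>vars (ts ! k). c x)"
      using sum_UN_le[of "{..<length ts}" "\<lambda>k. vars (ts ! k)" c] by (simp add: finite_vars)
    also have "\<dots> \<le> (\<Sum>k<length ts. d k)" by (intro sum_mono) (use d in auto)
    finally show ?thesis .
  qed
  ultimately show ?case by blast
qed

text \<open>A position-free form of \<open>hstep\<close>: descending through active arguments
  replaces \<open>is_pos\<close>, \<open>active\<close> and \<open>replace_at\<close>, so that steps
  can be treated by rule induction.\<close>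

inductive hst :: "('f \<Rightarrow> nat) \<Rightarrow> ('f \<Rightarrow> ('f, 'v) crule list) \<Rightarrow> ('f hsym, 'v) term \<Rightarrow> ('f hsym, 'v) term \<Rightarrow> nat \<Rightarrow> bool"
  for ar rules where
  hst_root: "xi_rule ar rules l r c \<Longrightarrow> hst ar rules (subst l \<sigma>) (subst r \<sigma>) c"
| hst_arg: "k \<in> mu ar g \<Longrightarrow> k < length Ts \<Longrightarrow> hst ar rules (Ts ! k) t c
    \<Longrightarrow> hst ar rules (Fun g Ts) (Fun g (Ts[k := t])) c"

lemma hstep_iff_hst: "hstep ar rules s t c \<longleftrightarrow> hst ar rules s t c"
proof
  assume "hstep ar rules s t c"
  then obtain l r p \<sigma> where *: "xi_rule ar rules l r c" "is_pos s p" "active ar s p"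
      "subt_at s p = subst l \<sigma>" "t = replace_at s p (subst r \<sigma>)"
    unfolding hstep_def by blast
  from *(2-) show "hst ar rules s t c"
  proof (induction p arbitrary: s t)
    case Nil
    then show ?case using hst_root[OF *(1)] by simp
  next
    case (Cons k p)
    then show ?case by (cases s) (auto intro!: hst_arg)
  qed
next
  assume "hst ar rules s t c"
  then show "hstep ar rules s t c"
  proof induction
    case (hst_root l r c \<sigma>)
    then show ?case unfolding hstep_def by (intro exI[of _ l] exI[of _ r] exI[of _ "[]"] exI[of _ \<sigma>]) simp
  next
    case (hst_arg k g Ts t c)
    then obtain l r p \<sigma> where "xi_rule ar rules l r c" "is_pos (Ts ! k) p" "active ar (Ts ! k) p"
      "subt_at (Ts ! k) p = subst l \<sigma>" "t = replace_at (Ts ! k) p (subst r \<sigma>)"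
      unfolding hstep_def by blast
    then show ?case unfolding hstep_def using hst_arg(1,2)
      by (intro exI[of _ l] exI[of _ r] exI[of _ "k # p"] exI[of _ \<sigma>]) simp
  qed
qed

inductive asub :: "('f \<Rightarrow> nat) \<Rightarrow> ('f hsym, 'v) term \<Rightarrow> ('f hsym, 'v) term \<Rightarrow> bool" for ar where
  asub_refl: "asub ar T T"
| asub_arg: "k \<in> mu ar g \<Longrightarrow> k < length Ts \<Longrightarrow> asub ar (Ts ! k) U \<Longrightarrow> asub ar (Fun g Ts) U"

lemma asub_trans: "asub ar T U \<Longrightarrow> asub ar U W \<Longrightarrow> asub ar T W"
  by (induction rule: asub.induct) (auto intro: asub.intros)

text \<open>Lifts a step of an active subterm to the surrounding term. In \<open>hsn_pays\<close>
  this turns progress of the subterm into descent of the accessible term above it.\<close>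

lemma asub_hst: "asub ar T U \<Longrightarrow> hst ar rules U U' c \<Longrightarrow> \<exists>T'. hst ar rules T T' c \<and> asub ar T' U'"
proof (induction rule: asub.induct)
  case (asub_arg k g Ts U)
  then obtain T' where "hst ar rules (Ts ! k) T' c" "asub ar T' U'" by blast
  then show ?case using asub_arg(1,2) hst_arg[OF asub_arg(1,2)]
    by (intro exI[of _ "Fun g (Ts[k := T'])"]) (auto intro: asub.asub_arg)
qed (auto intro: asub.intros)

section \<open>Accessibility and infinite chains\<close>

lemma not_accp_chain:
  assumes "\<not> Wellfounded.accp r x"
  obtains g where "g 0 = x" "\<And>i::nat. r (g (Suc i)) (g i)"
proof -
  have "\<exists>g. \<forall>n. \<not> Wellfounded.accp r (g n) \<and> (n = 0 \<longrightarrow> g n = x) \<and> r (g (Suc n)) (g n)"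
    by (rule dependent_nat_choice[where P = "\<lambda>n y. \<not> Wellfounded.accp r y \<and> (n = 0 \<longrightarrow> y = x)"
          and Q = "\<lambda>n y z. r z y", simplified conj_assoc])
      (use assms in \<open>auto dest: not_accp_down\<close>)
  then show thesis using that by metis
qed

lemma accp_no_chain: "Wellfounded.accp r (x :: 'a) \<Longrightarrow> g 0 = x \<Longrightarrow> \<exists>i::nat. \<not> r (g (Suc i)) (g i)"
proof (induction arbitrary: g rule: accp.induct)
  case (accI x)
  show ?case
  proof (rule ccontr)
    assume *: "\<not> ?case"
    then have "r (g 1) x" using accI.prems by (metis One_nat_def)
    from accI.IH[OF this, of "\<lambda>n. g (Suc n)"] * show False by auto
  qed
qed

section \<open>The simulation relation\<close>

definition flags :: "('f \<Rightarrow> ('f, 'v) crule list) \<Rightarrow> 'f \<Rightarrow> ('f, 'v) crule set \<Rightarrow> ('f hsym, 'v) term list" where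
  "flags rules f R = map (\<lambda>\<rho>. if \<rho> \<in> R then Fun HTop [] else Fun HBot []) (rules f)"

definition rvars :: "('f, 'v) term list \<Rightarrow> (('f, 'v) term \<times> ('f, 'v) term) list \<Rightarrow> nat \<Rightarrow> 'v set" where
  "rvars ls cs j = (\<Union>l\<in>set ls. vars l) \<union> (\<Union>m<j. vars (snd (cs ! m)))"

text \<open>Values of these variables have entered a condition reduction and must stay fixed from
  then on.\<close>

definition avars :: "(('f, 'v) term \<times> ('f, 'v) term) list \<Rightarrow> nat \<Rightarrow> 'v set" where
  "avars cs j = (\<Union>m<j. vars (fst (cs ! m)))"

definition pays :: "('f \<Rightarrow> ('f, 'v) crule list) \<Rightarrow> bool \<Rightarrow> ('f, 'v) lterm \<Rightarrow> nat \<Rightarrow> bool" where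
  "pays rules w s P \<longleftrightarrow> (\<exists>t c. lsteps rules s t c \<and> (w \<longrightarrow> P \<le> c))"

lemma length_flags [simp]: "length (flags rules f R) = length (rules f)"
  by (simp add: flags_def)

lemma finite_rvars: "finite (rvars ls cs j)"
  by (simp add: rvars_def finite_vars)

lemma rvars_Suc: "rvars ls cs (Suc j) = rvars ls cs j \<union> vars (snd (cs ! j))"
  by (auto simp: rvars_def lessThan_Suc)

lemma avars_Suc: "avars cs (Suc j) = avars cs j \<union> vars (fst (cs ! j))"
  by (auto simp: avars_def lessThan_Suc)

lemma rvars_mono: "i \<le> j \<Longrightarrow> rvars ls cs i \<subseteq> rvars ls cs j"
  by (force simp: rvars_def)

text \<open>In \<open>sim ar rules w s T P\<close> every \<open>Cond\<close>-rooted subterm of \<open>T\<close> is rolled back in \<open>s\<close> to the term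
  whose rule application it started. \<open>P\<close> is the cost already spent on these suspended
  evaluations, counting each variable only at its pending copy: a variable of an evaluated condition
  has passed its pending cost on to that condition. With \<open>w = False\<close> costs are ignored, which
  is the form needed for infinite reductions.\<close>

inductive sim :: "('f \<Rightarrow> nat) \<Rightarrow> ('f \<Rightarrow> ('f, 'v) crule list) \<Rightarrow> bool
    \<Rightarrow> ('f, 'v) lterm \<Rightarrow> ('f hsym, 'v) term \<Rightarrow> nat \<Rightarrow> bool"
  for ar rules w where
  sim_fun: "\<lbrakk> length ss = ar f; length Ts = length ss; R \<subseteq> set (rules f);
      \<forall>k < length ss. sim ar rules w (ss ! k) (Ts ! k) (p k) \<rbrakk>
    \<Longrightarrow> sim ar rules w (Fun (f, R) ss) (Fun (Orig f) (Ts @ flags rules f R)) (\<Sum>k<length ss. p k)"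
| sim_cond: "\<lbrakk> i < length (rules f); rules f ! i = (Fun f ls, r, cs); rules f ! i \<in> R; R \<subseteq> set (rules f);
      j < length cs;
      \<forall>x \<in> rvars ls cs j. sim ar rules w (\<sigma>' x) (\<sigma> x) (p x) \<and> pays rules w (\<sigma>' x) (p x);
      \<forall>m < j. lsteps rules (subst (label rules (fst (cs ! m))) \<sigma>')
                           (subst (label rules (snd (cs ! m))) \<sigma>') (k m);
      lsteps rules (subst (label rules (fst (cs ! j))) \<sigma>') v c; sim ar rules w v u P \<rbrakk>
    \<Longrightarrow> sim ar rules w (Fun (f, R) (map (\<lambda>l. subst (label rules l) \<sigma>') ls))
          (Fun (Cond f i j) (map (\<lambda>l. subst (xi rules HTop l) \<sigma>) ls @
             ins_at (flags rules f R) i (map (\<lambda>c. subst (xi rules HTop (snd c)) \<sigma>) (take j cs) @ [u])))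
          ((\<Sum>m<j. k m) + c + P + (\<Sum>x \<in> rvars ls cs j - avars cs (Suc j). p x))"

locale cctrs =
  fixes ar :: "'f \<Rightarrow> nat" and rules :: "'f \<Rightarrow> ('f, 'v) crule list"
  assumes inf: "infinite (UNIV :: 'v set)" and strong: "strong_cctrs ar rules"
begin

lemma distinct_rules: "distinct (rules f)"
  using strong by (simp add: strong_cctrs_def)

lemma rule_props:
  assumes "i < length (rules f)" "rules f ! i = (Fun g ls, r, cs)"
  shows "g = f" "length ls = ar f" "\<And>l. l \<in> set ls \<Longrightarrow> is_cterm ar rules l"
    "\<And>l. l \<in> set ls \<Longrightarrow> linear_term l" "pdisj ls" "wf_term ar r"
    "\<And>m. m < length cs \<Longrightarrow> is_cterm ar rules (snd (cs ! m))"
    "\<And>m. m < length cs \<Longrightarrow> linear_term (snd (cs ! m))"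
    "\<And>m. m < length cs \<Longrightarrow> wf_term ar (fst (cs ! m))"
    "\<And>m. m < length cs \<Longrightarrow> vars (snd (cs ! m)) \<inter> rvars ls cs m = {}"
    "\<And>m. m < length cs \<Longrightarrow> vars (fst (cs ! m)) \<subseteq> rvars ls cs m"
    "\<And>m l. m < length cs \<Longrightarrow> l \<in> set ls \<Longrightarrow> vars (snd (cs ! m)) \<inter> vars l = {}"
    "\<And>m n. m < length cs \<Longrightarrow> n < length cs \<Longrightarrow> m \<noteq> n \<Longrightarrow> vars (snd (cs ! m)) \<inter> vars (snd (cs ! n)) = {}"
    "vars r \<subseteq> rvars ls cs (length cs)"
proof -
  have mem: "rules f ! i \<in> set (rules f)" using assms(1) by simp
  obtain ls' r' cs' where *: "rules f ! i = (Fun f ls', r', cs')" "length ls' = ar f"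
       "(\<forall>l \<in> set ls'. is_cterm ar rules l)"
       "(\<forall>c \<in> set cs'. is_cterm ar rules (snd c) \<and> wf_term ar (fst c))" "wf_term ar r'"
       "linear_term (Fun f ls')" "(\<forall>c \<in> set cs'. linear_term (snd c))"
       "(\<forall>i < length cs'. vars (snd (cs' ! i)) \<inter> vars (Fun f ls') = {})"
       "(\<forall>i < length cs'. \<forall>j < length cs'. i \<noteq> j \<longrightarrow> vars (snd (cs' ! i)) \<inter> vars (snd (cs' ! j)) = {})"
       "vars r' \<subseteq> vars (Fun f ls') \<union> (\<Union>c \<in> set cs'. vars (snd c))"
       "(\<forall>i < length cs'. vars (fst (cs' ! i)) \<subseteq> vars (Fun f ls') \<union> (\<Union>j < i. vars (snd (cs' ! j))))"
    using bspec[OF spec[OF conjunct2[OF strong[unfolded strong_cctrs_def]]] mem]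
    by (elim exE conjE) (rule that)
  have eq: "ls' = ls" "r' = r" "cs' = cs" "g = f" using *(1) assms(2) by auto
  note * = *[unfolded eq]
  show "g = f" by (fact eq)
  show "length ls = ar f" "\<And>l. l \<in> set ls \<Longrightarrow> is_cterm ar rules l" "wf_term ar r"
    "\<And>m. m < length cs \<Longrightarrow> is_cterm ar rules (snd (cs ! m))"
    "\<And>m. m < length cs \<Longrightarrow> linear_term (snd (cs ! m))"
    "\<And>m. m < length cs \<Longrightarrow> wf_term ar (fst (cs ! m))"
    "\<And>l. l \<in> set ls \<Longrightarrow> linear_term l" "pdisj ls"
    using * by (auto simp: linear_Fun)
  show "vars (snd (cs ! m)) \<inter> vars l = {}" if "m < length cs" "l \<in> set ls" for m l
    using * that by fastforce
  show "vars (fst (cs ! m)) \<subseteq> rvars ls cs m" if "m < length cs" for m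
    using *(11) that by (auto simp: rvars_def)
  show "vars (snd (cs ! m)) \<inter> vars (snd (cs ! n)) = {}"
    if "m < length cs" "n < length cs" "m \<noteq> n" for m n using *(9) that by blast
  show "vars r \<subseteq> rvars ls cs (length cs)"
    using *(10) by (force simp: rvars_def in_set_conv_nth)
  show "vars (snd (cs ! m)) \<inter> rvars ls cs m = {}" if "m < length cs" for m
  proof -
    have "vars (snd (cs ! m)) \<inter> vars (snd (cs ! n)) = {}" if "n < m" for n
      using *(9) \<open>m < length cs\<close> that by auto
    moreover have "vars (snd (cs ! m)) \<inter> vars (Fun f ls) = {}" using *(8) that by blast
    ultimately show ?thesis by (fastforce simp: rvars_def)
  qed
qed

lemma avars_subset:
  assumes "i < length (rules f)" "rules f ! i = (Fun g ls, r, cs)" "j \<le> length cs" "0 < j"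
  shows "avars cs j \<subseteq> rvars ls cs (j - 1)"
proof
  fix x assume "x \<in> avars cs j"
  then obtain m where m: "m < j" "x \<in> vars (fst (cs ! m))" by (auto simp: avars_def)
  then have "x \<in> rvars ls cs m" using rule_props(11)[OF assms(1,2), of m] assms(3) by auto
  then show "x \<in> rvars ls cs (j - 1)" using rvars_mono[of m "j - 1" ls cs] m(1) by (simp add: subset_iff)
qed

text \<open>The pattern of condition \<open>j\<close> binds its variables only after the left sides
  up to index \<open>j\<close> were evaluated. Freshly bound values thus have not yet passed on
  their pending cost.\<close>

lemma avars_disjoint:
  assumes "i < length (rules f)" "rules f ! i = (Fun g ls, r, cs)" "j < length cs"
  shows "vars (snd (cs ! j)) \<inter> avars cs (Suc j) = {}"
  using avars_subset[OF assms(1,2), of "Suc j"] rule_props(10)[OF assms] assms(3) by auto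

text \<open>Distinctness of the enumeration enters here: a rule listed twice would lose two flags at
  once.\<close>

lemma flags_remove:
  "i < length (rules f) \<Longrightarrow> (flags rules f R)[i := Fun HBot []] = flags rules f (R - {rules f ! i})"
  using distinct_rules[of f]
  by (auto simp: flags_def list_eq_iff_nth_eq nth_list_update distinct_conv_nth)

lemma flags_full: "flags rules f (set (rules f)) = replicate (length (rules f)) (Fun HTop [])"
  by (auto simp: flags_def list_eq_iff_nth_eq)

lemma sim_args_inst:
  assumes "\<And>t. t \<in> set ts \<Longrightarrow> \<exists>P. sim ar rules w (subst (label rules t) \<sigma>') (subst (xi rules HTop t) \<sigma>) P
      \<and> (\<Sum>x\<in>vars t. p x) \<le> P"
  obtains P where "\<And>k. k < length ts \<Longrightarrow>
      sim ar rules w (subst (label rules (ts ! k)) \<sigma>') (subst (xi rules HTop (ts ! k)) \<sigma>) (P k)"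
    "(\<Sum>x\<in>(\<Union>t\<in>set ts. vars t). p x) \<le> (\<Sum>k<length ts. P k)"
proof -
  have "\<forall>k. \<exists>P. k < length ts \<longrightarrow>
      sim ar rules w (subst (label rules (ts ! k)) \<sigma>') (subst (xi rules HTop (ts ! k)) \<sigma>) P
      \<and> (\<Sum>x\<in>vars (ts ! k). p x) \<le> P"
    using assms by (meson nth_mem)
  from choice[OF this] obtain P where P: "\<And>k. k < length ts \<Longrightarrow>
      sim ar rules w (subst (label rules (ts ! k)) \<sigma>') (subst (xi rules HTop (ts ! k)) \<sigma>) (P k)
      \<and> (\<Sum>x\<in>vars (ts ! k). p x) \<le> P k" by blast
  have "(\<Union>t\<in>set ts. vars t) = (\<Union>k\<in>{..<length ts}. vars (ts ! k))" by (auto simp: set_conv_nth)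
  then have "(\<Sum>x\<in>(\<Union>t\<in>set ts. vars t). p x) \<le> (\<Sum>k<length ts. \<Sum>x\<in>vars (ts ! k). p x)"
    using sum_UN_le[of "{..<length ts}" "\<lambda>k. vars (ts ! k)" p] by (simp add: finite_vars)
  also have "\<dots> \<le> (\<Sum>k<length ts. P k)" by (intro sum_mono) (use P in auto)
  finally show thesis using that[of P] P by blast
qed

text \<open>Copying a value copies its suspended evaluation: each occurrence of \<open>x\<close> is
  simulated by the same \<open>\<sigma>' x\<close> and carries \<open>p x\<close> again, whereas the
  sum on the left counts \<open>x\<close> once. \<open>label\<close> attaches full rule sets, which
  matches the flags \<open>HTop\<close> produced by \<open>xi\<close>.\<close>

lemma sim_inst:
  assumes "wf_term ar t" "\<And>x. x \<in> vars t \<Longrightarrow> sim ar rules w (\<sigma>' x) (\<sigma> x) (p x)"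
  shows "\<exists>P. sim ar rules w (subst (label rules t) \<sigma>') (subst (xi rules HTop t) \<sigma>) P \<and> (\<Sum>x\<in>vars t. p x) \<le> P"
  using assms
proof (induction t)
  case (Var x)
  then show ?case by auto
next
  case (Fun g ts)
  have "\<exists>P. sim ar rules w (subst (label rules t) \<sigma>') (subst (xi rules HTop t) \<sigma>) P
      \<and> (\<Sum>x\<in>vars t. p x) \<le> P" if "t \<in> set ts" for t
    using that Fun by auto
  from sim_args_inst[OF this] obtain P where P: "\<And>k. k < length ts \<Longrightarrow>
      sim ar rules w (subst (label rules (ts ! k)) \<sigma>') (subst (xi rules HTop (ts ! k)) \<sigma>) (P k)"
    "(\<Sum>x\<in>(\<Union>t\<in>set ts. vars t). p x) \<le> (\<Sum>k<length ts. P k)" by blast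
  have "sim ar rules w (subst (label rules (Fun g ts)) \<sigma>') (subst (xi rules HTop (Fun g ts)) \<sigma>)
      (\<Sum>k<length ts. P k)"
    using sim_fun[of "map (\<lambda>t. subst (label rules t) \<sigma>') ts" ar g
        "map (\<lambda>t. subst (xi rules HTop t) \<sigma>) ts" "set (rules g)" rules w P] Fun.prems(1) P(1)
    by (simp add: flags_full o_def)
  then show ?case using P(2) by auto
qed

text \<open>Collects the premises of \<open>sim_cond\<close> about the conditions already settled.
  Separating them from the open condition also covers the case \<open>j = length cs\<close>, in
  which none is open.\<close>

definition stage where
  "stage w ls cs j \<sigma>' \<sigma> p k \<longleftrightarrow>
    (\<forall>x \<in> rvars ls cs j. sim ar rules w (\<sigma>' x) (\<sigma> x) (p x) \<and> pays rules w (\<sigma>' x) (p x)) \<and>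
    (\<forall>m < j. lsteps rules (subst (label rules (fst (cs ! m))) \<sigma>')
                          (subst (label rules (snd (cs ! m))) \<sigma>') (k m))"

definition lhs_inst where
  "lhs_inst f R ls \<sigma>' = Fun (f, R) (map (\<lambda>l. subst (label rules l) \<sigma>') ls)"

definition cond_inst where
  "cond_inst f i j R ls cs \<sigma> u = Fun (Cond f i j) (map (\<lambda>l. subst (xi rules HTop l) \<sigma>) ls @
     ins_at (flags rules f R) i (map (\<lambda>c. subst (xi rules HTop (snd c)) \<sigma>) (take j cs) @ [u]))"

lemma sim_condI:
  assumes "i < length (rules f)" "rules f ! i = (Fun f ls, r, cs)" "rules f ! i \<in> R" "R \<subseteq> set (rules f)"
    "j < length cs" "stage w ls cs j \<sigma>' \<sigma> p k"
    "lsteps rules (subst (label rules (fst (cs ! j))) \<sigma>') v c" "sim ar rules w v u P"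
  shows "sim ar rules w (lhs_inst f R ls \<sigma>') (cond_inst f i j R ls cs \<sigma> u)
     ((\<Sum>m<j. k m) + c + P + (\<Sum>x \<in> rvars ls cs j - avars cs (Suc j). p x))"
  using assms unfolding stage_def lhs_inst_def cond_inst_def by (intro sim_cond) auto

text \<open>Opening condition \<open>j\<close> hands the pending cost of the variables in its left
  side over to the new active argument. They drop out of the last sum, and the pending cost of the
  new argument makes up for it.\<close>

lemma sim_start:
  assumes r: "i < length (rules f)" "rules f ! i = (Fun f ls, r, cs)" "rules f ! i \<in> R" "R \<subseteq> set (rules f)"
    and j: "j < length cs" and st: "stage w ls cs j \<sigma>' \<sigma> p k"
  shows "\<exists>P. sim ar rules w (lhs_inst f R ls \<sigma>')
      (cond_inst f i j R ls cs \<sigma> (subst (xi rules HTop (fst (cs ! j))) \<sigma>)) P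
    \<and> (\<Sum>m<j. k m) + (\<Sum>x \<in> rvars ls cs j - avars cs j. p x) \<le> P"
proof -
  have "vars (fst (cs ! j)) \<subseteq> rvars ls cs j" using rule_props(11)[OF r(1,2) j] .
  then obtain P where P: "sim ar rules w (subst (label rules (fst (cs ! j))) \<sigma>')
      (subst (xi rules HTop (fst (cs ! j))) \<sigma>) P" "(\<Sum>x\<in>vars (fst (cs ! j)). p x) \<le> P"
    using sim_inst[OF rule_props(9)[OF r(1,2) j], of w \<sigma>' \<sigma> p] st unfolding stage_def by blast
  have "(\<Sum>x \<in> rvars ls cs j - avars cs j. p x)
      \<le> (\<Sum>x \<in> vars (fst (cs ! j)) \<union> (rvars ls cs j - avars cs (Suc j)). p x)"
    by (intro sum_mono2) (auto simp: finite_vars finite_rvars avars_Suc)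
  also have "\<dots> \<le> (\<Sum>x \<in> vars (fst (cs ! j)). p x) + (\<Sum>x \<in> rvars ls cs j - avars cs (Suc j). p x)"
    by (intro sum_Un_le) (auto simp: finite_vars finite_rvars)
  finally show ?thesis using P sim_condI[OF r j st lsteps_refl P(1)] by fastforce
qed

text \<open>Advances exactly the values of variables in \<open>D\<close>; all others must remain as
  they are because they are shared with terms that may not change.\<close>

lemma choose_payments:
  assumes "\<forall>x \<in> V. pays rules w (\<sigma>' x) (p x)" "D \<subseteq> V"
  obtains \<sigma>'' e where "\<And>x. lsteps rules (\<sigma>' x) (\<sigma>'' x) (e x)" "\<And>x. x \<notin> D \<Longrightarrow> \<sigma>'' x = \<sigma>' x"
    "\<And>x. x \<in> D \<Longrightarrow> w \<Longrightarrow> p x \<le> e x"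
proof -
  have "\<forall>x. \<exists>t c. lsteps rules (\<sigma>' x) t c \<and> (x \<notin> D \<longrightarrow> t = \<sigma>' x) \<and> (x \<in> D \<longrightarrow> w \<longrightarrow> p x \<le> c)"
  proof
    fix x
    show "\<exists>t c. lsteps rules (\<sigma>' x) t c \<and> (x \<notin> D \<longrightarrow> t = \<sigma>' x) \<and> (x \<in> D \<longrightarrow> w \<longrightarrow> p x \<le> c)"
    proof (cases "x \<in> D")
      case True
      then show ?thesis using assms unfolding pays_def by blast
    next
      case False
      then show ?thesis using lsteps_refl[of rules "\<sigma>' x"] by blast
    qed
  qed
  then obtain \<sigma>'' e where "\<And>x. lsteps rules (\<sigma>' x) (\<sigma>'' x) (e x) \<and> (x \<notin> D \<longrightarrow> \<sigma>'' x = \<sigma>' x)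
      \<and> (x \<in> D \<longrightarrow> w \<longrightarrow> p x \<le> e x)" by metis
  then show thesis using that[of \<sigma>'' e] by blast
qed

lemma sum_rvars_le:
  fixes e :: "'v \<Rightarrow> nat"
  assumes "(\<Sum>x\<in>(\<Union>l\<in>set ls. vars l). e x) \<le> c" "\<And>m. m < j \<Longrightarrow> (\<Sum>x\<in>vars (snd (cs ! m)). e x) \<le> d m"
  shows "(\<Sum>x\<in>rvars ls cs j. e x) \<le> c + (\<Sum>m<j. d m)"
proof -
  have "(\<Sum>x\<in>rvars ls cs j. e x) \<le> (\<Sum>x\<in>(\<Union>l\<in>set ls. vars l). e x) + (\<Sum>x\<in>(\<Union>m<j. vars (snd (cs ! m))). e x)"
    unfolding rvars_def by (intro sum_Un_le) (auto simp: finite_vars)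
  also have "(\<Sum>x\<in>(\<Union>m<j. vars (snd (cs ! m))). e x) \<le> (\<Sum>m<j. \<Sum>x\<in>vars (snd (cs ! m)). e x)"
    by (intro sum_UN_le) (auto simp: finite_vars)
  also have "\<dots> \<le> (\<Sum>m<j. d m)" by (intro sum_mono) (use assms(2) in auto)
  finally show ?thesis using assms(1) by linarith
qed

text \<open>Variables that occur neither in the right-hand side nor in an evaluated condition are about to be
  erased; the cost pending in their values is realised before the rule is applied.\<close>

lemma sim_success:
  assumes r: "i < length (rules f)" "rules f ! i = (Fun f ls, r, cs)" "rules f ! i \<in> R"
    and st: "stage w ls cs (length cs) \<sigma>' \<sigma> p k"
  shows "\<exists>s' c P. lsteps rules (lhs_inst f R ls \<sigma>') s' c \<and> (red rules)\<^sup>+\<^sup>+ (lhs_inst f R ls \<sigma>') s'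
    \<and> sim ar rules w s' (subst (xi rules HTop r) \<sigma>) P
    \<and> (w \<longrightarrow> Suc ((\<Sum>m<length cs. k m) + (\<Sum>x \<in> rvars ls cs (length cs) - avars cs (length cs). p x)) \<le> c + P)"
proof -
  let ?n = "length cs"
  let ?V = "rvars ls cs ?n"
  \<comment> \<open>Values in evaluated conditions must stay the starting points of the recorded
    reductions, and values in \<open>r\<close> survive with their pending cost. Only the others are
    erased.\<close>
  define D where "D = ?V - avars cs ?n - vars r"
  have K: "\<forall>x\<in>?V. pays rules w (\<sigma>' x) (p x)" and D: "D \<subseteq> ?V" using st by (auto simp: stage_def D_def)
  obtain \<sigma>'' e where \<sigma>'': "\<And>x. lsteps rules (\<sigma>' x) (\<sigma>'' x) (e x)" "\<And>x. x \<notin> D \<Longrightarrow> \<sigma>'' x = \<sigma>' x"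
    "\<And>x. x \<in> D \<Longrightarrow> w \<Longrightarrow> p x \<le> e x" using choose_payments[OF K D] by blast
  obtain c1 where c1: "lsteps rules (lhs_inst f R ls \<sigma>') (lhs_inst f R ls \<sigma>'') c1"
    "(\<Sum>x\<in>(\<Union>l\<in>set ls. vars l). e x) \<le> c1"
    using lsteps_subst[of "Fun (f, R) (map (label rules) ls)" rules \<sigma>' \<sigma>'' e] \<sigma>''(1)
    by (auto simp: lhs_inst_def o_def)
  have "\<forall>m. \<exists>d. lsteps rules (subst (label rules (snd (cs ! m))) \<sigma>') (subst (label rules (snd (cs ! m))) \<sigma>'') d
      \<and> (\<Sum>x\<in>vars (snd (cs ! m)). e x) \<le> d"
    using lsteps_subst[of _ rules \<sigma>' \<sigma>'' e] \<sigma>''(1) by (metis vars_label)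
  then obtain d where d: "\<And>m. lsteps rules (subst (label rules (snd (cs ! m))) \<sigma>')
      (subst (label rules (snd (cs ! m))) \<sigma>'') (d m)" "\<And>m. (\<Sum>x\<in>vars (snd (cs ! m)). e x) \<le> d m" by metis
  \<comment> \<open>The left side of a condition avoids \<open>D\<close>, so its reduction can be
    reused and prolonged by \<open>d m\<close> on the pattern side. This is where erased values
    bound by patterns pay; those bound by \<open>ls\<close> have paid in \<open>c1\<close>.\<close>
  have conds: "lsteps rules (subst (label rules (fst (cs ! m))) \<sigma>'') (subst (label rules (snd (cs ! m))) \<sigma>'')
      (k m + d m)" if "m < ?n" for m
  proof -
    have "subst (label rules (fst (cs ! m))) \<sigma>'' = subst (label rules (fst (cs ! m))) \<sigma>'"
      by (intro subst_cong \<sigma>''(2)) (use that in \<open>auto simp: D_def avars_def\<close>)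
    then show ?thesis using st that lsteps_trans[OF _ d(1)[of m]] by (simp add: stage_def)
  qed
  have "lstep rules (lhs_inst f R ls \<sigma>'') (subst (label rules r) \<sigma>'')
      (Suc (sum_list (map (\<lambda>m. k m + d m) [0..<?n])))"
    using lstep_lsteps.succ_step[of "lhs_inst f R ls \<sigma>''" "[]" "rules f ! i" R f ls r cs rules \<sigma>''
        "map (\<lambda>m. k m + d m) [0..<?n]"] r(2,3) conds by (simp add: lhs_inst_def)
  also have "sum_list (map (\<lambda>m. k m + d m) [0..<?n]) = (\<Sum>m<?n. k m + d m)"
    by (simp add: sum_list_sum_nth atLeast0LessThan)
  also have "subst (label rules r) \<sigma>'' = subst (label rules r) \<sigma>'"
    by (intro subst_cong \<sigma>''(2)) (auto simp: D_def)
  finally have step: "lstep rules (lhs_inst f R ls \<sigma>'') (subst (label rules r) \<sigma>') (Suc (\<Sum>m<?n. k m + d m))" .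
  obtain P where P: "sim ar rules w (subst (label rules r) \<sigma>') (subst (xi rules HTop r) \<sigma>) P"
    "(\<Sum>x\<in>vars r. p x) \<le> P"
    using sim_inst[OF rule_props(6)[OF r(1,2)], of w \<sigma>' \<sigma> p] st rule_props(14)[OF r(1,2)]
    unfolding stage_def by blast
  have "Suc ((\<Sum>m<?n. k m) + (\<Sum>x \<in> ?V - avars cs ?n. p x)) \<le> c1 + Suc (\<Sum>m<?n. k m + d m) + P" if w
  proof -
    have "(\<Sum>x \<in> ?V - avars cs ?n. p x) \<le> (\<Sum>x \<in> D \<union> vars r. p x)"
      by (intro sum_mono2) (auto simp: D_def finite_vars finite_rvars)
    also have "\<dots> \<le> (\<Sum>x \<in> D. p x) + (\<Sum>x \<in> vars r. p x)"
      by (intro sum_Un_le) (auto simp: D_def finite_vars finite_rvars)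
    also have "(\<Sum>x \<in> D. p x) \<le> (\<Sum>x \<in> D. e x)" by (intro sum_mono \<sigma>''(3)) (use that in auto)
    also have "\<dots> \<le> (\<Sum>x \<in> ?V. e x)" by (intro sum_mono2) (auto simp: D_def finite_rvars)
    also have "\<dots> \<le> c1 + (\<Sum>m<?n. d m)" by (intro sum_rvars_le c1(2) d(2))
    finally show ?thesis using P(2) by (simp add: sum.distrib)
  qed
  moreover have "(red rules)\<^sup>+\<^sup>+ (lhs_inst f R ls \<sigma>') (subst (label rules r) \<sigma>')"
    using rtranclp_into_tranclp1[OF lsteps_imp_rtranclp[OF c1(1)]] step by blast
  ultimately show ?thesis using P(1) lsteps_trans[OF c1(1) lstep_imp_lsteps[OF step]] by blast
qed

text \<open>A failed rule keeps its arguments, so variables of \<open>ls\<close> retain their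
  pending cost in the new state. Erased are only values bound by condition patterns, which pay by
  prolonging the condition reductions, and the failing condition itself, whose pending cost
  \<open>P\<close> is realised on the way to an instance of \<open>u\<close>.\<close>

lemma sim_fail:
  assumes r: "i < length (rules f)" "rules f ! i = (Fun f ls, r, cs)" "rules f ! i \<in> R" "R \<subseteq> set (rules f)"
    and j: "j < length cs" and st: "stage w ls cs j \<sigma>' \<sigma> p k"
    and c: "lsteps rules (subst (label rules (fst (cs ! j))) \<sigma>') v c"
    and u: "lsteps rules v (subst u \<tau>) d'" "w \<longrightarrow> P \<le> d'"
      "linear_term u" "lnf u" "vars u \<inter> vars (snd (cs ! j)) = {}" "\<not> unifiable (erase u) (snd (cs ! j))"
  shows "\<exists>s' c' P'. lsteps rules (lhs_inst f R ls \<sigma>') s' c' \<and> (red rules)\<^sup>+\<^sup>+ (lhs_inst f R ls \<sigma>') s'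
    \<and> sim ar rules w s' (Fun (Orig f) (map (\<lambda>l. subst (xi rules HTop l) \<sigma>) ls @
         (flags rules f R)[i := Fun HBot []])) P'
    \<and> (w \<longrightarrow> (\<Sum>m<j. k m) + c + P + (\<Sum>x \<in> rvars ls cs j - avars cs (Suc j). p x) \<le> c' + P')"
proof -
  let ?V = "rvars ls cs j"
  let ?L = "\<Union>l\<in>set ls. vars l"
  \<comment> \<open>Excluding the variables of \<open>ls\<close> leaves the left-hand side fixed, so
    a single failed step suffices, without steps before it.\<close>
  define D where "D = ?V - avars cs (Suc j) - ?L"
  have K: "\<forall>x\<in>?V. pays rules w (\<sigma>' x) (p x)" and D: "D \<subseteq> ?V" using st by (auto simp: stage_def D_def)
  obtain \<sigma>'' e where \<sigma>'': "\<And>x. lsteps rules (\<sigma>' x) (\<sigma>'' x) (e x)" "\<And>x. x \<notin> D \<Longrightarrow> \<sigma>'' x = \<sigma>' x"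
    "\<And>x. x \<in> D \<Longrightarrow> w \<Longrightarrow> p x \<le> e x" using choose_payments[OF K D] by blast
  have lhs: "lhs_inst f R' ls \<sigma>'' = lhs_inst f R' ls \<sigma>'" for R'
    unfolding lhs_inst_def by (auto intro!: subst_cong \<sigma>''(2) simp: D_def)
  have a: "subst (label rules (fst (cs ! m))) \<sigma>'' = subst (label rules (fst (cs ! m))) \<sigma>'" if "m \<le> j" for m
    by (intro subst_cong \<sigma>''(2)) (use that in \<open>auto simp: D_def avars_def\<close>)
  have "\<forall>m. \<exists>d. lsteps rules (subst (label rules (snd (cs ! m))) \<sigma>') (subst (label rules (snd (cs ! m))) \<sigma>'') d
      \<and> (\<Sum>x\<in>vars (snd (cs ! m)). e x) \<le> d"
    using lsteps_subst[of _ rules \<sigma>' \<sigma>'' e] \<sigma>''(1) by (metis vars_label)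
  then obtain d where d: "\<And>m. lsteps rules (subst (label rules (snd (cs ! m))) \<sigma>')
      (subst (label rules (snd (cs ! m))) \<sigma>'') (d m)" "\<And>m. (\<Sum>x\<in>vars (snd (cs ! m)). e x) \<le> d m" by metis
  have conds: "lsteps rules (subst (label rules (fst (cs ! m))) \<sigma>'') (subst (label rules (snd (cs ! m))) \<sigma>'')
      (k m + d m)" if "m < j" for m
    using st that lsteps_trans[OF _ d(1)[of m]] a[of m] by (simp add: stage_def)
  have "lstep rules (lhs_inst f R ls \<sigma>'') (lhs_inst f (R - {rules f ! i}) ls \<sigma>'')
      (sum_list (map (\<lambda>m. k m + d m) [0..<j]) + (c + d'))"
    using lstep_lsteps.fail_step[of "lhs_inst f R ls \<sigma>''" "[]" "rules f ! i" R f ls r cs rules \<sigma>'' j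
        "map (\<lambda>m. k m + d m) [0..<j]" u \<tau> "c + d'"] r(2,3) conds j u lsteps_trans[OF c u(1)] a[of j]
    by (simp add: lhs_inst_def)
  also have "sum_list (map (\<lambda>m. k m + d m) [0..<j]) = (\<Sum>m<j. k m + d m)"
    by (simp add: sum_list_sum_nth atLeast0LessThan)
  finally have step: "lstep rules (lhs_inst f R ls \<sigma>') (lhs_inst f (R - {rules f ! i}) ls \<sigma>')
      ((\<Sum>m<j. k m + d m) + (c + d'))" unfolding lhs .
  have "\<exists>P. sim ar rules w (subst (label rules t) \<sigma>') (subst (xi rules HTop t) \<sigma>) P
      \<and> (\<Sum>x\<in>vars t. p x) \<le> P" if t: "t \<in> set ls" for t
    using sim_inst[OF is_cterm_imp_wf_term[OF rule_props(3)[OF r(1,2) t]], of w \<sigma>' \<sigma> p] st t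
    unfolding stage_def rvars_def by blast
  from sim_args_inst[OF this] obtain P' where P': "\<And>k. k < length ls \<Longrightarrow>
      sim ar rules w (subst (label rules (ls ! k)) \<sigma>') (subst (xi rules HTop (ls ! k)) \<sigma>) (P' k)"
    "(\<Sum>x\<in>?L. p x) \<le> (\<Sum>k<length ls. P' k)" by blast
  have sim: "sim ar rules w (lhs_inst f (R - {rules f ! i}) ls \<sigma>')
      (Fun (Orig f) (map (\<lambda>l. subst (xi rules HTop l) \<sigma>) ls @ (flags rules f R)[i := Fun HBot []]))
      (\<Sum>k<length ls. P' k)"
    using sim_fun[of "map (\<lambda>l. subst (label rules l) \<sigma>') ls" ar f "map (\<lambda>l. subst (xi rules HTop l) \<sigma>) ls"
        "R - {rules f ! i}" rules w P'] P'(1) r(4) rule_props(2)[OF r(1,2)]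
    unfolding lhs_inst_def flags_remove[OF r(1)] by auto
  have "(\<Sum>m<j. k m) + c + P + (\<Sum>x \<in> ?V - avars cs (Suc j). p x)
      \<le> (\<Sum>m<j. k m + d m) + (c + d') + (\<Sum>k<length ls. P' k)" if w
  proof -
    have "(\<Sum>x \<in> ?V - avars cs (Suc j). p x) \<le> (\<Sum>x \<in> D \<union> ?L. p x)"
      by (intro sum_mono2) (auto simp: D_def finite_vars finite_rvars)
    also have "\<dots> \<le> (\<Sum>x \<in> D. p x) + (\<Sum>x \<in> ?L. p x)"
      by (intro sum_Un_le) (auto simp: D_def finite_vars finite_rvars)
    also have "(\<Sum>x \<in> D. p x) \<le> (\<Sum>x \<in> D. e x)" by (intro sum_mono \<sigma>''(3)) (use that in auto)
    also have "\<dots> \<le> (\<Sum>x \<in> (\<Union>m<j. vars (snd (cs ! m))). e x)"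
      by (intro sum_mono2) (auto simp: D_def finite_vars rvars_def)
    also have "\<dots> \<le> (\<Sum>m<j. \<Sum>x\<in>vars (snd (cs ! m)). e x)" by (intro sum_UN_le) (auto simp: finite_vars)
    also have "\<dots> \<le> (\<Sum>m<j. d m)" by (intro sum_mono d(2))
    finally show ?thesis using P'(2) u(2) that by (simp add: sum.distrib)
  qed
  then show ?thesis using sim lstep_imp_lsteps[OF step] tranclp.r_into_trancl[of "red rules", OF exI, OF step]
    by blast
qed

end

section \<open>Matching and anti-patterns\<close>

inductive psub :: "('f \<Rightarrow> nat) \<Rightarrow> ('f hsym, 'v) term \<Rightarrow> ('f hsym, 'v) term \<Rightarrow> bool" for ar where
  psub_arg: "k \<in> mu ar g \<Longrightarrow> k < length Ts \<Longrightarrow> asub ar (Ts ! k) U \<Longrightarrow> psub ar (Fun g Ts) U"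

lemma psub_imp_asub: "psub ar T U \<Longrightarrow> asub ar T U"
  by (auto elim!: psub.cases intro: asub.intros)

lemma psub_nth: "k \<in> mu ar g \<Longrightarrow> k < length Ts \<Longrightarrow> psub ar (Fun g Ts) (Ts ! k)"
  by (auto intro: psub.intros asub.intros)

lemma psub_arg_trans: "k \<in> mu ar g \<Longrightarrow> k < length Ts \<Longrightarrow> psub ar (Ts ! k) U \<Longrightarrow> psub ar (Fun g Ts) U"
  by (auto intro: psub.intros psub_imp_asub)

text \<open>Constructors carry no flags and all their arguments are active, so no inactive position
  lies above a variable of \<open>t\<close>.\<close>

lemma asub_subst_cterm:
  "is_cterm ar rules t \<Longrightarrow> x \<in> vars t \<Longrightarrow> asub ar (subst (xi rules HTop t) \<sigma>) (\<sigma> x)"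
proof (induction t)
  case (Var y)
  then show ?case by (auto intro: asub.intros)
next
  case (Fun g ts)
  then obtain k where k: "k < length ts" "x \<in> vars (ts ! k)" by (auto simp: in_set_conv_nth)
  then have "asub ar (subst (xi rules HTop (ts ! k)) \<sigma>) (\<sigma> x)" using Fun by auto
  then show ?case using k Fun.prems(1) by (auto intro!: asub_arg[of k])
qed

context cctrs
begin

text \<open>What a step needs in order to store \<open>pays\<close> for values that it freezes. The
  restriction to proper active subterms lets it be used inside the size induction of
  \<open>hsn_pays\<close>, which proves the same for the whole term.\<close>

definition args_pay where
  "args_pay w T \<longleftrightarrow> (\<forall>U s P. psub ar T U \<longrightarrow> sim ar rules w s U P \<longrightarrow> pays rules w s P)"

lemma args_payD: "args_pay w T \<Longrightarrow> psub ar T U \<Longrightarrow> sim ar rules w s U P \<Longrightarrow> pays rules w s P"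
  unfolding args_pay_def by blast

lemma sim_OrigE:
  assumes "sim ar rules w s (Fun (Orig f) As) P"
  obtains R ss Ts p where "s = Fun (f, R) ss" "As = Ts @ flags rules f R" "length ss = ar f"
    "length Ts = ar f" "R \<subseteq> set (rules f)" "\<And>k. k < ar f \<Longrightarrow> sim ar rules w (ss ! k) (Ts ! k) (p k)"
    "P = (\<Sum>k<ar f. p k)"
  using assms by cases auto

lemma sim_constrE:
  assumes "sim ar rules w s (Fun (Orig f) Ts) P" "rules f = []"
  obtains ss p where "s = Fun (f, {}) ss" "length ss = ar f" "length Ts = ar f"
    "\<And>k. k < ar f \<Longrightarrow> sim ar rules w (ss ! k) (Ts ! k) (p k)" "P = (\<Sum>k<ar f. p k)"
  using assms(1)
proof (rule sim_OrigE)
  fix R ss Ts' p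
  assume "s = Fun (f, R) ss" "Ts = Ts' @ flags rules f R" "length ss = ar f" "length Ts' = ar f"
    "R \<subseteq> set (rules f)" "\<And>k. k < ar f \<Longrightarrow> sim ar rules w (ss ! k) (Ts' ! k) (p k)" "P = (\<Sum>k<ar f. p k)"
  then show thesis using that[of ss p] assms(2) by (simp add: flags_def)
qed

lemma sim_match_args:
  assumes "pdisj ts" "length ss = length ts"
    and "\<And>k. k < length ts \<Longrightarrow> \<exists>\<sigma>' p. ss ! k = subst (label rules (ts ! k)) \<sigma>' \<and>
      (\<forall>x\<in>vars (ts ! k). sim ar rules w (\<sigma>' x) (\<sigma> x) (p x)) \<and> P k = (\<Sum>x\<in>vars (ts ! k). p x)"
  shows "\<exists>\<sigma>' p. ss = map (\<lambda>t. subst (label rules t) \<sigma>') ts \<and>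
    (\<forall>x\<in>(\<Union>t\<in>set ts. vars t). sim ar rules w (\<sigma>' x) (\<sigma> x) (p x)) \<and>
    (\<Sum>k<length ts. P k) = (\<Sum>x\<in>(\<Union>t\<in>set ts. vars t). p x)"
proof -
  have "\<forall>k. \<exists>\<sigma>' p. k < length ts \<longrightarrow> ss ! k = subst (label rules (ts ! k)) \<sigma>' \<and>
      (\<forall>x\<in>vars (ts ! k). sim ar rules w (\<sigma>' x) (\<sigma> x) (p x)) \<and> P k = (\<Sum>x\<in>vars (ts ! k). p x)"
    using assms(3) by blast
  then obtain f q where fq: "\<And>k. k < length ts \<Longrightarrow> ss ! k = subst (label rules (ts ! k)) (f k)"
    "\<And>k x. k < length ts \<Longrightarrow> x \<in> vars (ts ! k) \<Longrightarrow> sim ar rules w (f k x) (\<sigma> x) (q k x)"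
    "\<And>k. k < length ts \<Longrightarrow> P k = (\<Sum>x\<in>vars (ts ! k). q k x)" by metis
  obtain \<sigma>' where \<sigma>': "\<And>k x. k < length ts \<Longrightarrow> x \<in> vars (ts ! k) \<Longrightarrow> \<sigma>' x = f k x"
    using merge_functions[OF assms(1), of f] by blast
  obtain p where p: "\<And>k x. k < length ts \<Longrightarrow> x \<in> vars (ts ! k) \<Longrightarrow> p x = q k x"
    using merge_functions[OF assms(1), of q] by blast
  have U: "(\<Union>t\<in>set ts. vars t) = (\<Union>k\<in>{..<length ts}. vars (ts ! k))" by (auto simp: set_conv_nth)
  show ?thesis
  proof (intro exI conjI ballI)
    show "ss = map (\<lambda>t. subst (label rules t) \<sigma>') ts"
      using assms(2) fq(1) by (auto simp: list_eq_iff_nth_eq intro!: subst_cong \<sigma>'[symmetric])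
    show "sim ar rules w (\<sigma>' x) (\<sigma> x) (p x)" if "x \<in> (\<Union>t\<in>set ts. vars t)" for x
      using that fq(2) \<sigma>' p unfolding U by auto
    have "(\<Sum>x\<in>(\<Union>t\<in>set ts. vars t). p x) = (\<Sum>k<length ts. \<Sum>x\<in>vars (ts ! k). p x)"
      unfolding U by (intro sum.UNION_disjoint) (use assms(1) in \<open>auto simp: finite_vars pdisj_nth\<close>)
    also have "\<dots> = (\<Sum>k<length ts. P k)" by (intro sum.cong) (use fq(3) p in auto)
    finally show "(\<Sum>k<length ts. P k) = (\<Sum>x\<in>(\<Union>t\<in>set ts. vars t). p x)" by simp
  qed
qed

text \<open>A constructor pattern has no \<open>Cond\<close> symbol, so rolling back affects only
  the values of its variables. By linearity each of them occurs once, which makes the cost an exact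
  sum.\<close>

lemma sim_match:
  assumes "is_cterm ar rules t" "linear_term t" "sim ar rules w s (subst (xi rules HTop t) \<sigma>) P"
  shows "\<exists>\<sigma>' p. s = subst (label rules t) \<sigma>' \<and> (\<forall>x\<in>vars t. sim ar rules w (\<sigma>' x) (\<sigma> x) (p x))
    \<and> P = (\<Sum>x\<in>vars t. p x)"
  using assms
proof (induction t arbitrary: s P)
  case (Var x)
  then show ?case by (intro exI[of _ "\<lambda>_. s"] exI[of _ "\<lambda>_. P"]) simp
next
  case (Fun g ts)
  have g: "rules g = []" "length ts = ar g" using Fun.prems(1) by auto
  have "sim ar rules w s (Fun (Orig g) (map (\<lambda>t. subst (xi rules HTop t) \<sigma>) ts)) P"
    using Fun.prems(3) g(1) by (simp add: o_def)
  from sim_constrE[OF this g(1)] obtain ss q where s: "s = Fun (g, {}) ss" "length ss = ar g"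
    "\<And>k. k < ar g \<Longrightarrow> sim ar rules w (ss ! k) (map (\<lambda>t. subst (xi rules HTop t) \<sigma>) ts ! k) (q k)"
    "P = (\<Sum>k<ar g. q k)" by blast
  have *: "\<exists>\<sigma>' p. ss ! k = subst (label rules (ts ! k)) \<sigma>' \<and>
      (\<forall>x\<in>vars (ts ! k). sim ar rules w (\<sigma>' x) (\<sigma> x) (p x)) \<and> q k = (\<Sum>x\<in>vars (ts ! k). p x)"
    if "k < length ts" for k
    using Fun.IH[of "ts ! k" "ss ! k" "q k"] Fun.prems that s(3)[of k] g by (auto simp: linear_Fun)
  obtain \<sigma>' p where "ss = map (\<lambda>t. subst (label rules t) \<sigma>') ts"
    "\<And>x. x \<in> (\<Union>t\<in>set ts. vars t) \<Longrightarrow> sim ar rules w (\<sigma>' x) (\<sigma> x) (p x)"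
    "(\<Sum>k<length ts. q k) = (\<Sum>x\<in>(\<Union>t\<in>set ts. vars t). p x)"
  proof -
    have "pdisj ts" "length ss = length ts" using Fun.prems(2) s(2) g(2) by (auto simp: linear_Fun)
    from sim_match_args[of ts ss w \<sigma> q, OF this *] show thesis using that by blast
  qed
  then show ?case using s g by (intro exI[of _ \<sigma>'] exI[of _ p]) simp
qed

text \<open>Both conclusions are wanted: a bot-step keeps the pending evaluations and needs the term
  itself to be an instance, while a failed step erases them and needs an instance reached after
  paying.\<close>

lemma fun_realise:
  assumes "length us = length ss" "pdisj us"
    and "\<And>k. k < length ss \<Longrightarrow> \<exists>\<tau>. ss ! k = subst (us ! k) \<tau>"
    and "\<And>k. k < length ss \<Longrightarrow> \<exists>\<tau> d. lsteps rules (ss ! k) (subst (us ! k) \<tau>) d \<and> (w \<longrightarrow> p k \<le> d)"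
  shows "(\<exists>\<tau>. Fun g ss = subst (Fun g us) \<tau>) \<and>
    (\<exists>\<tau> d. lsteps rules (Fun g ss) (subst (Fun g us) \<tau>) d \<and> (w \<longrightarrow> (\<Sum>k<length ss. p k) \<le> d))"
proof
  show "\<exists>\<tau>. Fun g ss = subst (Fun g us) \<tau>"
    using merge_match[of us ss] assms(1-3) by simp
  have "\<forall>k. \<exists>\<tau> d. k < length ss \<longrightarrow> lsteps rules (ss ! k) (subst (us ! k) \<tau>) d \<and> (w \<longrightarrow> p k \<le> d)"
    using assms(4) by blast
  then obtain f d where f: "\<And>k. k < length ss \<Longrightarrow> lsteps rules (ss ! k) (subst (us ! k) (f k)) (d k)"
    "\<And>k. k < length ss \<Longrightarrow> w \<Longrightarrow> p k \<le> d k" by metis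
  obtain \<tau> where \<tau>: "\<And>k x. k < length us \<Longrightarrow> x \<in> vars (us ! k) \<Longrightarrow> \<tau> x = f k x"
    using merge_functions[OF assms(2), of f] by blast
  have "lsteps rules (Fun g ss) (Fun g (map (\<lambda>u. subst u \<tau>) us)) (\<Sum>k<length ss. d k)"
  proof (rule lsteps_args)
    show "lsteps rules (ss ! k) (map (\<lambda>u. subst u \<tau>) us ! k) (d k)" if "k < length ss" for k
      using f(1)[OF that] subst_cong[of "us ! k" \<tau> "f k"] \<tau> assms(1) that by simp
  qed (use assms(1) in simp)
  moreover have "(\<Sum>k<length ss. p k) \<le> (\<Sum>k<length ss. d k)" if w
    by (intro sum_mono) (use f(2) that in auto)
  ultimately show "\<exists>\<tau> d. lsteps rules (Fun g ss) (subst (Fun g us) \<tau>) d \<and> (w \<longrightarrow> (\<Sum>k<length ss. p k) \<le> d)"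
    by auto
qed

text \<open>For a clash at the root the arguments do not matter: fresh variables match them before
  and after any reduction.\<close>

lemma fun_realise_fresh:
  assumes "finite V"
    and "\<And>k. k < length ss \<Longrightarrow> \<exists>t d. lsteps rules (ss ! k) t d \<and> (w \<longrightarrow> p k \<le> d)"
  obtains us where "linear_term (Fun (g, {}) us)" "lnf (Fun (g, {}) us)" "vars (Fun (g, {}) us) \<inter> V = {}"
    "\<exists>\<tau>. Fun (g, {}) ss = subst (Fun (g, {}) us) \<tau>"
    "\<exists>\<tau> d. lsteps rules (Fun (g, {}) ss) (subst (Fun (g, {}) us) \<tau>) d \<and> (w \<longrightarrow> (\<Sum>k<length ss. p k) \<le> d)"
proof -
  obtain zs where zs: "length zs = length ss" "distinct zs" "set zs \<inter> V = {}"
    using fresh_list[OF inf assms(1)] .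
  let ?us = "map Var zs"
  have 1: "\<exists>\<tau>. ss ! k = subst (?us ! k) \<tau>" if "k < length ss" for k
    using that zs(1) by auto
  have 2: "\<exists>\<tau> d. lsteps rules (ss ! k) (subst (?us ! k) \<tau>) d \<and> (w \<longrightarrow> p k \<le> d)" if k: "k < length ss" for k
  proof -
    obtain t d where "lsteps rules (ss ! k) t d \<and> (w \<longrightarrow> p k \<le> d)" using assms(2)[OF k] by blast
    then show ?thesis using k zs(1) by (intro exI[of _ "\<lambda>_. t"] exI[of _ d]) simp
  qed
  show thesis
    by (rule that[of ?us]) (use zs fun_realise[of ?us ss, OF _ _ 1 2] in \<open>auto simp: linear_Fun\<close>)
qed

lemma not_unifiable_update:
  fixes ts :: "('f, 'v) term list"
  assumes "length zs = length ts" "i < length ts" "\<not> unifiable (erase u) (ts ! i)"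
  shows "\<not> unifiable (Fun f (map erase ((map Var zs)[i := u]))) (Fun f ts)"
proof
  assume "unifiable (Fun f (map erase ((map Var zs)[i := u]))) (Fun f ts)"
  then obtain \<tau> :: "'v \<Rightarrow> ('f, 'v) term"
    where "map (\<lambda>t. subst (erase t) \<tau>) ((map Var zs)[i := u]) = map (\<lambda>t. subst t \<tau>) ts"
    by (auto simp: unifiable_def o_def)
  from arg_cong[OF this, of "\<lambda>xs. xs ! i"] have "subst (erase u) \<tau> = subst (ts ! i) \<tau>"
    using assms(1,2) by simp
  then show False using assms(3) by (auto simp: unifiable_def)
qed

text \<open>An anti-pattern inspects only constructors and defined symbols without remaining rules,
  which are exactly the symbols of labeled normal forms. Hence it translates into a linear labeled
  normal form \<open>u\<close> with the same clash; \<open>V\<close> supplies the freshness demanded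
  by bot-steps and failed steps.\<close>

lemma ap_sim:
  assumes "ap ar rules t pt" "is_cterm ar rules t" "finite V" "sim ar rules w s (subst pt \<sigma>) P"
    and "args_pay w (subst pt \<sigma>)"
  shows "\<exists>u. linear_term u \<and> lnf u \<and> vars u \<inter> V = {} \<and> \<not> unifiable (erase u) t \<and>
    (\<exists>\<tau>. s = subst u \<tau>) \<and> (\<exists>\<tau> d. lsteps rules s (subst u \<tau>) d \<and> (w \<longrightarrow> P \<le> d))"
  using assms
proof (induction arbitrary: V s P rule: ap.induct)
  case (ap_con g f xs ts)
  define R :: "('f, 'v) crule set" where "R = {}"
  define Ts where "Ts = map (\<lambda>t. subst t \<sigma>) (map Var xs)"
  have T: "subst (Fun (Orig g) (map Var xs)) \<sigma> = Fun (Orig g) Ts" by (simp add: Ts_def)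
  from sim_constrE[OF ap_con.prems(3)[unfolded T] ap_con.hyps(1)]
  obtain ss p where s: "s = Fun (g, R) ss" "length ss = ar g" "R = {}"
    "\<And>k. k < ar g \<Longrightarrow> sim ar rules w (ss ! k) (Ts ! k) (p k)" "P = (\<Sum>k<ar g. p k)" "length Ts = ar g"
    "subst (Fun (Orig g) (map Var xs)) \<sigma> = Fun (Orig g) Ts" unfolding R_def T by blast
  have pay: "\<exists>t d. lsteps rules (ss ! k) t d \<and> (w \<longrightarrow> p k \<le> d)" if k: "k < length ss" for k
    using args_payD[OF ap_con.prems(4) _ s(4)[OF k[unfolded s(2)]]] psub_nth[of k ar "Orig g" Ts] k s(2,6)
    unfolding s(7) pays_def by auto
  obtain us where us: "linear_term (Fun (g, {}) us)" "lnf (Fun (g, {}) us)" "vars (Fun (g, {}) us) \<inter> V = {}"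
    "\<exists>\<tau>. Fun (g, {}) ss = subst (Fun (g, {}) us) \<tau>"
    "\<exists>\<tau> d. lsteps rules (Fun (g, {}) ss) (subst (Fun (g, {}) us) \<tau>) d \<and> (w \<longrightarrow> (\<Sum>k<length ss. p k) \<le> d)"
    using fun_realise_fresh[of V ss w p g, OF ap_con.prems(2) pay] .
  moreover have "\<not> unifiable (erase (Fun (g, {}) us)) (Fun f ts)"
    using ap_con by (auto simp: unifiable_def)
  ultimately show ?case using s(2,5) unfolding s(1) s(3)
    by (intro exI[of _ "Fun (g, {}) us"]) simp
next
  case (ap_def g xs f ts)
  have "sim ar rules w s (Fun (Orig g) (map \<sigma> xs @ replicate (length (rules g)) (Fun HBot []))) P"
    using ap_def.prems(3) by (simp add: o_def)
  then obtain R ss Ts p where s: "s = Fun (g, R) ss" "length ss = ar g"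
    "R \<subseteq> set (rules g)"
    "\<And>k. k < ar g \<Longrightarrow> sim ar rules w (ss ! k) (Ts ! k) (p k)" "P = (\<Sum>k<ar g. p k)" "length Ts = ar g"
    "map \<sigma> xs @ replicate (length (rules g)) (Fun HBot []) = Ts @ flags rules g R"
    by (rule sim_OrigE) blast
  have 7: "subst (Fun (Orig g) (map Var xs @ replicate (length (rules g)) (Fun HBot []))) \<sigma>
     = Fun (Orig g) (Ts @ flags rules g R)" unfolding s(7)[symmetric] by (simp add: o_def)
  have "replicate (length (rules g)) (Fun HBot []) = flags rules g R"
    using s(6,7) ap_def.hyps(2) by simp
  then have "\<rho> \<notin> R" if "\<rho> \<in> set (rules g)" for \<rho>
    using that by (auto simp: flags_def list_eq_iff_nth_eq in_set_conv_nth split: if_splits)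
  then have R: "R = {}" using s(3) by blast
  have pay: "\<exists>t d. lsteps rules (ss ! k) t d \<and> (w \<longrightarrow> p k \<le> d)" if k: "k < length ss" for k
    using args_payD[OF ap_def.prems(4) _ s(4)[OF k[unfolded s(2)]]] psub_nth[of k ar "Orig g" "Ts @ flags rules g R"] k s(2,6)
    unfolding 7 pays_def by (auto simp: nth_append)
  obtain us where us: "linear_term (Fun (g, {}) us)" "lnf (Fun (g, {}) us)" "vars (Fun (g, {}) us) \<inter> V = {}"
    "\<exists>\<tau>. Fun (g, {}) ss = subst (Fun (g, {}) us) \<tau>"
    "\<exists>\<tau> d. lsteps rules (Fun (g, {}) ss) (subst (Fun (g, {}) us) \<tau>) d \<and> (w \<longrightarrow> (\<Sum>k<length ss. p k) \<le> d)"
    using fun_realise_fresh[of V ss w p g, OF ap_def.prems(2) pay] .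
  moreover have "\<not> unifiable (erase (Fun (g, {}) us)) (Fun f ts)"
    using ap_def by (auto simp: unifiable_def)
  ultimately show ?case using s(2,5) unfolding s(1) R
    by (intro exI[of _ "Fun (g, {}) us"]) simp
next
  case (ap_arg i ts xs u f)
  have f: "length ts = ar f" "rules f = []" using ap_arg.prems(1) by auto
  let ?T = "subst (Fun (Orig f) ((map Var xs)[i := u])) \<sigma>"
  define R :: "('f, 'v) crule set" where "R = {}"
  define Ts where "Ts = map (\<lambda>t. subst t \<sigma>) ((map Var xs)[i := u])"
  have T: "?T = Fun (Orig f) Ts" by (simp add: Ts_def)
  from sim_constrE[OF ap_arg.prems(3)[unfolded T] f(2)]
  obtain ss p where s: "s = Fun (f, R) ss" "length ss = ar f" "R = {}"
    "\<And>k. k < ar f \<Longrightarrow> sim ar rules w (ss ! k) (Ts ! k) (p k)" "P = (\<Sum>k<ar f. p k)" "length Ts = ar f"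
    "?T = Fun (Orig f) Ts" unfolding R_def T by blast
  have Ti: "Ts ! i = subst u \<sigma>" using s(7) ap_arg.hyps(1,2) by auto
  have i: "i < ar f" using ap_arg.hyps(1) f by simp
  \<comment> \<open>The clash sits in argument \<open>i\<close>; the other arguments of the new term
    will be fresh variables.\<close>
  obtain u' where u': "linear_term u'" "lnf u'" "vars u' \<inter> V = {}" "\<not> unifiable (erase u') (ts ! i)"
    "\<exists>\<tau>. ss ! i = subst u' \<tau>" "\<exists>\<tau> d. lsteps rules (ss ! i) (subst u' \<tau>) d \<and> (w \<longrightarrow> p i \<le> d)"
  proof -
    have "is_cterm ar rules (ts ! i)" using ap_arg.prems(1) ap_arg.hyps(1) by simp
    moreover have "args_pay w (subst u \<sigma>)"
      using ap_arg.prems(4) psub_arg_trans[of i ar "Orig f" Ts] i s(6)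
      unfolding s(7) Ti args_pay_def by simp blast
    ultimately show thesis
      using ap_arg.IH[OF _ ap_arg.prems(2) s(4)[OF i, unfolded Ti]] that by blast
  qed
  obtain zs where zs: "length zs = ar f" "distinct zs" "set zs \<inter> (V \<union> vars u') = {}"
    using fresh_list[OF inf, of "V \<union> vars u'"] ap_arg.prems(2) by (auto simp: finite_vars)
  let ?us = "(map Var zs)[i := u']"
  have pay: "\<exists>t d. lsteps rules (ss ! k) t d \<and> (w \<longrightarrow> p k \<le> d)" if "k < ar f" for k
    using args_payD[OF ap_arg.prems(4) _ s(4)[OF that]] psub_nth[of k ar "Orig f" Ts] that s(6)
    unfolding s(7) pays_def by auto
  have "\<exists>\<tau>. ss ! k = subst (?us ! k) \<tau>" if "k < length ss" for k
    using u'(5) that s(2) zs(1) by (cases "k = i") auto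
  moreover have "\<exists>\<tau> d. lsteps rules (ss ! k) (subst (?us ! k) \<tau>) d \<and> (w \<longrightarrow> p k \<le> d)"
    if k: "k < length ss" for k
  proof (cases "k = i")
    case False
    obtain t d where "lsteps rules (ss ! k) t d \<and> (w \<longrightarrow> p k \<le> d)" using pay[of k] k s(2) by auto
    then show ?thesis using False k s(2) zs(1) by (intro exI[of _ "\<lambda>_. t"] exI[of _ d]) simp
  qed (use u'(6) that s(2) zs(1) in simp)
  moreover have pd: "pdisj ?us" using zs by (intro pdisj_map_Var_update) auto
  ultimately have "(\<exists>\<tau>. Fun (f, R) ss = subst (Fun (f, R) ?us) \<tau>) \<and>
    (\<exists>\<tau> d. lsteps rules (Fun (f, R) ss) (subst (Fun (f, R) ?us) \<tau>) d \<and> (w \<longrightarrow> (\<Sum>k<length ss. p k) \<le> d))"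
    using zs s(2) by (intro fun_realise) auto
  moreover have us: "x \<in> Var ` set zs \<union> {u'}" if "x \<in> set ?us" for x
    using that set_update_subset_insert[of "map Var zs" i u'] by auto
  have "linear_term (Fun (f, R) ?us)" using pd us u'(1) by (fastforce simp: linear_Fun)
  moreover have "lnf (Fun (f, R) ?us)" using us u'(2) s(3) by fastforce
  moreover have "vars (Fun (f, R) ?us) \<inter> V = {}" using us u'(3) zs(3) by fastforce
  moreover have "\<not> unifiable (erase (Fun (f, R) ?us)) (Fun f ts)"
    using not_unifiable_update[of zs ts i u' f] zs(1) f(1) i u'(4) by simp
  ultimately show ?case using s by (intro exI[of _ "Fun (f, R) ?us"]) auto
qed

text \<open>The flag \<open>HTop\<close> at place \<open>i\<close> certifies that the rule is still
  available in \<open>s\<close>. The matched values are active now but may be frozen by the coming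
  step, so \<open>pays\<close> is recorded here.\<close>

lemma sim_orig_match:
  assumes r: "i < length (rules f)" "rules f ! i = (Fun f ls, r, cs)" and X: "length X = length (rules f)"
    and sim: "sim ar rules w s (Fun (Orig f) (map (\<lambda>l. subst (xi rules HTop l) \<sigma>) ls @ ins_at X i [Fun HTop []])) P"
    and C: "args_pay w (Fun (Orig f) (map (\<lambda>l. subst (xi rules HTop l) \<sigma>) ls @ ins_at X i [Fun HTop []]))"
  obtains R \<sigma>' p where "s = lhs_inst f R ls \<sigma>'" "rules f ! i \<in> R" "R \<subseteq> set (rules f)"
    "\<And>k. stage w ls cs 0 \<sigma>' \<sigma> p k" "P = (\<Sum>x\<in>rvars ls cs 0. p x)"
    "\<And>zs. ins_at X i zs = ins_at (flags rules f R) i zs"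
proof -
  note rp = rule_props[OF r]
  from sim obtain R ss Ts q where s: "s = Fun (f, R) ss" "length ss = ar f" "R \<subseteq> set (rules f)"
    "\<And>k. k < ar f \<Longrightarrow> sim ar rules w (ss ! k) (Ts ! k) (q k)" "P = (\<Sum>k<ar f. q k)" "length Ts = ar f"
    "map (\<lambda>l. subst (xi rules HTop l) \<sigma>) ls @ ins_at X i [Fun HTop []] = Ts @ flags rules f R"
    by (auto elim!: sim_OrigE)
  then have Ts: "Ts = map (\<lambda>l. subst (xi rules HTop l) \<sigma>) ls"
    and fl: "ins_at X i [Fun HTop []] = flags rules f R" using rp(2) by auto
  have fl': "flags rules f R = ins_at (flags rules f R) i [flags rules f R ! i]"
    using r(1) by (simp add: ins_at_single)
  have "flags rules f R ! i = Fun HTop []" using r(1) X by (simp add: fl[symmetric] ins_at_single)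
  then have R: "rules f ! i \<in> R" using r(1) by (auto simp: flags_def split: if_splits)
  have *: "\<exists>\<sigma>' p. ss ! k = subst (label rules (ls ! k)) \<sigma>' \<and>
      (\<forall>x\<in>vars (ls ! k). sim ar rules w (\<sigma>' x) (\<sigma> x) (p x)) \<and> q k = (\<Sum>x\<in>vars (ls ! k). p x)"
    if "k < length ls" for k
    using sim_match[of "ls ! k" w "ss ! k" \<sigma> "q k"] rp(2-4) s(4)[of k] that unfolding Ts by simp
  obtain \<sigma>' p where m: "ss = map (\<lambda>t. subst (label rules t) \<sigma>') ls"
    "\<And>x. x \<in> (\<Union>t\<in>set ls. vars t) \<Longrightarrow> sim ar rules w (\<sigma>' x) (\<sigma> x) (p x)"
    "(\<Sum>k<length ls. q k) = (\<Sum>x\<in>(\<Union>t\<in>set ls. vars t). p x)"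
    using sim_match_args[of ls ss w \<sigma> q, OF rp(5) _ *] s(2) rp(2) by auto
  have "pays rules w (\<sigma>' x) (p x)" if x: "x \<in> (\<Union>t\<in>set ls. vars t)" for x
  proof (rule args_payD[OF C _ m(2)[OF x]])
    obtain k where k: "k < length ls" "x \<in> vars (ls ! k)" using x by (auto simp: in_set_conv_nth)
    show "psub ar (Fun (Orig f) (map (\<lambda>l. subst (xi rules HTop l) \<sigma>) ls @ ins_at X i [Fun HTop []])) (\<sigma> x)"
      using k rp(2) asub_subst_cterm[OF rp(3)[of "ls ! k"] k(2), of \<sigma>]
      by (intro psub.intros[of k]) (auto simp: nth_append)
  qed
  then have "stage w ls cs 0 \<sigma>' \<sigma> p k" for k using m(2) by (simp add: stage_def rvars_def)
  moreover have "ins_at X i zs = ins_at (flags rules f R) i zs" for zs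
    by (rule ins_at_inj(2)[of X "flags rules f R" "[Fun HTop []]" "[flags rules f R ! i]"])
      (use X fl fl' in auto)
  ultimately show thesis
    using that[of R \<sigma>' p] s m R rp(2) by (simp add: lhs_inst_def rvars_def)
qed

text \<open>The substitution hidden in \<open>sim_cond\<close> and the matcher
  \<open>\<sigma>\<close> yield the same instances of the patterns, so they agree on
  \<open>rvars ls cs j\<close> and the former can be eliminated.\<close>

lemma sim_cond_match:
  assumes r: "i < length (rules f)" "rules f ! i = (Fun f ls, r, cs)" and X: "length X = length (rules f)"
    and sim: "sim ar rules w s (Fun (Cond f i j) (map (\<lambda>l. subst (xi rules HTop l) \<sigma>) ls @
      ins_at X i (map (\<lambda>c. subst (xi rules HTop (snd c)) \<sigma>) (take j cs) @ [u]))) P"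
  obtains R \<sigma>' p k v c Pu where "s = lhs_inst f R ls \<sigma>'" "rules f ! i \<in> R" "R \<subseteq> set (rules f)" "j < length cs"
    "stage w ls cs j \<sigma>' \<sigma> p k" "lsteps rules (subst (label rules (fst (cs ! j))) \<sigma>') v c"
    "sim ar rules w v u Pu" "P = (\<Sum>m<j. k m) + c + Pu + (\<Sum>x \<in> rvars ls cs j - avars cs (Suc j). p x)"
    "\<And>zs. ins_at X i zs = ins_at (flags rules f R) i zs"
  using sim
proof (cases rule: sim.cases)
  case (sim_cond ls' r' cs' R \<sigma>' \<sigma>0 p k v c u0 Pu)
  then have eq: "ls' = ls" "cs' = cs" using r(2) by auto
  note sc = sim_cond[unfolded eq]
  have args: "map (\<lambda>l. subst (xi rules HTop l) \<sigma>) ls @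
      ins_at X i (map (\<lambda>c. subst (xi rules HTop (snd c)) \<sigma>) (take j cs) @ [u])
    = map (\<lambda>l. subst (xi rules HTop l) \<sigma>0) ls @
      ins_at (flags rules f R) i (map (\<lambda>c. subst (xi rules HTop (snd c)) \<sigma>0) (take j cs) @ [u0])"
    by (rule sc(2))
  then have 1: "map (\<lambda>l. subst (xi rules HTop l) \<sigma>) ls = map (\<lambda>l. subst (xi rules HTop l) \<sigma>0) ls"
    and 2: "ins_at X i (map (\<lambda>c. subst (xi rules HTop (snd c)) \<sigma>) (take j cs) @ [u])
      = ins_at (flags rules f R) i (map (\<lambda>c. subst (xi rules HTop (snd c)) \<sigma>0) (take j cs) @ [u0])" by auto
  have 3: "map (\<lambda>c. subst (xi rules HTop (snd c)) \<sigma>) (take j cs) @ [u]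
      = map (\<lambda>c. subst (xi rules HTop (snd c)) \<sigma>0) (take j cs) @ [u0]"
    by (rule ins_at_inj(1)[OF _ _ 2]) (use X in auto)
  then have u: "u0 = u" by simp
  have "\<sigma>0 x = \<sigma> x" if x: "x \<in> rvars ls cs j" for x
  proof -
    consider l where "l \<in> set ls" "x \<in> vars l" | m where "m < j" "x \<in> vars (snd (cs ! m))"
      using x by (auto simp: rvars_def)
    then show ?thesis
    proof cases
      case 1
      then have "subst (xi rules HTop l) \<sigma>0 = subst (xi rules HTop l) \<sigma>"
        using \<open>map _ ls = map _ ls\<close> by simp
      then show ?thesis using 1(2) by (auto dest: subst_eqD)
    next
      case (2 m)
      have "map (\<lambda>c. subst (xi rules HTop (snd c)) \<sigma>) (take j cs) ! m
        = map (\<lambda>c. subst (xi rules HTop (snd c)) \<sigma>0) (take j cs) ! m" using 3 by (metis append1_eq_conv)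
      then have "subst (xi rules HTop (snd (cs ! m))) \<sigma>0 = subst (xi rules HTop (snd (cs ! m))) \<sigma>"
        using 2(1) sc(8) by simp
      then show ?thesis using 2(2) by (auto dest: subst_eqD)
    qed
  qed
  then have "stage w ls cs j \<sigma>' \<sigma> p k" using sc(9,10) by (simp add: stage_def)
  moreover have "ins_at X i zs = ins_at (flags rules f R) i zs" for zs
    by (rule ins_at_inj(2)[OF _ _ 2]) (use X in auto)
  ultimately show thesis using that[of R \<sigma>' p k v c Pu] sc u unfolding lhs_inst_def by blast
qed

text \<open>The term \<open>v\<close> is an instance of the pattern of condition \<open>j\<close>,
  and its matcher can be joined with \<open>\<sigma>'\<close> because the pattern shares no variable
  with those bound before. The accounts balance exactly: \<open>c\<close> becomes the cost of the
  settled condition and \<open>P\<close> is distributed over the pattern variables.\<close>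

lemma sim_cond_next:
  assumes r: "i < length (rules f)" "rules f ! i = (Fun f ls, r, cs)" and j: "j < length cs"
    and st: "stage w ls cs j \<sigma>' \<sigma> p k"
    and v: "lsteps rules (subst (label rules (fst (cs ! j))) \<sigma>') v c"
      "sim ar rules w v (subst (xi rules HTop (snd (cs ! j))) \<sigma>) P"
    and C: "\<forall>x\<in>vars (snd (cs ! j)). \<forall>s P. sim ar rules w s (\<sigma> x) P \<longrightarrow> pays rules w s P"
  obtains \<tau> q k' where "\<And>R. lhs_inst f R ls \<tau> = lhs_inst f R ls \<sigma>'" "stage w ls cs (Suc j) \<tau> \<sigma> q k'"
    "(\<Sum>m<j. k m) + c + P + (\<Sum>x \<in> rvars ls cs j - avars cs (Suc j). p x)
      = (\<Sum>m<Suc j. k' m) + (\<Sum>x \<in> rvars ls cs (Suc j) - avars cs (Suc j). q x)"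
proof -
  note rp = rule_props[OF r]
  let ?B = "vars (snd (cs ! j))"
  obtain \<theta> q where \<theta>: "v = subst (label rules (snd (cs ! j))) \<theta>"
    "\<And>x. x \<in> ?B \<Longrightarrow> sim ar rules w (\<theta> x) (\<sigma> x) (q x)" "P = (\<Sum>x\<in>?B. q x)"
    using sim_match[OF rp(7,8)[OF j] v(2)] by blast
  define \<tau> where "\<tau> x = (if x \<in> ?B then \<theta> x else \<sigma>' x)" for x
  define q' where "q' x = (if x \<in> ?B then q x else p x)" for x
  define k' where "k' = k(j := c)"
  have B: "?B \<inter> rvars ls cs j = {}" by (rule rp(10)[OF j])
  have \<tau>: "subst (label rules t) \<tau> = subst (label rules t) \<sigma>'" if "vars t \<subseteq> rvars ls cs j" for t
    by (intro subst_cong) (use that B in \<open>auto simp: \<tau>_def\<close>)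
  have \<tau>B: "subst (label rules (snd (cs ! j))) \<tau> = v"
    unfolding \<theta>(1) by (intro subst_cong) (auto simp: \<tau>_def)
  show thesis
  proof (rule that)
    show "lhs_inst f R ls \<tau> = lhs_inst f R ls \<sigma>'" for R
      unfolding lhs_inst_def using \<tau> by (auto simp: rvars_def)
    have "sim ar rules w (\<tau> x) (\<sigma> x) (q' x) \<and> pays rules w (\<tau> x) (q' x)" if "x \<in> rvars ls cs (Suc j)" for x
      using that st C \<theta>(2) B by (auto simp: rvars_Suc \<tau>_def q'_def stage_def)
    moreover have "lsteps rules (subst (label rules (fst (cs ! m))) \<tau>) (subst (label rules (snd (cs ! m))) \<tau>) (k' m)"
      if "m < Suc j" for m
    proof (cases "m = j")
      case True
      then show ?thesis using v(1) \<tau>[OF rp(11)[OF j]] \<tau>B by (simp add: k'_def)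
    next
      case False
      then have m: "m < j" using that by simp
      have "vars (fst (cs ! m)) \<subseteq> rvars ls cs j" "vars (snd (cs ! m)) \<subseteq> rvars ls cs j"
        using rp(11)[of m] m j rvars_mono[of m j ls cs] by (auto simp: rvars_def)
      then show ?thesis using st m \<tau> by (simp add: stage_def k'_def)
    qed
    ultimately show "stage w ls cs (Suc j) \<tau> \<sigma> q' k'" by (simp add: stage_def)
    have "rvars ls cs (Suc j) - avars cs (Suc j) = ?B \<union> (rvars ls cs j - avars cs (Suc j))"
      using avars_disjoint[OF r j] by (auto simp: rvars_Suc)
    then have "(\<Sum>x \<in> rvars ls cs (Suc j) - avars cs (Suc j). q' x)
      = (\<Sum>x\<in>?B. q' x) + (\<Sum>x \<in> rvars ls cs j - avars cs (Suc j). q' x)"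
      using B by (simp add: finite_vars finite_rvars sum.union_disjoint disjoint_iff)
    also have "(\<Sum>x\<in>?B. q' x) = P" unfolding \<theta>(3) by (intro sum.cong) (auto simp: q'_def)
    also have "(\<Sum>x \<in> rvars ls cs j - avars cs (Suc j). q' x) = (\<Sum>x \<in> rvars ls cs j - avars cs (Suc j). p x)"
      by (intro sum.cong) (use B in \<open>auto simp: q'_def\<close>)
    finally show "(\<Sum>m<j. k m) + c + P + (\<Sum>x \<in> rvars ls cs j - avars cs (Suc j). p x)
      = (\<Sum>m<Suc j. k' m) + (\<Sum>x \<in> rvars ls cs (Suc j) - avars cs (Suc j). q' x)"
      by (simp add: k'_def)
  qed
qed

end

section \<open>Simulating single steps\<close>

context cctrs
begin

text \<open>A bot-step neither erases nor freezes arguments, so the pending cost stays the same, and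
  only the instance part of \<open>ap_sim\<close> is used.\<close>

lemma sim_root_type6:
  assumes r: "i < length (rules f)" "rules f ! i = (Fun f ls, r, cs)" and j: "j < length ls"
    and ap: "ap ar rules (ls ! j) v" and len: "length ys = length ls" "length xs = length (rules f)"
    and sim: "sim ar rules w s (Fun (Orig f) (map (\<lambda>t. subst t \<sigma>) ((map Var ys)[j := v]) @
      ins_at (map \<sigma> xs) i [Fun HTop []])) P"
    and C: "args_pay w (subst v \<sigma>)"
  shows "\<exists>s'. lstep rules s s' 0 \<and> sim ar rules w s' (Fun (Orig f) (map (\<lambda>t. subst t \<sigma>) ((map Var ys)[j := v]) @
      ins_at (map \<sigma> xs) i [Fun HBot []])) P"
proof -
  note rp = rule_props[OF r]
  let ?Ts = "map (\<lambda>t. subst t \<sigma>) ((map Var ys)[j := v])"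
  from sim obtain R ss Ts p where s: "s = Fun (f, R) ss" "?Ts @ ins_at (map \<sigma> xs) i [Fun HTop []] = Ts @ flags rules f R"
    "length ss = ar f" "length Ts = ar f" "R \<subseteq> set (rules f)"
    "\<And>k. k < ar f \<Longrightarrow> sim ar rules w (ss ! k) (Ts ! k) (p k)" "P = (\<Sum>k<ar f. p k)"
    by (rule sim_OrigE) blast
  have Ts: "Ts = ?Ts" and fl: "flags rules f R = ins_at (map \<sigma> xs) i [Fun HTop []]"
    using s(2,4) len rp(2) by auto
  have fi: "flags rules f R ! i = Fun HTop []" using r(1) len by (simp add: fl ins_at_single)
  then have R: "rules f ! i \<in> R" using r(1) by (auto simp: flags_def split: if_splits)
  have fl': "ins_at (map \<sigma> xs) i [Fun HBot []] = flags rules f (R - {rules f ! i})"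
    using r(1) len by (simp add: ins_at_single flags_remove[symmetric] fl)
  have "Ts ! j = subst v \<sigma>" using Ts j len by simp
  then have "sim ar rules w (ss ! j) (subst v \<sigma>) (p j)" using s(6)[of j] j rp(2) by simp
  from ap_sim[OF ap rp(3)[OF nth_mem[OF j]] finite_vars[of "fst (rules f ! i)"] this C]
  obtain u \<tau> where u: "linear_term u" "lnf u" "vars u \<inter> vars (fst (rules f ! i)) = {}"
    "\<not> unifiable (erase u) (ls ! j)" "ss ! j = subst u \<tau>" by blast
  obtain zs where zs: "length zs = length ls" "distinct zs" "set zs \<inter> (vars u \<union> vars (fst (rules f ! i))) = {}"
    using fresh_list[OF inf, of "vars u \<union> vars (fst (rules f ! i))"] by (auto simp: finite_vars)
  let ?us = "(map Var zs)[j := u]"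
  have us: "x \<in> Var ` set zs \<union> {u}" if "x \<in> set ?us" for x
    using that set_update_subset_insert[of "map Var zs" j u] by auto
  have pd: "pdisj ?us" using zs by (intro pdisj_map_Var_update) auto
  have "\<exists>\<tau>. ss ! k = subst (?us ! k) \<tau>" if "k < length ?us" for k
    using u(5) that zs(1) by (cases "k = j") auto
  then obtain \<theta> where \<theta>: "ss = map (\<lambda>t. subst t \<theta>) ?us"
    using merge_match[OF pd, of ss] s(3) zs(1) rp(2) by auto
  have "lstep rules s (replace_at s [] (Fun (f, R - {rules f ! i}) ss)) 0"
  proof (rule lstep_lsteps.bot_step[where us = ?us and \<sigma> = \<theta>])
    show "linear_term (Fun (f, R) ?us)" using pd us u(1) by (fastforce simp: linear_Fun)
    show "\<forall>t\<in>set ?us. lnf t" using us u(2) by fastforce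
    show "vars (Fun (f, R) ?us) \<inter> vars (fst (rules f ! i)) = {}" using us u(3) zs(3) by fastforce
    show "subt_at s [] = subst (Fun (f, R) ?us) \<theta>" using s(1) \<theta> by simp
    show "\<not> unifiable (Fun f (map erase ?us)) (fst (rules f ! i))"
      using not_unifiable_update[OF zs(1) j u(4)] r(2) by simp
  qed (use s(1) R in auto)
  moreover have "sim ar rules w (Fun (f, R - {rules f ! i}) ss) (Fun (Orig f) (?Ts @ ins_at (map \<sigma> xs) i [Fun HBot []])) P"
    unfolding fl' Ts[symmetric] s(7) using sim_fun[of ss ar f Ts "R - {rules f ! i}" rules w p] s by auto
  ultimately show ?thesis by auto
qed

text \<open>In front of the active argument stand \<open>ar f\<close> instances of left-hand side
  arguments, \<open>i\<close> flags and \<open>j\<close> settled patterns.\<close>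

lemma cond_active_arg:
  assumes "length As = ar f" "i < length X" "length Bs = j"
  shows "ar f + i + j < length (As @ ins_at X i (Bs @ [u]))"
    "(As @ ins_at X i (Bs @ [u])) ! (ar f + i + j) = u"
    "(As @ ins_at X i (Bs @ [u]))[ar f + i + j := u'] = As @ ins_at X i (Bs @ [u'])"
  using assms by (auto simp: ins_at_def nth_append list_update_append)

lemma psub_cond_arg:
  assumes "length As = ar f" "i < length X" "length Bs = j" "asub ar u U"
  shows "psub ar (Fun (Cond f i j) (As @ ins_at X i (Bs @ [u]))) U"
  using psub_arg[of "ar f + i + j" ar "Cond f i j", OF _ cond_active_arg(1)[OF assms(1-3), of u]]
    cond_active_arg(2)[OF assms(1-3), of u] assms(4) by simp

text \<open>Rules of types 2 and 4 merely open a condition and may leave \<open>s\<close> in place;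
  all other types force at least one labeled step. The last disjunction exports this dichotomy for
  the termination argument.\<close>

lemma sim_root:
  assumes xi: "xi_rule ar rules l r k" and sim: "sim ar rules w s (subst l \<sigma>) P"
    and C: "args_pay w (subst l \<sigma>)"
  shows "\<exists>s' c P'. lsteps rules s s' c \<and> sim ar rules w s' (subst r \<sigma>) P' \<and> (w \<longrightarrow> P + k \<le> c + P') \<and>
    ((\<exists>f i j us. r = Fun (Cond f i j) us) \<or> (red rules)\<^sup>+\<^sup>+ s s')"
  using xi
proof cases
  case (type1 i f ls r' cs xs)
  note ru = type1(3,4)
  have len: "length (map \<sigma> xs) = length (rules f)" using type1(6) by simp
  have T: "subst l \<sigma> = Fun (Orig f) (map (\<lambda>l. subst (xi rules HTop l) \<sigma>) ls @ ins_at (map \<sigma> xs) i [Fun HTop []])"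
    by (simp add: type1 map_ins_at o_def)
  obtain R \<sigma>' p where m: "s = lhs_inst f R ls \<sigma>'" "rules f ! i \<in> R" "R \<subseteq> set (rules f)"
    "\<And>k. stage w ls cs 0 \<sigma>' \<sigma> p k" "P = (\<Sum>x\<in>rvars ls cs 0. p x)"
    by (rule sim_orig_match[OF ru len sim[unfolded T] C[unfolded T]]) (rule that)
  have "stage w ls cs (length cs) \<sigma>' \<sigma> p (\<lambda>_. 0)" using m(4) type1(5) by simp
  from sim_success[OF ru m(2) this] show ?thesis
    unfolding type1(1,2) m(1,5) by (fastforce simp: type1(5) avars_def)
next
  case (type2 i f ls r' cs xs)
  note ru = type2(3,4)
  have len: "length (map \<sigma> xs) = length (rules f)" using type2(6) by simp
  have T: "subst l \<sigma> = Fun (Orig f) (map (\<lambda>l. subst (xi rules HTop l) \<sigma>) ls @ ins_at (map \<sigma> xs) i [Fun HTop []])"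
    by (simp add: type2 map_ins_at o_def)
  obtain R \<sigma>' p where m: "s = lhs_inst f R ls \<sigma>'" "rules f ! i \<in> R" "R \<subseteq> set (rules f)"
    "\<And>k. stage w ls cs 0 \<sigma>' \<sigma> p k" "P = (\<Sum>x\<in>rvars ls cs 0. p x)"
    "\<And>zs. ins_at (map \<sigma> xs) i zs = ins_at (flags rules f R) i zs"
    by (rule sim_orig_match[OF ru len sim[unfolded T] C[unfolded T]]) (rule that)
  have T': "subst r \<sigma> = cond_inst f i 0 R ls cs \<sigma> (subst (xi rules HTop (fst (cs ! 0))) \<sigma>)"
    by (simp add: type2 map_ins_at o_def cond_inst_def m(6))
  obtain P' where "sim ar rules w s (subst r \<sigma>) P'" "(\<Sum>x \<in> rvars ls cs 0 - avars cs 0. p x) \<le> P'"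
    using sim_start[OF ru m(2,3) _ m(4)] type2(5) unfolding T' m(1) by auto
  then show ?thesis using lsteps_refl[of rules s] unfolding type2(2) m(5)
    by (intro exI[of _ s] exI[of _ 0] exI[of _ P']) (auto simp: type2(1) avars_def)
next
  case (type3 i f ls r' cs xs)
  note ru = type3(3,4)
  have len: "length (map \<sigma> xs) = length (rules f)" using type3(6) by simp
  note rp = rule_props[OF ru]
  define j where "j = length cs - 1"
  have j: "j < length cs" "Suc j = length cs" using type3(5) by (auto simp: j_def)
  have cs: "map (\<lambda>c. subst (xi rules HTop (snd c)) \<sigma>) cs
    = map (\<lambda>c. subst (xi rules HTop (snd c)) \<sigma>) (take j cs) @ [subst (xi rules HTop (snd (cs ! j))) \<sigma>]"
  proof -
    have "cs = take j cs @ [cs ! j]" using take_Suc_conv_app_nth[OF j(1)] j(2) by simp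
    from arg_cong[OF this, of "map (\<lambda>c. subst (xi rules HTop (snd c)) \<sigma>)"] show ?thesis by simp
  qed
  have T: "subst l \<sigma> = Fun (Cond f i j) (map (\<lambda>l. subst (xi rules HTop l) \<sigma>) ls @
      ins_at (map \<sigma> xs) i (map (\<lambda>c. subst (xi rules HTop (snd c)) \<sigma>) (take j cs) @
        [subst (xi rules HTop (snd (cs ! j))) \<sigma>]))"
    unfolding cs[symmetric] by (simp add: type3 map_ins_at o_def j_def)
  obtain R \<sigma>' p k0 v c Pu where m: "s = lhs_inst f R ls \<sigma>'" "rules f ! i \<in> R" "R \<subseteq> set (rules f)" "j < length cs"
    "stage w ls cs j \<sigma>' \<sigma> p k0" "lsteps rules (subst (label rules (fst (cs ! j))) \<sigma>') v c"
    "sim ar rules w v (subst (xi rules HTop (snd (cs ! j))) \<sigma>) Pu"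
    "P = (\<Sum>m<j. k0 m) + c + Pu + (\<Sum>x \<in> rvars ls cs j - avars cs (Suc j). p x)"
    by (rule sim_cond_match[OF ru len sim[unfolded T]]) (rule that)
  have ac: "\<forall>x\<in>vars (snd (cs ! j)). \<forall>s P. sim ar rules w s (\<sigma> x) P \<longrightarrow> pays rules w s P"
  proof (intro ballI allI impI)
    fix x s P
    assume that: "x \<in> vars (snd (cs ! j))" "sim ar rules w s (\<sigma> x) P"
    show "pays rules w s P"
    proof (rule args_payD[OF C _ that(2)])
      show "psub ar (subst l \<sigma>) (\<sigma> x)"
        unfolding T using asub_subst_cterm[OF rp(7)[OF j(1)] that(1), of \<sigma>] ru(1) rp(2) type3(6) j(1)
        by (intro psub_cond_arg) auto
    qed
  qed
  obtain \<tau> q k' where n: "\<And>R. lhs_inst f R ls \<tau> = lhs_inst f R ls \<sigma>'" "stage w ls cs (Suc j) \<tau> \<sigma> q k'"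
    "P = (\<Sum>m<Suc j. k' m) + (\<Sum>x \<in> rvars ls cs (Suc j) - avars cs (Suc j). q x)"
    using sim_cond_next[OF ru m(4-7) ac] unfolding m(8) by metis
  from sim_success[OF ru m(2) n(2)[unfolded j(2)]] show ?thesis
    unfolding type3(1,2) m(1) n(1,3) j(2) by fastforce
next
  case (type4 i f ls r' cs j xs)
  note ru = type4(3,4)
  have len: "length (map \<sigma> xs) = length (rules f)" using type4(6) by simp
  note rp = rule_props[OF ru]
  have j: "j < length cs" using type4(5) by simp
  have cs: "map (\<lambda>c. subst (xi rules HTop (snd c)) \<sigma>) (take (Suc j) cs)
    = map (\<lambda>c. subst (xi rules HTop (snd c)) \<sigma>) (take j cs) @ [subst (xi rules HTop (snd (cs ! j))) \<sigma>]"
    using j by (simp add: take_Suc_conv_app_nth)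
  have T: "subst l \<sigma> = Fun (Cond f i j) (map (\<lambda>l. subst (xi rules HTop l) \<sigma>) ls @
      ins_at (map \<sigma> xs) i (map (\<lambda>c. subst (xi rules HTop (snd c)) \<sigma>) (take j cs) @
        [subst (xi rules HTop (snd (cs ! j))) \<sigma>]))"
    unfolding cs[symmetric] by (simp add: type4 map_ins_at o_def)
  obtain R \<sigma>' p k0 v c Pu where m: "s = lhs_inst f R ls \<sigma>'" "rules f ! i \<in> R" "R \<subseteq> set (rules f)" "j < length cs"
    "stage w ls cs j \<sigma>' \<sigma> p k0" "lsteps rules (subst (label rules (fst (cs ! j))) \<sigma>') v c"
    "sim ar rules w v (subst (xi rules HTop (snd (cs ! j))) \<sigma>) Pu"
    "P = (\<Sum>m<j. k0 m) + c + Pu + (\<Sum>x \<in> rvars ls cs j - avars cs (Suc j). p x)"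
    "\<And>zs. ins_at (map \<sigma> xs) i zs = ins_at (flags rules f R) i zs"
    by (rule sim_cond_match[OF ru len sim[unfolded T]]) (rule that)
  have ac: "\<forall>x\<in>vars (snd (cs ! j)). \<forall>s P. sim ar rules w s (\<sigma> x) P \<longrightarrow> pays rules w s P"
  proof (intro ballI allI impI)
    fix x s P
    assume that: "x \<in> vars (snd (cs ! j))" "sim ar rules w s (\<sigma> x) P"
    show "pays rules w s P"
    proof (rule args_payD[OF C _ that(2)])
      show "psub ar (subst l \<sigma>) (\<sigma> x)"
        unfolding T using asub_subst_cterm[OF rp(7)[OF j] that(1), of \<sigma>] ru(1) rp(2) type4(6) j
        by (intro psub_cond_arg) auto
    qed
  qed
  obtain \<tau> q k' where n: "\<And>R. lhs_inst f R ls \<tau> = lhs_inst f R ls \<sigma>'" "stage w ls cs (Suc j) \<tau> \<sigma> q k'"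
    "P = (\<Sum>m<Suc j. k' m) + (\<Sum>x \<in> rvars ls cs (Suc j) - avars cs (Suc j). q x)"
    using sim_cond_next[OF ru m(4-7) ac] unfolding m(8) by metis
  have T': "subst r \<sigma> = cond_inst f i (Suc j) R ls cs \<sigma> (subst (xi rules HTop (fst (cs ! Suc j))) \<sigma>)"
    by (simp add: type4 map_ins_at o_def cond_inst_def m(9))
  obtain P' where "sim ar rules w s (subst r \<sigma>) P'" "P \<le> P'"
    using sim_start[OF ru m(2,3) type4(5) n(2)] unfolding T' m(1) n(1,3) by auto
  then show ?thesis using lsteps_refl[of rules s] unfolding type4(2)
    by (intro exI[of _ s] exI[of _ 0] exI[of _ P']) (auto simp: type4(1))
next
  case (type5 i f ls r' cs j v' xs)
  note ru = type5(3,4)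
  have len: "length (map \<sigma> xs) = length (rules f)" using type5(7) by simp
  note rp = rule_props[OF ru]
  note j = type5(5)
  have T: "subst l \<sigma> = Fun (Cond f i j) (map (\<lambda>l. subst (xi rules HTop l) \<sigma>) ls @
      ins_at (map \<sigma> xs) i (map (\<lambda>c. subst (xi rules HTop (snd c)) \<sigma>) (take j cs) @ [subst v' \<sigma>]))"
    by (simp add: type5 map_ins_at o_def)
  obtain R \<sigma>' p k0 v c Pu where m: "s = lhs_inst f R ls \<sigma>'" "rules f ! i \<in> R" "R \<subseteq> set (rules f)" "j < length cs"
    "stage w ls cs j \<sigma>' \<sigma> p k0" "lsteps rules (subst (label rules (fst (cs ! j))) \<sigma>') v c"
    "sim ar rules w v (subst v' \<sigma>) Pu"
    "P = (\<Sum>m<j. k0 m) + c + Pu + (\<Sum>x \<in> rvars ls cs j - avars cs (Suc j). p x)"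
    "\<And>zs. ins_at (map \<sigma> xs) i zs = ins_at (flags rules f R) i zs"
    by (rule sim_cond_match[OF ru len sim[unfolded T]]) (rule that)
  have ac: "args_pay w (subst v' \<sigma>)"
    unfolding args_pay_def
  proof (intro allI impI)
    fix U s P
    assume that: "psub ar (subst v' \<sigma>) U" "sim ar rules w s U P"
    show "pays rules w s P"
    proof (rule args_payD[OF C _ that(2)])
      show "psub ar (subst l \<sigma>) U"
        unfolding T using psub_imp_asub[OF that(1)] ru(1) rp(2) type5(7) j
        by (intro psub_cond_arg) auto
    qed
  qed
  obtain u \<tau> d where u: "linear_term u" "lnf u" "vars u \<inter> vars (snd (cs ! j)) = {}"
    "\<not> unifiable (erase u) (snd (cs ! j))" "lsteps rules v (subst u \<tau>) d" "w \<longrightarrow> Pu \<le> d"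
    using ap_sim[OF type5(6) rp(7)[OF j] finite_vars[of "snd (cs ! j)"] m(7) ac] by blast
  have T': "subst r \<sigma> = Fun (Orig f) (map (\<lambda>l. subst (xi rules HTop l) \<sigma>) ls @ (flags rules f R)[i := Fun HBot []])"
    using ru(1) by (simp add: type5 map_ins_at o_def m(9) ins_at_single[of i "flags rules f R"])
  from sim_fail[OF ru m(2,3) j m(5,6) u(5,6,1,2,3,4)] show ?thesis
    unfolding T' type5(2) m(1,8) by fastforce
next
  case (type6 i f ls r' cs j v' ys xs)
  note ru = type6(3,4)
  note rp = rule_props[OF ru]
  let ?Ts = "map (\<lambda>t. subst t \<sigma>) ((map Var ys)[j := v'])"
  have T: "subst l \<sigma> = Fun (Orig f) (?Ts @ ins_at (map \<sigma> xs) i [Fun HTop []])"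
    by (simp add: type6 map_ins_at o_def)
  have T': "subst r \<sigma> = Fun (Orig f) (?Ts @ ins_at (map \<sigma> xs) i [Fun HBot []])"
    by (simp add: type6 map_ins_at o_def)
  have ac: "args_pay w (subst v' \<sigma>)"
    unfolding args_pay_def
  proof (intro allI impI)
    fix U s P
    assume that: "psub ar (subst v' \<sigma>) U" "sim ar rules w s U P"
    show "pays rules w s P"
    proof (rule args_payD[OF C _ that(2)])
      show "psub ar (subst l \<sigma>) U"
        unfolding T using psub_imp_asub[OF that(1)] type6(5,7) rp(2)
        by (intro psub.intros[of j]) (auto simp: nth_append)
    qed
  qed
  obtain s' where s': "lstep rules s s' 0" "sim ar rules w s' (subst r \<sigma>) P"
    using sim_root_type6[OF ru type6(5-8) sim[unfolded T] ac] unfolding T' by blast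
  then have "(red rules)\<^sup>+\<^sup>+ s s'" by blast
  then show ?thesis using s' lstep_imp_lsteps[OF s'(1)] unfolding type6(2)
    by (intro exI[of _ s'] exI[of _ 0] exI[of _ P]) auto
qed

text \<open>Below an \<open>Orig\<close> symbol the labeled steps are made in the corresponding
  argument. Inside an open condition \<open>s\<close> stays put and the recorded reduction of that
  condition is prolonged, its cost being collected there.\<close>

lemma sim_step:
  assumes "hst ar rules T T' k" "sim ar rules w s T P"
    and "args_pay w T"
  shows "\<exists>s' c P'. lsteps rules s s' c \<and> sim ar rules w s' T' P' \<and> (w \<longrightarrow> P + k \<le> c + P')"
  using assms
proof (induction arbitrary: s P rule: hst.induct)
  case (hst_root l r c \<sigma>)
  then show ?case using sim_root by blast
next
  case (hst_arg n g Ts t c)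
  have C: "args_pay w (Ts ! n)"
    using hst_arg.prems(2) psub_arg_trans[OF hst_arg.hyps(1,2)] unfolding args_pay_def by blast
  from hst_arg.prems(1) show ?case
  proof (cases rule: sim.cases)
    case (sim_fun ss f Ts0 R p)
    have n: "n < ar f" using hst_arg.hyps(1) sim_fun(2) by simp
    have "Ts ! n = Ts0 ! n" using n sim_fun by (simp add: nth_append)
    then have "sim ar rules w (ss ! n) (Ts ! n) (p n)" using sim_fun n by simp
    from hst_arg.IH[OF this C] obtain s' d P' where s': "lsteps rules (ss ! n) s' d"
      "sim ar rules w s' t P'" "w \<longrightarrow> p n + c \<le> d + P'" by blast
    have "lsteps rules s (Fun (f, R) (ss[n := s'])) d"
      using lsteps_Fun[OF s'(1)] n sim_fun by simp
    moreover have "sim ar rules w (Fun (f, R) (ss[n := s'])) (Fun (Orig f) (Ts0[n := t] @ flags rules f R))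
      (\<Sum>k<length (ss[n := s']). (p(n := P')) k)"
      using sim_fun n s'(2) by (intro sim.sim_fun) (auto simp: nth_list_update)
    moreover have "Fun g (Ts[n := t]) = Fun (Orig f) (Ts0[n := t] @ flags rules f R)"
      using sim_fun n by (simp add: list_update_append)
    moreover have "P + c \<le> d + (\<Sum>k<length (ss[n := s']). (p(n := P')) k)" if w
      using s'(3) that n sim_fun by (simp add: sum.remove[of "{..<ar f}" n])
    ultimately show ?thesis by metis
  next
    case (sim_cond i f ls r cs R j \<sigma>' \<sigma> p k v d u Pu)
    note rp = rule_props[OF sim_cond(5,6)]
    let ?As = "map (\<lambda>l. subst (xi rules HTop l) \<sigma>) ls"
    let ?Bs = "map (\<lambda>c. subst (xi rules HTop (snd c)) \<sigma>) (take j cs)"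
    note g = sim_cond(2)
    have Ts: "Ts = ?As @ ins_at (flags rules f R) i (?Bs @ [u])"
      using sim_cond(3) by simp
    have n: "n = ar f + i + j" using hst_arg.hyps(1) g by simp
    have len: "length ?As = ar f" "i < length (flags rules f R)" "length ?Bs = j"
      using rp(2) sim_cond(5,9) by auto
    note ca = cond_active_arg[of ?As f i "flags rules f R" ?Bs j, OF len]
    have "sim ar rules w v (Ts ! n) Pu" using sim_cond(13) unfolding Ts n ca .
    from hst_arg.IH[OF this C] obtain v' e P' where v': "lsteps rules v v' e"
      "sim ar rules w v' t P'" "w \<longrightarrow> Pu + c \<le> e + P'" by blast
    have "stage w ls cs j \<sigma>' \<sigma> p k" using sim_cond(10,11) by (simp add: stage_def)
    from sim_condI[OF sim_cond(5-9) this lsteps_trans[OF sim_cond(12) v'(1)] v'(2)]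
    have "sim ar rules w s (Fun g (Ts[n := t]))
      ((\<Sum>m<j. k m) + (d + e) + P' + (\<Sum>x \<in> rvars ls cs j - avars cs (Suc j). p x))"
      unfolding Ts n ca g by (simp add: sim_cond(1) lhs_inst_def cond_inst_def)
    then show ?thesis using v'(3) sim_cond(4) lsteps_refl[of rules s] by fastforce
  qed
qed

text \<open>Completeness of anti-patterns for images of labeled normal forms: the root is a defined
  symbol with all flags \<open>HBot\<close>, a different constructor, or the constructor of the
  pattern, and in the last case some argument is to blame for a failed match. \<open>V\<close> keeps
  the anti-pattern apart from the other variables of the left-hand side in which it will be
  placed.\<close>

lemma match_or_ap:
  assumes "is_cterm ar rules t" "linear_term t" "finite V"
    and "wf_lterm ar rules s" "lnf s" "vars s = {}"
  shows "(\<exists>\<tau>. zeta rules s = subst (xi rules HTop t) \<tau>) \<or>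
    (\<exists>pt \<tau>. ap ar rules t pt \<and> zeta rules s = subst pt \<tau> \<and> linear_term pt \<and> vars pt \<inter> V = {})"
  using assms
proof (induction t arbitrary: s)
  case (Var x)
  then show ?case by (intro disjI1 exI[of _ "\<lambda>_. zeta rules s"]) simp
next
  case (Fun f ts)
  obtain g ss where s: "s = Fun (g, {}) ss" "length ss = ar g"
    using Fun.prems(4-6) by (cases s) auto
  have ss: "wf_lterm ar rules u" "lnf u" "vars u = {}" if "u \<in> set ss" for u
    using that Fun.prems(4-6) s(1) by auto
  have z: "zeta rules s = Fun (Orig g) (map (zeta rules) ss @ replicate (length (rules g)) (Fun HBot []))"
    unfolding s by (simp add: map_replicate_const)
  obtain zs :: "'v list" where zs: "length zs = ar g" "distinct zs" "set zs \<inter> V = {}"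
    using fresh_list[OF inf Fun.prems(3)] .
  obtain \<tau> where \<tau>: "map (zeta rules) ss = map (\<lambda>t. subst t \<tau>) (map Var zs)"
    using merge_match[of "map Var zs :: ('f hsym, 'v) term list" "map (zeta rules) ss"] zs s(2)
    by (force intro: exI[of _ "\<lambda>_. _"])
  consider "rules g \<noteq> []" | "rules g = []" "g \<noteq> f" | "rules g = []" "g = f" by blast
  then show ?case
  proof cases
    case 1
    let ?pt = "Fun (Orig g) (map Var zs @ replicate (length (rules g)) (Fun HBot []))"
    have "ap ar rules (Fun f ts) ?pt" using ap.ap_def[of rules g zs ar f ts] 1 zs(1) by simp
    moreover have "zeta rules s = subst ?pt \<tau>" using z \<tau> by (simp add: o_def)
    moreover have "linear_term ?pt" using zs(2)
      by (auto simp: linear_Fun intro!: pdisj_ground)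
    ultimately show ?thesis using zs(3) by (intro disjI2 exI[of _ ?pt] exI[of _ \<tau>]) auto
  next
    case 2
    let ?pt = "Fun (Orig g) (map Var zs)"
    have "ap ar rules (Fun f ts) ?pt" using ap.ap_con[of rules g f zs ar ts] 2 zs(1) by simp
    moreover have "zeta rules s = subst ?pt \<tau>" using z \<tau> 2(1) by (simp add: o_def)
    ultimately show ?thesis using zs(2,3) by (intro disjI2 exI[of _ ?pt] exI[of _ \<tau>]) (auto simp: linear_Fun)
  next
    case 3
    have len: "length ts = length ss" using Fun.prems(1) s 3 by simp
    show ?thesis
    proof (cases "\<forall>k<length ts. \<exists>\<tau>. zeta rules (ss ! k) = subst (xi rules HTop (ts ! k)) \<tau>")
      case True
      have "pdisj (map (xi rules HTop) ts)" using Fun.prems(2) by (simp add: linear_Fun pdisj_nth)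
      then obtain \<tau> where "map (zeta rules) ss = map (\<lambda>t. subst t \<tau>) (map (xi rules HTop) ts)"
        using merge_match[of "map (xi rules HTop) ts" "map (zeta rules) ss"] len True by auto
      then show ?thesis using z 3 by (intro disjI1 exI[of _ \<tau>]) (simp add: o_def)
    next
      case False
      then obtain k where k: "k < length ts" "\<nexists>\<tau>. zeta rules (ss ! k) = subst (xi rules HTop (ts ! k)) \<tau>" by blast
      have mem: "ts ! k \<in> set ts" "ss ! k \<in> set ss" using k(1) len by auto
      have "is_cterm ar rules (ts ! k)" "linear_term (ts ! k)"
        using Fun.prems(1,2) mem(1) by (auto simp: linear_Fun)
      from Fun.IH[OF mem(1) this Fun.prems(3) ss[OF mem(2)]] k(2)
      obtain pt \<tau>' where pt: "ap ar rules (ts ! k) pt" "zeta rules (ss ! k) = subst pt \<tau>'"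
        "linear_term pt" "vars pt \<inter> V = {}" by blast
      obtain zs :: "'v list" where zs: "length zs = length ts" "distinct zs" "set zs \<inter> (V \<union> vars pt) = {}"
        using fresh_list[OF inf, of "V \<union> vars pt"] Fun.prems(3) by (auto simp: finite_vars)
      let ?ps = "(map Var zs)[k := pt]"
      have ps: "x \<in> Var ` set zs \<union> {pt}" if "x \<in> set ?ps" for x
        using that set_update_subset_insert[of "map Var zs" k pt] by auto
      have pd: "pdisj ?ps" using zs by (intro pdisj_map_Var_update) auto
      have "\<exists>\<tau>. map (zeta rules) ss ! m = subst (?ps ! m) \<tau>" if "m < length ?ps" for m
        using that pt(2) len zs(1) by (cases "m = k") auto
      then obtain \<tau> where \<tau>: "map (zeta rules) ss = map (\<lambda>t. subst t \<tau>) ?ps"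
        using merge_match[OF pd, of "map (zeta rules) ss"] len zs(1) by auto
      have "ap ar rules (Fun f ts) (Fun (Orig f) ?ps)" by (rule ap.ap_arg[OF k(1) zs(1) pt(1)])
      moreover have "zeta rules s = subst (Fun (Orig f) ?ps) \<tau>" using z \<tau> 3 by simp
      moreover have "linear_term (Fun (Orig f) ?ps)" using pd ps pt(3) by (fastforce simp: linear_Fun)
      moreover have "vars (Fun (Orig f) ?ps) \<inter> V = {}" using ps pt(4) zs(3) by fastforce
      ultimately show ?thesis by blast
    qed
  qed
qed

end

section \<open>Normal forms and completion of pending evaluations\<close>

lemma psub_size: "psub ar T U \<Longrightarrow> size U < size T"
proof (induction rule: psub.induct)
  case (psub_arg k g Ts U)
  have "size U \<le> size W" if "asub ar W U" for W
    using that
  proof induction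
    case (asub_arg k g Ts U)
    then have "size U \<le> size_list size Ts" using size_list_estimation'[OF nth_mem] by blast
    then show ?case by simp
  qed simp
  then have "size U \<le> size_list size Ts"
    using psub_arg size_list_estimation'[OF nth_mem] by blast
  then show ?case by simp
qed

section \<open>Subterms of labeled terms and lifting of steps along them\<close>

inductive lsub :: "('g, 'v) term \<Rightarrow> ('g, 'v) term \<Rightarrow> bool" where
  lsub_refl: "lsub s s"
| lsub_arg: "k < length ss \<Longrightarrow> lsub (ss ! k) s \<Longrightarrow> lsub (Fun g ss) s"

lemma lsub_trans: "lsub s t \<Longrightarrow> lsub t u \<Longrightarrow> lsub s u"
  by (induction rule: lsub.induct) (auto intro: lsub.intros)

lemma lsub_red: "lsub s t \<Longrightarrow> red rules t t' \<Longrightarrow> \<exists>s'. red rules s s' \<and> lsub s' t'"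
proof (induction rule: lsub.induct)
  case (lsub_arg k ss s g)
  then obtain s' c where "lstep rules (ss ! k) s' c" "lsub s' t'" by blast
  then show ?case using lstep_Fun[of rules "ss ! k" s' c k ss g] lsub_arg.hyps(1)
      lsub.lsub_arg[of k "ss[k := s']" t' g] by auto
qed (auto intro: lsub.intros)

lemma lsub_cond: "lsub s t \<Longrightarrow> lstep_cond rules t u \<Longrightarrow> lstep_cond rules s u"
proof (induction rule: lsub.induct)
  case (lsub_arg k ss s g)
  then obtain p \<rho> R f ls r cs \<sigma> j where "is_pos (ss ! k) p" "\<rho> \<in> R" "\<rho> = (Fun f ls, r, cs)"
      "subt_at (ss ! k) p = Fun (f, R) (map (\<lambda>l. subst (label rules l) \<sigma>) ls)" "j < length cs"
      "\<forall>i < j. \<exists>c. lsteps rules (subst (label rules (fst (cs ! i))) \<sigma>)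
                                (subst (label rules (snd (cs ! i))) \<sigma>) c"
      "u = subst (label rules (fst (cs ! j))) \<sigma>" unfolding lstep_cond_def by blast
  then show ?case unfolding lstep_cond_def using lsub_arg.hyps(1)
    by (intro exI[of _ "k # p"] exI[of _ \<rho>] exI[of _ R] exI[of _ f] exI[of _ ls] exI[of _ r]
        exI[of _ cs] exI[of _ \<sigma>] exI[of _ j]) simp
qed auto

section \<open>Exhibiting redexes by matching linear left-hand sides\<close>

definition matches :: "('f, 'v) term \<Rightarrow> ('f, 'v) term \<Rightarrow> bool" where
  "matches T p \<longleftrightarrow> (\<exists>\<tau>. T = subst p \<tau>)"

lemma matches_Var [simp]: "matches T (Var x)"
  by (auto simp: matches_def intro: exI[of _ "\<lambda>_. T"])

lemma matches_subst [simp]: "matches (subst t \<sigma>) t"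
  by (auto simp: matches_def)

lemma list_all2_matches_Var: "length Ts = length xs \<Longrightarrow> list_all2 matches Ts (map Var xs)"
  by (simp add: list_all2_conv_all_nth)

lemma list_all2_ins_at:
  "list_all2 P F X \<Longrightarrow> list_all2 P us vs \<Longrightarrow> list_all2 P (ins_at F i us) (ins_at X i vs)"
  unfolding ins_at_def by (intro list_all2_appendI list_all2_takeI list_all2_dropI)

lemma hst_matches:
  assumes "xi_rule ar rules (Fun g ps) r c" "linear_term (Fun g ps)" "list_all2 matches Ts ps"
  shows "\<exists>T'. hst ar rules (Fun g Ts) T' c"
proof -
  have "pdisj ps" using assms(2) by (simp add: linear_Fun)
  then obtain \<tau> where "Ts = map (\<lambda>p. subst p \<tau>) ps"
    using merge_match[of ps Ts] assms(3) by (auto simp: list_all2_conv_all_nth matches_def)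
  then show ?thesis using hst_root[OF assms(1), of \<tau>] by auto
qed

lemma linear_xi: "is_cterm ar rules t \<Longrightarrow> linear_term t \<Longrightarrow> linear_term (xi rules HTop t)"
  by (induction t) (auto simp: linear_Fun pdisj_nth)

context cctrs
begin

text \<open>Nothing is suspended in an image of \<open>zeta\<close>, hence the pending cost 0.
  Groundness matters since \<open>sim\<close> has no rule for variables.\<close>

lemma sim_zeta: "wf_lterm ar rules s \<Longrightarrow> vars s = {} \<Longrightarrow> sim ar rules w s (zeta rules s) 0"
proof (induction s)
  case (Fun g ss)
  obtain f R where g: "g = (f, R)" by force
  have "sim ar rules w (Fun (f, R) ss) (Fun (Orig f) (map (zeta rules) ss @ flags rules f R)) (\<Sum>k<length ss. 0)"
    by (rule sim_fun) (use Fun g in auto)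
  then show ?case by (simp add: g flags_def)
qed simp

text \<open>Any rule left in the label gives a root redex: if all arguments match its left-hand side
  it is of type 1 or 2, otherwise an anti-pattern applies to some argument and type 6 does.\<close>

lemma redex_exists:
  assumes R: "R \<subseteq> set (rules f)" "R \<noteq> {}" and ss: "length ss = ar f"
    "\<And>u. u \<in> set ss \<Longrightarrow> wf_lterm ar rules u" "\<And>u. u \<in> set ss \<Longrightarrow> lnf u" "\<And>u. u \<in> set ss \<Longrightarrow> vars u = {}"
  shows "\<exists>T' c. hst ar rules (Fun (Orig f) (map (zeta rules) ss @ flags rules f R)) T' c"
proof -
  obtain \<rho> where \<rho>: "\<rho> \<in> R" using R(2) by blast
  then have "\<rho> \<in> set (rules f)" using R(1) by blast
  then obtain i where i: "i < length (rules f)" "rules f ! i \<in> R" using \<rho> by (auto simp: in_set_conv_nth)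
  obtain g ls r cs where r0: "rules f ! i = (Fun g ls, r, cs)"
    using bspec[OF spec[OF conjunct2[OF strong[unfolded strong_cctrs_def]]] nth_mem[OF i(1)]]
    by (elim exE conjE) (rule that)
  have r: "rules f ! i = (Fun f ls, r, cs)" using rule_props(1)[OF i(1) r0] r0 by simp
  note rp = rule_props[OF i(1) r]
  have "flags rules f R ! i = Fun HTop []" using i by (simp add: flags_def)
  then have fl: "flags rules f R = ins_at (flags rules f R) i [Fun HTop []]"
    using i(1) by (metis ins_at_single length_flags list_update_id)
  have M: "list_all2 matches (flags rules f R) (ins_at (map Var xs) i [Fun HTop []])"
    if "length xs = length (rules f)" for xs
    by (subst fl, rule list_all2_ins_at, rule list_all2_matches_Var) (use that in \<open>auto simp: matches_def\<close>)
  show ?thesis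
  proof (cases "list_all2 matches (map (zeta rules) ss) (map (xi rules HTop) ls)")
    case True
    obtain xs :: "'v list" where xs: "length xs = length (rules f)" "distinct xs" "set xs \<inter> (\<Union>l\<in>set ls. vars l) = {}"
      using fresh_list[OF inf, of "\<Union>l\<in>set ls. vars l"] by (auto simp: finite_vars)
    let ?ps = "map (xi rules HTop) ls @ ins_at (map Var xs) i [Fun HTop []]"
    have "pdisj (map (xi rules HTop) ls)" using rp(5) by (simp add: pdisj_nth)
    then have lin: "linear_term (Fun (Orig f) ?ps)"
      using linear_xi[OF rp(3,4)] xs by (intro linear_lhs) (auto simp: linear_Fun)
    have m: "list_all2 matches (map (zeta rules) ss @ flags rules f R) ?ps"
      by (intro list_all2_appendI True M xs(1))
    show ?thesis
    proof (cases "cs = []")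
      case True
      show ?thesis using hst_matches[OF type1[OF i(1) r True xs(1) refl lin] lin m] by blast
    next
      case False
      show ?thesis using hst_matches[OF type2[OF i(1) r False xs(1) refl lin] lin m] by blast
    qed
  next
    case False
    then obtain j where j: "j < length ls" "\<not> matches (zeta rules (ss ! j)) (xi rules HTop (ls ! j))"
      using ss(1) rp(2) by (auto simp: list_all2_conv_all_nth)
    have mem: "ls ! j \<in> set ls" "ss ! j \<in> set ss" using j(1) ss(1) rp(2) by auto
    obtain pt where pt: "ap ar rules (ls ! j) pt" "matches (zeta rules (ss ! j)) pt" "linear_term pt"
      using match_or_ap[OF rp(3,4)[OF mem(1)] finite.emptyI ss(2-4)[OF mem(2)]] j(2) unfolding matches_def by blast
    obtain ys :: "'v list" where ys: "length ys = length ls" "distinct ys" "set ys \<inter> vars pt = {}"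
      using fresh_list[OF inf finite_vars] .
    obtain xs :: "'v list" where xs: "length xs = length (rules f)" "distinct xs" "set xs \<inter> (set ys \<union> vars pt) = {}"
      using fresh_list[OF inf, of "set ys \<union> vars pt"] by (auto simp: finite_vars)
    let ?As = "(map Var ys)[j := pt]"
    let ?ps = "?As @ ins_at (map Var xs) i [Fun HTop []]"
    have As: "x \<in> Var ` set ys \<union> {pt}" if "x \<in> set ?As" for x
      using that set_update_subset_insert[of "map Var ys" j pt] by auto
    have pd: "pdisj ?As" using ys by (intro pdisj_map_Var_update) auto
    have lin: "linear_term (Fun (Orig f) ?ps)"
    proof (rule linear_lhs[OF _ _ pd])
      show "\<forall>t\<in>set ?As. linear_term t" using As pt(3) by fastforce
      show "\<forall>t\<in>set ?As \<union> set [Fun HTop []]. vars t \<inter> set xs = {}" using As xs(3) by fastforce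
    qed (auto simp: linear_Fun xs(2))
    have "matches (map (zeta rules) ss ! k) (?As ! k)" if "k < ar f" for k
      using that ys(1) ss(1) rp(2) pt(2) by (cases "k = j") auto
    then have "list_all2 matches (map (zeta rules) ss) ?As"
      using ys(1) ss(1) rp(2) by (simp add: list_all2_conv_all_nth)
    then have m: "list_all2 matches (map (zeta rules) ss @ flags rules f R) ?ps"
      by (intro list_all2_appendI M xs(1))
    show ?thesis using hst_matches[OF type6[OF i(1) r j(1) pt(1) ys(1) xs(1) refl lin] lin m] by blast
  qed
qed

text \<open>A fully evaluated condition is decided: type 3 or 4 applies if its pattern matches, type
  5 otherwise. Most of the work lies in choosing variables that make the left-hand side
  linear.\<close>

lemma cond_redex_exists:
  assumes r: "i < length (rules f)" "rules f ! i = (Fun f ls, r, cs)" and j: "j < length cs"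
    and v: "wf_lterm ar rules v" "lnf v" "vars v = {}"
  shows "\<exists>T' c. hst ar rules (cond_inst f i j R ls cs \<sigma> (zeta rules v)) T' c"
proof -
  note rp = rule_props[OF r]
  let ?As = "map (xi rules HTop) ls"
  let ?Bs = "\<lambda>j. map (\<lambda>c. xi rules HTop (snd c)) (take j cs)"
  obtain q where q: "matches (zeta rules v) q" "linear_term q" "vars q \<inter> rvars ls cs j = {}"
    "q = xi rules HTop (snd (cs ! j)) \<or> ap ar rules (snd (cs ! j)) q"
  proof -
    have "linear_term (xi rules HTop (snd (cs ! j)))" using rp(7,8)[OF j] by (rule linear_xi)
    moreover have "vars (xi rules HTop (snd (cs ! j))) \<inter> rvars ls cs j = {}" using rp(10)[OF j] by simp
    ultimately show thesis
      using match_or_ap[OF rp(7,8)[OF j] finite_rvars[of ls cs j] v] that unfolding matches_def by blast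
  qed
  obtain xs :: "'v list" where xs: "length xs = length (rules f)" "distinct xs"
    "set xs \<inter> (rvars ls cs j \<union> vars q) = {}"
    using fresh_list[OF inf, of "rvars ls cs j \<union> vars q"] by (auto simp: finite_vars finite_rvars)
  let ?ps = "?As @ ins_at (map Var xs) i (?Bs j @ [q])"
  have B: "\<exists>m<j. b = xi rules HTop (snd (cs ! m))" if "b \<in> set (?Bs j)" for b
    using that j by (auto simp: in_set_conv_nth) (metis snd_conv)
  have Bv: "vars b \<subseteq> rvars ls cs j" if "b \<in> set (?Bs j)" for b
    using B[OF that] by (auto simp: rvars_def)
  have Av: "vars a \<subseteq> rvars ls cs j" if "a \<in> set ?As" for a
    using that by (auto simp: rvars_def)
  have lin: "linear_term (Fun (Cond f i j) ?ps)"
  proof (rule linear_lhs)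
    show "\<forall>t\<in>set ?As. linear_term t" using linear_xi[OF rp(3,4)] by auto
    have "linear_term b" if "b \<in> set (?Bs j)" for b
      using B[OF that] linear_xi[OF rp(7,8)] j by (metis order_less_trans)
    then show "\<forall>t\<in>set (?Bs j @ [q]). linear_term t" using q(2) by auto
    show "pdisj ?As" using rp(5) by (simp add: pdisj_nth)
    have "pdisj (?Bs j)" using rp(13) j by (simp add: pdisj_nth)
    moreover have Bq: "vars b \<inter> vars q = {}" if "b \<in> set (?Bs j)" for b using Bv[OF that] q(3) by blast
    ultimately show "pdisj (?Bs j @ [q])" by simp
    have "vars a \<inter> vars b = {}" if ab: "a \<in> set ?As" "b \<in> set (?Bs j)" for a b
    proof -
      obtain m where "m < j" "b = xi rules HTop (snd (cs ! m))" using B[OF ab(2)] by blast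
      then show ?thesis using ab(1) rp(12)[of m] j by fastforce
    qed
    moreover have "vars a \<inter> vars q = {}" if "a \<in> set ?As" for a using Av[OF that] q(3) by blast
    ultimately show "\<forall>t\<in>set ?As. \<forall>u\<in>set (?Bs j @ [q]). vars t \<inter> vars u = {}"
      unfolding set_append list.set by (metis UnE singletonD)
    have "vars t \<subseteq> rvars ls cs j \<union> vars q" if "t \<in> set ?As \<union> set (?Bs j @ [q])" for t
      using that Av[of t] Bv[of t] unfolding set_append by auto
    then show "\<forall>t\<in>set ?As \<union> set (?Bs j @ [q]). vars t \<inter> set xs = {}"
      using xs(3) by blast
  qed (rule xs(2))
  have m: "list_all2 matches (map (\<lambda>l. subst (xi rules HTop l) \<sigma>) ls @ ins_at (flags rules f R) i
      (map (\<lambda>c. subst (xi rules HTop (snd c)) \<sigma>) (take j cs) @ [zeta rules v])) ?ps"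
    by (intro list_all2_appendI list_all2_ins_at list_all2_matches_Var)
      (use xs(1) q(1) in \<open>auto simp: list_all2_conv_all_nth\<close>)
  have "\<exists>r c. xi_rule ar rules (Fun (Cond f i j) ?ps) r c"
    using q(4)
  proof
    assume "q = xi rules HTop (snd (cs ! j))"
    then have ps: "?ps = ?As @ ins_at (map Var xs) i (?Bs (Suc j))"
      using j by (simp add: take_Suc_conv_app_nth)
    show ?thesis
    proof (cases "Suc j < length cs")
      case True
      show ?thesis using type4[OF r True xs(1) refl lin[unfolded ps]] unfolding ps by blast
    next
      case False
      then have j': "j = length cs - 1" "cs \<noteq> []" "take (Suc j) cs = cs" using j by auto
      show ?thesis using type3[OF r j'(2) xs(1) refl lin[unfolded ps j'(3), unfolded j'(1)]]
        unfolding ps j'(3) unfolding j'(1) by blast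
    qed
  next
    assume "ap ar rules (snd (cs ! j)) q"
    from type5[OF r j this xs(1) refl lin] show ?thesis by blast
  qed
  then show ?thesis using hst_matches[OF _ lin m] unfolding cond_inst_def by blast
qed

text \<open>Active arguments of a normal form are normal forms. The two redex lemmas then exclude
  non-empty labels and \<open>Cond\<close> roots, so nothing remains suspended at an active
  position.\<close>

lemma sim_normal_form:
  assumes "sim ar rules w s T P" "\<nexists>T' c. hst ar rules T T' c"
  shows "T = zeta rules s \<and> lnf s \<and> wf_lterm ar rules s \<and> vars s = {}"
  using assms
proof (induction rule: sim.induct)
  case (sim_fun ss f Ts R p)
  have *: "Ts ! k = zeta rules (ss ! k) \<and> lnf (ss ! k) \<and> wf_lterm ar rules (ss ! k) \<and> vars (ss ! k) = {}"
    if k: "k < length ss" for k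
  proof -
    have "\<nexists>T' c. hst ar rules (Ts ! k) T' c"
    proof
      assume "\<exists>T' c. hst ar rules (Ts ! k) T' c"
      then obtain T' c where "hst ar rules ((Ts @ flags rules f R) ! k) T' c"
        using k sim_fun.hyps(2) by (auto simp: nth_append)
      from hst_arg[OF _ _ this, of "Orig f"] sim_fun.prems sim_fun.hyps(1,2) k show False by auto
    qed
    then show ?thesis using sim_fun.IH k by blast
  qed
  have Ts: "Ts = map (zeta rules) ss" using * sim_fun.hyps(2) by (auto simp: list_eq_iff_nth_eq)
  have ss: "lnf u \<and> wf_lterm ar rules u \<and> vars u = {}" if "u \<in> set ss" for u
    using that * by (auto simp: in_set_conv_nth)
  have "R = {}"
    using redex_exists[OF sim_fun.hyps(3) _ sim_fun.hyps(1)] ss sim_fun.prems unfolding Ts by blast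
  then show ?case using Ts ss sim_fun.hyps(1) by (auto simp: flags_def)
next
  case (sim_cond i f ls r cs R j \<sigma>' \<sigma> p k v c u P)
  note rp = rule_props[OF sim_cond.hyps(1,2)]
  let ?As = "map (\<lambda>l. subst (xi rules HTop l) \<sigma>) ls"
  let ?Bs = "map (\<lambda>c. subst (xi rules HTop (snd c)) \<sigma>) (take j cs)"
  have len: "length ?As = ar f" "i < length (flags rules f R)" "length ?Bs = j"
    using rp(2) sim_cond.hyps by auto
  note ca = cond_active_arg[of ?As f i "flags rules f R" ?Bs j, OF len]
  have "\<nexists>T' c. hst ar rules u T' c"
  proof
    assume "\<exists>T' c. hst ar rules u T' c"
    then obtain T' c where "hst ar rules ((?As @ ins_at (flags rules f R) i (?Bs @ [u])) ! (ar f + i + j)) T' c"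
      unfolding ca by blast
    from hst_arg[OF _ ca(1) this, of "Cond f i j"] sim_cond.prems show False by auto
  qed
  then have "u = zeta rules v" "lnf v" "wf_lterm ar rules v" "vars v = {}" using sim_cond.IH by auto
  then show ?case
    using cond_redex_exists[OF sim_cond.hyps(1,2,5), of v R \<sigma>] sim_cond.prems
    unfolding cond_inst_def by blast
qed

abbreviation hsn where
  "hsn \<equiv> Wellfounded.accp (\<lambda>T' T. \<exists>c. hst ar rules T T' c)"

text \<open>The outer induction is on termination of \<open>T\<close>, the inner one on the size of
  its active subterm \<open>U\<close>. An \<open>Orig\<close> root pays argument by argument. A
  \<open>Cond\<close> root makes a step, which \<open>sim_step\<close> turns into labeled steps and
  a new pending cost; the step lifts to \<open>T\<close>, where the outer hypothesis
  applies.\<close>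

lemma hsn_pays:
  assumes "hsn T" "asub ar T U" "sim ar rules w s U P"
  shows "pays rules w s P"
  using assms
proof (induction arbitrary: U s P rule: accp.induct)
  case (accI T)
  from accI.prems show ?case
  proof (induction "size U" arbitrary: U s P rule: less_induct)
    case less
    have C: "args_pay w U"
      unfolding args_pay_def
      using less.hyps psub_size asub_trans[OF less.prems(1) psub_imp_asub] by blast
    from less.prems(2) show ?case
    proof (cases rule: sim.cases)
      case (sim_fun ss f Ts R p)
      have "\<exists>t c. lsteps rules (ss ! k) t c \<and> (w \<longrightarrow> p k \<le> c)" if "k < length ss" for k
      proof -
        have "psub ar U (Ts ! k)" using psub_nth[of k ar "Orig f" "Ts @ flags rules f R"] sim_fun that
          by (simp add: nth_append)
        then show ?thesis using args_payD[OF C] sim_fun that by (auto simp: pays_def)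
      qed
      then have "\<forall>k. \<exists>t c. k < length ss \<longrightarrow> lsteps rules (ss ! k) t c \<and> (w \<longrightarrow> p k \<le> c)" by blast
      then obtain t c where tc: "\<And>k. k < length ss \<Longrightarrow> lsteps rules (ss ! k) (t k) (c k)"
        "\<And>k. k < length ss \<Longrightarrow> w \<Longrightarrow> p k \<le> c k" by metis
      have "lsteps rules s (Fun (f, R) (map t [0..<length ss])) (\<Sum>k<length ss. c k)"
        unfolding sim_fun(1) by (rule lsteps_args) (use tc(1) in auto)
      moreover have "P \<le> (\<Sum>k<length ss. c k)" if w
        unfolding sim_fun(3) by (intro sum_mono) (use tc(2) that in auto)
      ultimately show ?thesis unfolding pays_def by blast
    next
      case (sim_cond i f ls r cs R j \<sigma>' \<sigma> p k v d u Pu)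
      \<comment> \<open>\<open>zeta\<close> never yields a \<open>Cond\<close> root, so
        \<open>U\<close> is not a normal form and its evaluation can be continued.\<close>
      then have "U \<noteq> zeta rules s" by simp
      then obtain U' c where U': "hst ar rules U U' c" using sim_normal_form[OF less.prems(2)] by blast
      from sim_step[OF this less.prems(2) C] obtain s' d P' where s': "lsteps rules s s' d"
        "sim ar rules w s' U' P'" "w \<longrightarrow> P + c \<le> d + P'" by blast
      obtain T' where "hst ar rules T T' c" "asub ar T' U'" using asub_hst[OF less.prems(1) U'] by blast
      then have "pays rules w s' P'" using accI.IH s'(2) by blast
      then obtain t e where "lsteps rules s' t e" "w \<longrightarrow> P' \<le> e" unfolding pays_def by blast
      then show ?thesis using lsteps_trans[OF s'(1)] s'(3) unfolding pays_def by fastforce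
    qed
  qed
qed

lemma hsn_args_pay: "hsn T \<Longrightarrow> args_pay w T"
  unfolding args_pay_def using hsn_pays psub_imp_asub by blast

text \<open>Steps may leave their cost pending, so the invariant speaks about \<open>P + N\<close>;
  what is pending at the end is realised by \<open>hsn_pays\<close>.\<close>

lemma hsteps_simulated:
  assumes "hsteps ar rules T T' N" "hsn T" "sim ar rules True s T P"
  shows "\<exists>s' c. lsteps rules s s' c \<and> P + N \<le> c"
  using assms
proof (induction arbitrary: s P rule: hsteps.induct)
  case (hsteps_refl T)
  then show ?case using hsn_pays[OF hsteps_refl.prems(1) asub_refl hsteps_refl.prems(2)] by (simp add: pays_def)
next
  case (hsteps_step T U c1 T' c2)
  have st: "hst ar rules T U c1" using hsteps_step.hyps(1) by (simp add: hstep_iff_hst)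
  have "hsn U" using accp_downward[OF hsteps_step.prems(1)] st by blast
  obtain s' c P' where s': "lsteps rules s s' c" "sim ar rules True s' U P'" "P + c1 \<le> c + P'"
    using sim_step[OF st hsteps_step.prems(2) hsn_args_pay[OF hsteps_step.prems(1)]] by blast
  obtain t d where "lsteps rules s' t d" "P' + c2 \<le> d"
    using hsteps_step.IH[OF \<open>hsn U\<close> s'(2)] by blast
  then show ?case using lsteps_trans[OF s'(1)] s'(3) by fastforce
qed

end

section \<open>Termination\<close>

lemma pays_False: "pays rules False s P"
  unfolding pays_def using lsteps_refl by blast

context cctrs
begin

abbreviation lred where
  "lred \<equiv> \<lambda>S' S. red rules S S' \<or> lstep_cond rules S S'"

lemma args_pay_False: "args_pay False T"
  by (simp add: args_pay_def pays_False)

lemma lsteps_eq_or_tranclp: "lsteps rules s t c \<Longrightarrow> s = t \<or> (red rules)\<^sup>+\<^sup>+ s t"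
  using lsteps_imp_rtranclp rtranclpD by metis

text \<open>Induction on the number of conditions left and, within it, on accessibility of the
  active argument. With \<open>s\<close> unchanged, a root step can only be of type 4 and lowers the
  first measure, and an argument step lowers the second; if \<open>s\<close> moves,
  \<open>progress\<close> applies. The active argument is accessible by \<open>cond\<close>, since
  it is simulated by a reduct of the instantiated condition.\<close>

lemma sim_cond_hsn:
  assumes sim: "sim ar rules False s (Fun (Cond f i j) us) P"
    and progress: "\<And>s' T P. (red rules)\<^sup>+\<^sup>+ s s' \<Longrightarrow> sim ar rules False s' T P \<Longrightarrow> hsn T"
    and cond: "\<And>a v c u P. lstep_cond rules s a \<Longrightarrow> lsteps rules a v c \<Longrightarrow> sim ar rules False v u P \<Longrightarrow> hsn u"
  shows "hsn (Fun (Cond f i j) us)"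
  using sim
\<comment> \<open>The condition list is existentially hidden in \<open>sim_cond\<close>, so its
  length is read off from the rule itself.\<close>
proof (induction "length (snd (snd (rules f ! i))) - j" arbitrary: j us P rule: less_induct)
  case less
  have "\<exists>u. us ! (ar f + i + j) = u \<and> j < length (snd (snd (rules f ! i))) \<and> hsn u"
    using less.prems
  proof (cases rule: sim.cases)
    case (sim_cond ls r cs R \<sigma>' \<sigma> p k v c u P)
    note rp = rule_props[OF sim_cond(4,5)]
    have "lstep_cond rules s (subst (label rules (fst (cs ! j))) \<sigma>')"
      unfolding lstep_cond_def using sim_cond(1,5,6,8,10)
      by (intro exI[of _ "[]"] exI[of _ "rules f ! i"] exI[of _ R] exI[of _ f] exI[of _ ls] exI[of _ r]
          exI[of _ cs] exI[of _ \<sigma>'] exI[of _ j]) auto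
    then have "hsn u" using cond sim_cond(11,12) by blast
    moreover have "us ! (ar f + i + j) = u"
      unfolding sim_cond(2) using rp(2) sim_cond(4,8) by (intro cond_active_arg) auto
    ultimately show ?thesis using sim_cond(5,8) by auto
  qed
  then obtain u where j: "j < length (snd (snd (rules f ! i)))" and "us ! (ar f + i + j) = u" "hsn u" by blast
  from this(3,2) less.prems show ?case
  proof (induction arbitrary: us P rule: accp.induct)
    case (accI u)
    show ?case
    proof (rule accp.accI, elim exE)
      fix T' c
      assume st: "hst ar rules (Fun (Cond f i j) us) T' c"
      from st show "hsn T'"
      proof cases
        case (hst_root l r \<sigma>)
        obtain s' d P' where s': "lsteps rules s s' d" "sim ar rules False s' T' P'"
          "(\<exists>f i j us. r = Fun (Cond f i j) us) \<or> (red rules)\<^sup>+\<^sup>+ s s'"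
          using sim_root[OF hst_root(3) accI.prems(2)[unfolded hst_root(1)] args_pay_False]
          unfolding hst_root(2) by blast
        show ?thesis
        proof (cases "(red rules)\<^sup>+\<^sup>+ s s'")
          case True
          then show ?thesis using progress s'(2) by blast
        next
          case False
          then have "s' = s" using lsteps_eq_or_tranclp[OF s'(1)] by blast
          obtain f' i' j' vs where r: "r = Fun (Cond f' i' j') vs" using False s'(3) by blast
          define us' where "us' = map (\<lambda>t. subst t \<sigma>) vs"
          have T': "T' = Fun (Cond f' i' j') us'" using hst_root(2) r by (simp add: us'_def)
          \<comment> \<open>Only type 4 has \<open>Cond\<close> at the root on both sides.\<close>
          have "f' = f \<and> i' = i \<and> j' = Suc j"
            using hst_root(3)
          proof cases
            case (type4 i0 f0 ls r0 cs j0 xs)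
            then show ?thesis using hst_root(1) r by simp
          next
            case (type1 i0 f0 ls r0 cs xs)
            then show ?thesis using hst_root(1) by simp
          next
            case (type2 i0 f0 ls r0 cs xs)
            then show ?thesis using hst_root(1) by simp
          next
            case (type3 i0 f0 ls r0 cs xs)
            then show ?thesis using r by (cases r0) auto
          next
            case (type5 i0 f0 ls r0 cs j0 v xs)
            then show ?thesis using r by simp
          next
            case (type6 i0 f0 ls r0 cs j0 v ys xs)
            then show ?thesis using hst_root(1) by simp
          qed
          then show ?thesis using less.hyps[of "Suc j" us' P'] j s'(2) T' \<open>s' = s\<close> by simp
        qed
      next
        case (hst_arg k t)
        have k: "k = ar f + i + j" using hst_arg(2) by simp
        obtain s' d P' where s': "lsteps rules s s' d" "sim ar rules False s' T' P'"
          using sim_step[OF st accI.prems(2) args_pay_False] by blast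
        show ?thesis
        proof (cases "(red rules)\<^sup>+\<^sup>+ s s'")
          case True
          then show ?thesis using progress s'(2) by blast
        next
          case False
          then have "s' = s" using lsteps_eq_or_tranclp[OF s'(1)] by blast
          then show ?thesis
            using accI.IH[of t "us[k := t]" P'] hst_arg accI.prems(1) s'(2) unfolding k by auto
        qed
      qed
    qed
  qed
qed

text \<open>Flags are inactive, so only the first \<open>ar f\<close> arguments can be reduced, and
  lists of accessible terms are accessible for \<open>listrel1\<close>. A root step without labeled
  progress leads to a \<open>Cond\<close> root and is handed to \<open>sim_cond_hsn\<close>.\<close>

lemma sim_orig_hsn:
  assumes sim: "sim ar rules False s (Fun (Orig f) As) P"
    and args: "\<And>k. k < ar f \<Longrightarrow> hsn (As ! k)"
    and progress: "\<And>s' T P. (red rules)\<^sup>+\<^sup>+ s s' \<Longrightarrow> sim ar rules False s' T P \<Longrightarrow> hsn T"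
    and cond: "\<And>a v c u P. lstep_cond rules s a \<Longrightarrow> lsteps rules a v c \<Longrightarrow> sim ar rules False v u P \<Longrightarrow> hsn u"
  shows "hsn (Fun (Orig f) As)"
proof -
  let ?r = "{(T', T). \<exists>c. hst ar rules T T' c}"
  have len: "ar f \<le> length As" if "sim ar rules False s (Fun (Orig f) As) P" for As P
    using that by (elim sim_OrigE) simp
  have "take (ar f) As \<in> lists (Wellfounded.acc ?r)"
    using args len[OF sim] by (auto simp: in_set_conv_nth accp_eq_acc)
  then have "take (ar f) As \<in> Wellfounded.acc (listrel1 ?r)" by (rule lists_accD)
  then show ?thesis using sim
  proof (induction "take (ar f) As" arbitrary: As P rule: acc.induct)
    case accI
    show ?case
    proof (rule accp.accI, elim exE)
      fix T' c
      assume st: "hst ar rules (Fun (Orig f) As) T' c"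
      from st show "hsn T'"
      proof cases
        case (hst_root l r \<sigma>)
        obtain s' d P' where s': "lsteps rules s s' d" "sim ar rules False s' T' P'"
          "(\<exists>f i j us. r = Fun (Cond f i j) us) \<or> (red rules)\<^sup>+\<^sup>+ s s'"
          using sim_root[OF hst_root(3) accI.prems[unfolded hst_root(1)] args_pay_False]
          unfolding hst_root(2) by blast
        show ?thesis
        proof (cases "(red rules)\<^sup>+\<^sup>+ s s'")
          case True
          then show ?thesis using progress s'(2) by blast
        next
          case False
          then have "s' = s" using lsteps_eq_or_tranclp[OF s'(1)] by blast
          moreover obtain f' i' j' vs where "r = Fun (Cond f' i' j') vs" using False s'(3) by blast
          ultimately show ?thesis using hst_root(2) s'(2) sim_cond_hsn[OF _ progress cond] by force
        qed
      next
        case (hst_arg k t)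
        have k: "k < ar f" using hst_arg(2) by simp
        obtain s' d P' where s': "lsteps rules s s' d" "sim ar rules False s' T' P'"
          using sim_step[OF st accI.prems args_pay_False] by blast
        show ?thesis
        proof (cases "(red rules)\<^sup>+\<^sup>+ s s'")
          case True
          then show ?thesis using progress s'(2) by blast
        next
          case False
          then have s: "s' = s" using lsteps_eq_or_tranclp[OF s'(1)] by blast
          have "take (ar f) As = (take (ar f) (As[k := t]))[k := take (ar f) As ! k]"
            by (simp only: take_update_swap list_update_overwrite list_update_id)
          moreover have "(take (ar f) (As[k := t]) ! k, take (ar f) As ! k) \<in> ?r"
            using hst_arg(3,4) k by auto
          moreover have "k < length (take (ar f) (As[k := t]))" using hst_arg(3) k by simp
          ultimately have "(take (ar f) (As[k := t]), take (ar f) As) \<in> listrel1 ?r"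
            unfolding listrel1_iff_update by blast
          from accI(2)[OF this] show ?thesis using s'(2) unfolding s hst_arg(1) by blast
        qed
      qed
    qed
  qed
qed

text \<open>\<open>lred\<close> takes the successor first, so \<open>S'\<close> is reachable from
  \<open>S\<close>. Subterms are included because \<open>sim\<close> descends into arguments: their
  labeled steps lift to the term above, while \<open>lstep_cond\<close> leads from a subterm to a
  condition standing on its own.\<close>

lemma accp_lred_imp_hsn:
  assumes "Wellfounded.accp lred S"
  shows "lred\<^sup>*\<^sup>* S' S \<Longrightarrow> lsub S' s \<Longrightarrow> sim ar rules False s T P \<Longrightarrow> hsn T"
  using assms
proof (induction arbitrary: S' s T P rule: accp.induct)
  case (accI S)
  have IH: "hsn T" if "lred\<^sup>+\<^sup>+ S' S" "lsub S' s" "sim ar rules False s T P" for S' s T P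
    using that(1)
  proof (cases rule: tranclp.cases)
    case r_into_trancl
    then show ?thesis using accI.IH[OF _ rtranclp.rtrancl_refl that(2,3)] by blast
  next
    case (trancl_into_trancl S1)
    then show ?thesis using accI.IH[OF _ tranclp_into_rtranclp that(2,3)] by blast
  qed
  \<comment> \<open>Passing from \<open>S\<close> to a subterm is no descent for
    \<open>lred\<close>, so the terms inside \<open>S\<close> itself are treated by induction on
    their size.\<close>
  have base: "hsn T" if "lsub S s" "sim ar rules False s T P" for s T P
    using that
  proof (induction "size s" arbitrary: s T P rule: less_induct)
    case less
    have progress: "hsn T" if "(red rules)\<^sup>+\<^sup>+ s s'" "sim ar rules False s' T P" for s' T P
    proof -
      have "\<exists>S'. lred\<^sup>+\<^sup>+ S' S \<and> lsub S' s'"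
        using that(1)
      proof (induction rule: tranclp_induct)
        case (base s1)
        then show ?case using lsub_red[OF less.prems(1)] by blast
      next
        case (step s1 s2)
        then obtain S1 where "lred\<^sup>+\<^sup>+ S1 S" "lsub S1 s1" by blast
        moreover obtain S2 where "lred S2 S1" "lsub S2 s2" using lsub_red[OF \<open>lsub S1 s1\<close> step(2)] by blast
        ultimately show ?case using tranclp_into_tranclp2[of lred S2 S1 S] by blast
      qed
      then show ?thesis using IH that(2) by blast
    qed
    have red_lred: "lred\<^sup>*\<^sup>* t a" if "(red rules)\<^sup>*\<^sup>* a t" for a t
      using that by induction (auto intro: converse_rtranclp_into_rtranclp)
    have cond: "hsn u" if "lstep_cond rules s a" "lsteps rules a v c" "sim ar rules False v u P" for a v c u P
    proof -
      have "lred a S" using lsub_cond[OF less.prems(1) that(1)] by blast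
      then have "lred\<^sup>+\<^sup>+ v S" using red_lred[OF lsteps_imp_rtranclp[OF that(2)]] by (rule rtranclp_into_tranclp1[rotated])
      then show ?thesis using IH[OF _ lsub_refl that(3)] by blast
    qed
    from less.prems(2) show ?case
    proof (cases rule: sim.cases)
      case (sim_fun ss f Ts R p)
      have args: "hsn ((Ts @ flags rules f R) ! k)" if k: "k < ar f" for k
      proof -
        have "lsub s (ss ! k)" unfolding sim_fun(1) by (rule lsub_arg[OF _ lsub_refl]) (use k sim_fun in simp)
        then have "lsub S (ss ! k)" by (rule lsub_trans[OF less.prems(1)])
        moreover have "size (ss ! k) < size s"
          using k sim_fun size_list_estimation'[OF nth_mem, of k ss "size (ss ! k)" size] by simp
        ultimately show ?thesis using less.hyps[of "ss ! k" "Ts ! k" "p k"] k sim_fun by (simp add: nth_append)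
      qed
      show ?thesis unfolding sim_fun(2)
        by (rule sim_orig_hsn[OF less.prems(2)[unfolded sim_fun(2)]]) (blast intro: args progress cond)+
    next
      case (sim_cond i f ls r cs R j \<sigma>' \<sigma> p k v d u Pu)
      show ?thesis unfolding sim_cond(2)
        by (rule sim_cond_hsn[OF less.prems(2)[unfolded sim_cond(2)]]) (blast intro: progress cond)+
    qed
  qed
  show ?case using accI.prems IH base rtranclpD[OF accI.prems(1)] by blast
qed

end

theorem theorem5:
  fixes ar :: "'f \<Rightarrow> nat"
    and rules :: "'f \<Rightarrow> ('f, 'v) crule list"
    and s :: "('f, 'v) lterm"
  assumes "infinite (UNIV :: 'v set)"
    and "strong_cctrs ar rules"
    and "wf_lterm ar rules s"
    and "vars s = {}"
  shows "(hterminating ar rules (zeta rules s) \<and> hsteps ar rules (zeta rules s) t N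
            \<longrightarrow> (\<exists>t' c. lsteps rules s t' c \<and> N \<le> c))
       \<and> (hinf ar rules (zeta rules s) \<longrightarrow> linf rules s)"
proof -
  interpret cctrs ar rules by unfold_locales (fact assms)+
  \<comment> \<open>Both values of \<open>w\<close> are used: \<open>True\<close> for the cost bound
    and \<open>False\<close> for infinite reductions.\<close>
  have sim: "sim ar rules w s (zeta rules s) 0" for w using sim_zeta assms(3,4) by blast
  show ?thesis
  proof (intro conjI impI)
    assume *: "hterminating ar rules (zeta rules s) \<and> hsteps ar rules (zeta rules s) t N"
    have "hsn (zeta rules s)"
    proof (rule ccontr)
      assume "\<not> hsn (zeta rules s)"
      then obtain g where "g 0 = zeta rules s" "\<And>i. \<exists>c. hst ar rules (g i) (g (Suc i)) c"
        by (rule not_accp_chain) blast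
      then have "hinf ar rules (zeta rules s)" unfolding hinf_def hstep_iff_hst by blast
      then show False using * by (simp add: hterminating_def)
    qed
    then show "\<exists>t' c. lsteps rules s t' c \<and> N \<le> c"
      using hsteps_simulated[OF conjunct2[OF *] _ sim] by simp
  next
    assume inf: "hinf ar rules (zeta rules s)"
    show "linf rules s"
    proof (rule ccontr)
      assume "\<not> linf rules s"
      have "Wellfounded.accp lred s"
      proof (rule ccontr)
        assume "\<not> Wellfounded.accp lred s"
        then obtain g where "g 0 = s" "\<And>i. red rules (g i) (g (Suc i)) \<or> lstep_cond rules (g i) (g (Suc i))"
          by (rule not_accp_chain) blast
        then show False using \<open>\<not> linf rules s\<close> unfolding linf_def by blast
      qed
      then have "hsn (zeta rules s)"
        using accp_lred_imp_hsn[OF _ rtranclp.rtrancl_refl lsub_refl sim] by blast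
      moreover obtain g where "g 0 = zeta rules s" "\<And>i. \<exists>c. hst ar rules (g i) (g (Suc i)) c"
        using inf unfolding hinf_def hstep_iff_hst by blast
      ultimately show False using accp_no_chain[of _ "zeta rules s" g] by auto
    qed
  qed
qed

end
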